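(* Let $r\ge2$ be an integer and $T>0$. Suppose that the initial-boundary-value problem $$m=u-u_{xx},\qquad m_t+um_x+2u_xm=0,\qquad 0\le x\le1,\ 0\le t\le T,$$ $$m(0,t)=m(1,t)=u(0,t)=u(1,t)=0,\qquad 0\le t\le T,$$ $$u(x,0)=u_0(x),\qquad m(x,0)=m_0(x),\qquad 0\le x\le1,$$ where $m_0=u_0-u_0''$, has a unique solution $(m,u)$ with $m\in C(0,T;C^{r-2}\cap\mathring H^1)$ and $u\in C(0,T;C^r\cap\mathring H^1)$, which is smooth enough for the purposes of the error estimation. Let $S_h=S_h^{r,\mu}\cap\mathring H^1$, $0\le\mu\le r-2$, be the finite element space on a quasiuniform partition of $[0,1]$ with maximum meshlength $h$, with $h$ sufficiently small, and let $m_h,u_h:[0,T]\to S_h$ be the solution of the semidiscrete problem: for $0\le t\le T$ $$(m_h,\phi)=A(u_h,\phi)\qquad\forall\phi\in S_h,$$ $$(m_{ht},\chi)=-(u_hm_{hx},\chi)-2(u_{hx}m_h,\chi)\qquad\forall\chi\in S_h,$$ with initial conditions $$m_h(0)=P_h(u_0-u_0''),\qquad u_h(0)=R_hu_0.$$ Then $$\max_{0\le t\le T}\|u(t)-u_h(t)\|\le Ch^{r-1/2},$$ with $C$ a constant independent of $h$.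
   Context: Notation: $(\cdot,\cdot)$ and $\|\cdot\|$ are the inner product and norm of $L^2=L^2(0,1)$; $\mathring H^1$ is the subspace of $H^1=H^1(0,1)$ of functions vanishing at $x=0$ and $x=1$; $C^k$ denotes the $k$-times continuously differentiable functions on $[0,1]$; $C(0,T;X)$ denotes the continuous maps from $[0,T]$ into $X$. For $v,w\in\mathring H^1$, $A(v,w)=(v,w)+(v',w')$. "Smooth enough" means having as many continuous derivatives (in $x$ and $t$) as needed for the estimate. Finite element spaces: $0=x_1<x_2<\dots<x_{N+1}=1$ is a partition of $[0,1]$ with maximum meshlength $h$, belonging to a quasiuniform family (the ratio of maximum to minimum meshlength is bounded independently of $h$). For integers $r\ge2$, $0\le\mu\le r-2$, $$S_h^{r,\mu}=\{\phi\in C^\mu[0,1]:\ \phi|_{[x_i,x_{i+1}]}\in\mathbb P_{r-1},\ i=1,\dots,N\},\qquad S_h=S_h^{r,\mu}\cap\mathring H^1,$$ where $\mathbb P_{r-1}$ is the set of polynomials of degree at most $r-1$. $P_h:L^2\to S_h$ is the $L^2$-projection onto $S_h$, and $R_h:\mathring H^1\to S_h$ is the elliptic projection: $A(R_hv,\phi)=A(v,\phi)$ for all $\phi\in S_h$. For $h$ sufficiently small the semidiscrete problem has a unique solution on $[0,T]$. *)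

theory Defs
  imports "HOL-Analysis.Analysis"
begin

text \<open>
  Functions on $[0,1]$ are total functions \<open>real \<Rightarrow> real\<close> whose values outside $[0,1]$ never matter.
  Time-dependent functions are curried with time first: \<open>u t x\<close> stands for $u(x,t)$, so that \<open>u t\<close> is
  an element of a function space on $[0,1]$.
\<close>

section \<open>Derivatives\<close>

text \<open>
  One-sided at the ends of the interval.  For piecewise polynomials \<open>Dx\<close> takes unspecified values at
  the finitely many points of non-differentiability; inside integrals these are irrelevant.
\<close>

definition Dx :: "(real \<Rightarrow> real) \<Rightarrow> real \<Rightarrow> real" where
  "Dx v x = vector_derivative v (at x within {0..1})"

definition Dt :: "real \<Rightarrow> (real \<Rightarrow> real \<Rightarrow> real) \<Rightarrow> real \<Rightarrow> real \<Rightarrow> real" where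
  "Dt T v t x = vector_derivative (\<lambda>s. v s x) (at t within {0..T})"

definition Ck :: "nat \<Rightarrow> (real \<Rightarrow> real) set" where
  "Ck k = {v. (\<forall>j<k. \<forall>x\<in>{0..1}. (Dx ^^ j) v differentiable (at x within {0..1})) \<and>
              (\<forall>j\<le>k. continuous_on {0..1} ((Dx ^^ j) v))}"

text \<open>All partial derivatives in $x$ and $t$ of order at most \<open>k\<close>, taken in any order, exist and are
  continuous on $[0,1] \times [0,T]$.\<close>

primrec Ck_xt :: "real \<Rightarrow> nat \<Rightarrow> (real \<Rightarrow> real \<Rightarrow> real) \<Rightarrow> bool" where
  "Ck_xt T 0 v \<longleftrightarrow> continuous_on ({0..T} \<times> {0..1}) (\<lambda>(t, x). v t x)"
| "Ck_xt T (Suc k) v \<longleftrightarrow>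
     continuous_on ({0..T} \<times> {0..1}) (\<lambda>(t, x). v t x) \<and>
     (\<forall>t\<in>{0..T}. \<forall>x\<in>{0..1}. v t differentiable (at x within {0..1}) \<and>
                           (\<lambda>s. v s x) differentiable (at t within {0..T})) \<and>
     Ck_xt T k (\<lambda>t. Dx (v t)) \<and> Ck_xt T k (Dt T v)"

section \<open>Function spaces on the unit interval\<close>

definition L2 :: "(real \<Rightarrow> real) set" where
  "L2 = {v. set_borel_measurable lebesgue {0..1} v \<and>
            set_integrable lebesgue {0..1} (\<lambda>x. (v x)\<^sup>2)}"

definition L2_inner :: "(real \<Rightarrow> real) \<Rightarrow> (real \<Rightarrow> real) \<Rightarrow> real" where
  "L2_inner v w = (LINT x:{0..1}|lebesgue. v x * w x)"

definition L2_norm :: "(real \<Rightarrow> real) \<Rightarrow> real" where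
  "L2_norm v = sqrt (L2_inner v v)"

text \<open>
  Elements of $H^1(0,1)$ are represented by their absolutely continuous representatives, so that
  boundary values make sense; the function \<open>g\<close> below is the weak derivative of \<open>v\<close>, and it agrees
  almost everywhere with \<open>Dx v\<close>.
\<close>

definition H1 :: "(real \<Rightarrow> real) set" where
  "H1 = {v. \<exists>g\<in>L2. \<forall>x\<in>{0..1}. v x = v 0 + (LINT y:{0..x}|lebesgue. g y)}"

definition H10 :: "(real \<Rightarrow> real) set" where
  "H10 = {v \<in> H1. v 0 = 0 \<and> v 1 = 0}"

definition A_form :: "(real \<Rightarrow> real) \<Rightarrow> (real \<Rightarrow> real) \<Rightarrow> real" where
  "A_form v w = L2_inner v w + L2_inner (Dx v) (Dx w)"

definition H1_norm :: "(real \<Rightarrow> real) \<Rightarrow> real" where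
  "H1_norm v = sqrt (A_form v v)"

text \<open>The space $C(0,T;C^k \cap \mathring H^1)$: continuity in time is with respect to the maximum
  norms of the derivatives of order at most \<open>k\<close> and (relevant only for \<open>k = 0\<close>) the $H^1$ norm.\<close>

definition CT_Ck_H10 :: "real \<Rightarrow> nat \<Rightarrow> (real \<Rightarrow> real \<Rightarrow> real) set" where
  "CT_Ck_H10 T k = {v.
     (\<forall>t\<in>{0..T}. v t \<in> Ck k \<inter> H10) \<and>
     (\<forall>t\<in>{0..T}. \<forall>j\<le>k.
        uniform_limit {0..1} (\<lambda>s. (Dx ^^ j) (v s)) ((Dx ^^ j) (v t)) (at t within {0..T})) \<and>
     (\<forall>t\<in>{0..T}. ((\<lambda>s. H1_norm (\<lambda>x. v s x - v t x)) \<longlongrightarrow> 0) (at t within {0..T}))}"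

section \<open>The initial-boundary-value problem\<close>

definition ibvp_solution ::
  "nat \<Rightarrow> real \<Rightarrow> (real \<Rightarrow> real) \<Rightarrow> (real \<Rightarrow> real) \<Rightarrow>
   (real \<Rightarrow> real \<Rightarrow> real) \<Rightarrow> (real \<Rightarrow> real \<Rightarrow> real) \<Rightarrow> bool" where
  "ibvp_solution r T u0 m0 m u \<longleftrightarrow>
     m \<in> CT_Ck_H10 T (r - 2) \<and> u \<in> CT_Ck_H10 T r \<and>
     (\<forall>t\<in>{0..T}. \<forall>x\<in>{0..1}.
        m t differentiable (at x within {0..1}) \<and>
        (\<lambda>s. m s x) differentiable (at t within {0..T}) \<and>
        m t x = u t x - Dx (Dx (u t)) x \<and>
        Dt T m t x + u t x * Dx (m t) x + 2 * Dx (u t) x * m t x = 0) \<and>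
     (\<forall>t\<in>{0..T}. m t 0 = 0 \<and> m t 1 = 0 \<and> u t 0 = 0 \<and> u t 1 = 0) \<and>
     (\<forall>x\<in>{0..1}. u 0 x = u0 x \<and> m 0 x = m0 x)"

definition ibvp_unique_solution ::
  "nat \<Rightarrow> real \<Rightarrow> (real \<Rightarrow> real) \<Rightarrow> (real \<Rightarrow> real) \<Rightarrow>
   (real \<Rightarrow> real \<Rightarrow> real) \<Rightarrow> (real \<Rightarrow> real \<Rightarrow> real) \<Rightarrow> bool" where
  "ibvp_unique_solution r T u0 m0 m u \<longleftrightarrow>
     ibvp_solution r T u0 m0 m u \<and>
     (\<forall>m' u'. ibvp_solution r T u0 m0 m' u' \<longrightarrow>
        (\<forall>t\<in>{0..T}. \<forall>x\<in>{0..1}. m' t x = m t x \<and> u' t x = u t x))"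

section \<open>Finite element spaces\<close>

text \<open>The nodes of a partition are \<open>z 1, \<dots>, z (N + 1)\<close>.\<close>

definition partition_01 :: "nat \<Rightarrow> (nat \<Rightarrow> real) \<Rightarrow> bool" where
  "partition_01 N z \<longleftrightarrow> N \<ge> 1 \<and> z 1 = 0 \<and> z (N + 1) = 1 \<and> (\<forall>i\<in>{1..N}. z i < z (i + 1))"

definition max_mesh :: "nat \<Rightarrow> (nat \<Rightarrow> real) \<Rightarrow> real" where
  "max_mesh N z = Max ((\<lambda>i. z (i + 1) - z i) ` {1..N})"

definition min_mesh :: "nat \<Rightarrow> (nat \<Rightarrow> real) \<Rightarrow> real" where
  "min_mesh N z = Min ((\<lambda>i. z (i + 1) - z i) ` {1..N})"

definition quasiuniform_family :: "(nat \<times> (nat \<Rightarrow> real)) set \<Rightarrow> bool" where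
  "quasiuniform_family F \<longleftrightarrow>
     (\<forall>(N, z)\<in>F. partition_01 N z) \<and> (\<exists>\<kappa>. \<forall>(N, z)\<in>F. max_mesh N z / min_mesh N z \<le> \<kappa>)"

definition fe_space :: "nat \<Rightarrow> nat \<Rightarrow> nat \<Rightarrow> (nat \<Rightarrow> real) \<Rightarrow> (real \<Rightarrow> real) set" where
  "fe_space r \<mu> N z = {\<phi> \<in> Ck \<mu>.
     \<forall>i\<in>{1..N}. \<exists>p :: real poly. degree p \<le> r - 1 \<and> (\<forall>x\<in>{z i..z (i + 1)}. \<phi> x = poly p x)}"

definition fe_space0 :: "nat \<Rightarrow> nat \<Rightarrow> nat \<Rightarrow> (nat \<Rightarrow> real) \<Rightarrow> (real \<Rightarrow> real) set" where
  "fe_space0 r \<mu> N z = fe_space r \<mu> N z \<inter> H10"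

text \<open>The projections are given as relations (\<open>w\<close> is the projection of \<open>v\<close> onto \<open>S\<close>), because
  elements of \<open>S\<close> are determined only on $[0,1]$.\<close>

definition is_L2_projection ::
  "(real \<Rightarrow> real) set \<Rightarrow> (real \<Rightarrow> real) \<Rightarrow> (real \<Rightarrow> real) \<Rightarrow> bool" where
  "is_L2_projection S v w \<longleftrightarrow> w \<in> S \<and> (\<forall>\<phi>\<in>S. L2_inner w \<phi> = L2_inner v \<phi>)"

definition is_elliptic_projection ::
  "(real \<Rightarrow> real) set \<Rightarrow> (real \<Rightarrow> real) \<Rightarrow> (real \<Rightarrow> real) \<Rightarrow> bool" where
  "is_elliptic_projection S v w \<longleftrightarrow> w \<in> S \<and> (\<forall>\<phi>\<in>S. A_form w \<phi> = A_form v \<phi>)"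

section \<open>The semidiscrete problem\<close>

text \<open>As \<open>S\<close> will be finite-dimensional, differentiability of $m_h : [0,T] \to S$ amounts to
  differentiability in time at every point \<open>x\<close>, with the same derivative.\<close>

definition semidiscrete_solution ::
  "real \<Rightarrow> (real \<Rightarrow> real) set \<Rightarrow> (real \<Rightarrow> real) \<Rightarrow>
   (real \<Rightarrow> real \<Rightarrow> real) \<Rightarrow> (real \<Rightarrow> real \<Rightarrow> real) \<Rightarrow> bool" where
  "semidiscrete_solution T S u0 mh uh \<longleftrightarrow>
     (\<forall>t\<in>{0..T}. mh t \<in> S \<and> uh t \<in> S) \<and>
     (\<forall>t\<in>{0..T}. \<forall>x\<in>{0..1}. (\<lambda>s. mh s x) differentiable (at t within {0..T})) \<and>
     (\<forall>t\<in>{0..T}. \<forall>\<phi>\<in>S. L2_inner (mh t) \<phi> = A_form (uh t) \<phi>) \<and>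
     (\<forall>t\<in>{0..T}. \<forall>\<psi>\<in>S. L2_inner (Dt T mh t) \<psi> =
        - L2_inner (\<lambda>x. uh t x * Dx (mh t) x) \<psi> - 2 * L2_inner (\<lambda>x. Dx (uh t) x * mh t x) \<psi>) \<and>
     is_L2_projection S (\<lambda>x. u0 x - Dx (Dx u0) x) (mh 0) \<and>
     is_elliptic_projection S u0 (uh 0)"

end

theory Submission
  imports Defs
begin

text \<open>
  Write \<open>\<theta> = P\<^sub>h m - m\<^sub>h\<close>, \<open>\<xi> = R\<^sub>h u - u\<^sub>h\<close>, so that \<open>(\<theta>, \<phi>) = A(\<xi>, \<phi>)\<close> for all \<open>\<phi>\<close> in the finite
  element space.  Testing the error equation with \<open>\<theta>\<close> gives \<open>\<parallel>\<theta>\<parallel> = O(h ^ (r - 1))\<close>; the required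
  maximum norm bound of the derivative of \<open>u\<^sub>h\<close> holds as long as \<open>\<parallel>\<theta>\<parallel>\<^sup>2 \<le> h\<close>, and a continuation
  argument shows that this persists up to time \<open>T\<close>.  Testing with \<open>\<xi>\<close> instead gives an energy
  estimate for the \<open>H1\<close> norm of \<open>\<xi>\<close>.  Its critical term \<open>(\<theta>, u \<xi>')\<close> is treated by replacing \<open>\<xi>\<close> with
  the solution \<open>v\<close> of \<open>v - v'' = \<theta>\<close>, whose elliptic projection is \<open>\<xi>\<close>: for \<open>v\<close> the term can be
  integrated by parts, and the replacement costs \<open>\<parallel>\<theta>\<parallel> h \<parallel>\<theta>\<parallel> = O(h ^ (2 r - 1))\<close>, which is where the
  exponent \<open>r - 1/2\<close> comes from.

  Approximation in the smoothest spline space, which lies in all the spaces considered, is proved by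
  induction on the order: integrating the \<open>L2\<close> projection of \<open>v'\<close> onto splines of order \<open>r\<close> gives a
  spline of order \<open>r + 1\<close> with the boundary values of \<open>v\<close>, and duality gains the missing power of \<open>h\<close>.
\<close>

section \<open>Integration on the unit interval and piecewise differentiable functions\<close>

definition int01 :: "(real \<Rightarrow> real) \<Rightarrow> real" where
  "int01 f = integral\<^sup>L (lebesgue_on {0..1}) f"

definition bmeas :: "(real \<Rightarrow> real) \<Rightarrow> bool" where
  "bmeas f \<longleftrightarrow> f \<in> borel_measurable (lebesgue_on {0..1}) \<and> (\<exists>B. \<forall>x\<in>{0..1}. \<bar>f x\<bar> \<le> B)"

lemma bmeasE:
  assumes "bmeas f"
  obtains B where "B \<ge> 0" "\<And>x. x \<in> {0..1} \<Longrightarrow> \<bar>f x\<bar> \<le> B"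
proof -
  obtain B where B: "\<forall>x\<in>{0..1}. \<bar>f x\<bar> \<le> B"
    using assms by (auto simp: bmeas_def)
  then have "\<bar>f 0\<bar> \<le> B" by simp
  then have "0 \<le> B" by linarith
  with B show ?thesis
    by (intro that[of B]) auto
qed

lemma bmeas_const [simp]: "bmeas (\<lambda>x. c)"
  by (auto simp: bmeas_def)

lemma bmeas_add [simp]:
  assumes "bmeas f" "bmeas g"
  shows "bmeas (\<lambda>x. f x + g x)"
proof -
  obtain A B where "A \<ge> 0" and AB: "\<And>x. x \<in> {0..1} \<Longrightarrow> \<bar>f x\<bar> \<le> A" "\<And>x. x \<in> {0..1} \<Longrightarrow> \<bar>g x\<bar> \<le> B"
    by (metis bmeasE[OF assms(1)] bmeasE[OF assms(2)])
  have "\<bar>f x + g x\<bar> \<le> A + B" if "x \<in> {0..1}" for x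
    using AB[OF that] by linarith
  then have "\<exists>B. \<forall>x\<in>{0..1}. \<bar>f x + g x\<bar> \<le> B" by blast
  moreover have "(\<lambda>x. f x + g x) \<in> borel_measurable (lebesgue_on {0..1})"
    using assms by (auto simp: bmeas_def)
  ultimately show ?thesis
    by (simp add: bmeas_def)
qed

lemma bmeas_mult [simp]:
  assumes "bmeas f" "bmeas g"
  shows "bmeas (\<lambda>x. f x * g x)"
proof -
  obtain A B where "A \<ge> 0" and AB: "\<And>x. x \<in> {0..1} \<Longrightarrow> \<bar>f x\<bar> \<le> A" "\<And>x. x \<in> {0..1} \<Longrightarrow> \<bar>g x\<bar> \<le> B"
    by (metis bmeasE[OF assms(1)] bmeasE[OF assms(2)])
  have "\<bar>f x * g x\<bar> \<le> A * B" if "x \<in> {0..1}" for x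
    unfolding abs_mult using AB[OF that] \<open>A \<ge> 0\<close> by (intro mult_mono) auto
  then have "\<exists>B. \<forall>x\<in>{0..1}. \<bar>f x * g x\<bar> \<le> B" by blast
  moreover have "(\<lambda>x. f x * g x) \<in> borel_measurable (lebesgue_on {0..1})"
    using assms by (auto simp: bmeas_def)
  ultimately show ?thesis
    by (simp add: bmeas_def)
qed

lemma bmeas_minus [simp]: "bmeas f \<Longrightarrow> bmeas (\<lambda>x. - f x)"
  using bmeas_mult[of "\<lambda>_. -1" f] by simp

lemma bmeas_diff [simp]: "bmeas f \<Longrightarrow> bmeas g \<Longrightarrow> bmeas (\<lambda>x. f x - g x)"
  using bmeas_add[of f "\<lambda>x. - g x"] by simp

lemma bmeas_divide [simp]: "bmeas f \<Longrightarrow> bmeas (\<lambda>x. f x / c)"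
  using bmeas_mult[of f "\<lambda>_. inverse c"] by (simp add: field_simps)

lemma bmeas_power [simp]: "bmeas f \<Longrightarrow> bmeas (\<lambda>x. f x ^ n)"
  by (induction n) simp_all

lemma bmeas_sum [simp]: "(\<And>i. i \<in> A \<Longrightarrow> bmeas (f i)) \<Longrightarrow> bmeas (\<lambda>x. \<Sum>i\<in>A. f i x)"
  by (induction A rule: infinite_finite_induct) simp_all

lemma bmeas_continuous:
  assumes "continuous_on {0..1} f"
  shows "bmeas f"
proof -
  have "bounded (f ` {0..1})"
    using assms by (intro compact_imp_bounded compact_continuous_image) auto
  then have "\<exists>B. \<forall>x\<in>{0..1}. \<bar>f x\<bar> \<le> B"
    by (simp add: bounded_iff)
  moreover have "f \<in> borel_measurable (lebesgue_on {0..1})"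
    using assms by (intro continuous_imp_measurable_on_sets_lebesgue) auto
  ultimately show ?thesis
    by (simp add: bmeas_def)
qed

lemma bmeas_indicator [simp]: "bmeas (indicator {a..b})" "bmeas (indicator {a..<b})"
    "bmeas (\<lambda>x. indicator {a..b} x)" "bmeas (\<lambda>x. indicator {a..<b} x)"
  unfolding bmeas_def
  by (auto intro!: exI[of _ 1] borel_measurable_indicator measurable_restrict_space1
      simp: indicator_def)

lemma bmeas_cong_finite:
  assumes "finite S" "\<And>x. x \<in> {0..1} - S \<Longrightarrow> f x = g x" "bmeas f"
  shows "bmeas g"
proof -
  obtain B where B: "B \<ge> 0" "\<And>x. x \<in> {0..1} \<Longrightarrow> \<bar>f x\<bar> \<le> B"
    using bmeasE[OF assms(3)] by blast
  have "g \<in> borel_measurable (lebesgue_on {0..1})"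
    by (rule measurable_discrete_difference[where f = f and X = "S \<inter> {0..1}"])
       (use assms in \<open>auto simp: bmeas_def sets_restrict_space_iff intro: countable_finite\<close>)
  moreover have "\<bar>g x\<bar> \<le> B + (\<Sum>y\<in>S. \<bar>g y\<bar>)" if x: "x \<in> {0..1}" for x
  proof (cases "x \<in> S")
    case True
    then have "\<bar>g x\<bar> \<le> (\<Sum>y\<in>S. \<bar>g y\<bar>)"
      using assms(1) by (intro member_le_sum) auto
    then show ?thesis using B(1) by simp
  next
    case False
    have "0 \<le> (\<Sum>y\<in>S. \<bar>g y\<bar>)" by (simp add: sum_nonneg)
    moreover have "\<bar>g x\<bar> \<le> B" using False B(2)[OF x] assms(2)[of x] x by auto
    ultimately show ?thesis by linarith
  qed
  ultimately show ?thesis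
    unfolding bmeas_def by blast
qed

lemma bmeas_integrable: "bmeas f \<Longrightarrow> integrable (lebesgue_on {0..1}) f"
  unfolding bmeas_def
  by (auto intro!: finite_measure.integrable_const_bound finite_measure_lebesgue_on AE_I2)

lemma int01_cong_finite:
  assumes "finite S" "\<And>x. x \<in> {0..1} - S \<Longrightarrow> f x = g x"
  shows "int01 f = int01 g"
  unfolding int01_def
  by (rule integral_discrete_difference[where X = "S \<inter> {0..1}"])
     (use assms in \<open>auto simp: sets_restrict_space_iff emeasure_restrict_space intro: countable_finite\<close>)

lemma int01_cong: "(\<And>x. x \<in> {0..1} \<Longrightarrow> f x = g x) \<Longrightarrow> int01 f = int01 g"
  by (rule int01_cong_finite[of "{}"]) auto

lemma L2_inner_int01: "L2_inner v w = int01 (\<lambda>x. v x * w x)"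
  by (simp add: L2_inner_def int01_def set_lebesgue_integral_def integral_restrict_space)

lemma int01_add: "bmeas f \<Longrightarrow> bmeas g \<Longrightarrow> int01 (\<lambda>x. f x + g x) = int01 f + int01 g"
  by (simp add: int01_def bmeas_integrable)

lemma int01_diff: "bmeas f \<Longrightarrow> bmeas g \<Longrightarrow> int01 (\<lambda>x. f x - g x) = int01 f - int01 g"
  by (simp add: int01_def bmeas_integrable)

lemma int01_cmult: "int01 (\<lambda>x. c * f x) = c * int01 f"
  by (simp add: int01_def)

lemma int01_minus: "int01 (\<lambda>x. - f x) = - int01 f"
  by (simp add: int01_def)

lemma int01_sum: "(\<And>i. i \<in> A \<Longrightarrow> bmeas (f i)) \<Longrightarrow> int01 (\<lambda>x. \<Sum>i\<in>A. f i x) = (\<Sum>i\<in>A. int01 (f i))"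
  unfolding int01_def by (intro Bochner_Integration.integral_sum bmeas_integrable)

lemma int01_nonneg: "(\<And>x. x \<in> {0..1} \<Longrightarrow> 0 \<le> f x) \<Longrightarrow> 0 \<le> int01 f"
  unfolding int01_def by (intro integral_nonneg_AE AE_I2) simp

lemma int01_mono:
  "bmeas f \<Longrightarrow> bmeas g \<Longrightarrow> (\<And>x. x \<in> {0..1} \<Longrightarrow> f x \<le> g x) \<Longrightarrow> int01 f \<le> int01 g"
  unfolding int01_def by (intro integral_mono bmeas_integrable) auto

lemma int01_const: "int01 (\<lambda>x. c) = c"
  by (simp add: int01_def measure_restrict_space)

lemma int01_abs_le:
  assumes "bmeas f" "bmeas g" "\<And>x. x \<in> {0..1} \<Longrightarrow> \<bar>f x\<bar> \<le> g x"
  shows "\<bar>int01 f\<bar> \<le> int01 g"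
proof -
  have "f x \<le> g x" "- g x \<le> f x" if "x \<in> {0..1}" for x
    using assms(3)[OF that] by auto
  then have "int01 f \<le> int01 g" "int01 (\<lambda>x. - g x) \<le> int01 f"
    by (intro int01_mono; simp add: assms)+
  then show ?thesis
    by (simp add: int01_minus)
qed

lemma int01_indicator_has_integral:
  assumes "bmeas f" "0 \<le> a" "a \<le> b" "b \<le> 1" "(f has_integral J) {a..b}"
  shows "int01 (\<lambda>x. indicator {a..b} x * f x) = J"
proof -
  have "int01 (\<lambda>x. indicator {a..b} x * f x) = integral {0..1} (\<lambda>x. indicator {a..b} x * f x)"
    unfolding int01_def using assms(1)
    by (intro lebesgue_integral_eq_integral bmeas_integrable) simp_all
  also have "\<dots> = integral {0..1} (\<lambda>x. if x \<in> {a..b} then f x else 0)"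
    by (intro integral_cong) (simp add: indicator_def)
  also have "\<dots> = integral {a..b} f"
    using assms by (intro integral_restrict_Int[THEN trans] arg_cong2[of _ _ _ _ integral]) auto
  finally show ?thesis
    using assms(5) by (simp add: integral_unique)
qed

definition wderiv :: "(real \<Rightarrow> real) \<Rightarrow> (real \<Rightarrow> real) \<Rightarrow> bool" where
  "wderiv v g \<longleftrightarrow> continuous_on {0..1} v \<and> bmeas g \<and>
     (\<exists>S. finite S \<and> (\<forall>x\<in>{0..1} - S. (v has_real_derivative g x) (at x within {0..1})))"

lemma wderivI:
  assumes "continuous_on {0..1} v" "bmeas g" "finite S"
    "\<And>x. x \<in> {0..1} - S \<Longrightarrow> (v has_real_derivative g x) (at x within {0..1})"
  shows "wderiv v g"
  using assms unfolding wderiv_def by auto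

lemma wderivE:
  assumes "wderiv v g"
  obtains S where "finite S"
    "\<forall>x\<in>{0..1} - S. (v has_real_derivative g x) (at x within {0..1})"
  using assms unfolding wderiv_def by blast

lemma wderiv_bmeas: "wderiv v g \<Longrightarrow> bmeas v" "wderiv v g \<Longrightarrow> bmeas g"
  by (auto simp: wderiv_def bmeas_continuous)

lemma Dx_eqI:
  assumes "(v has_real_derivative d) (at x within {0..1})" "x \<in> {0..1}"
  shows "Dx v x = d"
  unfolding Dx_def using assms
  by (intro vector_derivative_within_closed_interval)
     (auto simp: has_real_derivative_iff_has_vector_derivative)

lemma wderiv_C1:
  assumes "\<And>x. x \<in> {0..1} \<Longrightarrow> (v has_real_derivative g x) (at x within {0..1})"
    "continuous_on {0..1} g"
  shows "wderiv v g"
  by (rule wderivI[of _ _ "{}"])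
     (use assms DERIV_continuous_on[of "{0..1}" v g] in \<open>auto intro: bmeas_continuous\<close>)

lemma wderiv_cong_finite:
  assumes "wderiv v g" "finite S" "\<And>x. x \<in> {0..1} - S \<Longrightarrow> g x = g' x"
  shows "wderiv v g'"
proof -
  obtain R where R: "finite R" "\<forall>x\<in>{0..1} - R. (v has_real_derivative g x) (at x within {0..1})"
    using wderivE[OF assms(1)] by blast
  have "(v has_real_derivative g' x) (at x within {0..1})" if "x \<in> {0..1} - (R \<union> S)" for x
    using bspec[OF R(2), of x] assms(3)[of x] that by simp
  then show ?thesis
    using assms R(1) bmeas_cong_finite[of S g g']
    by (intro wderivI[of _ _ "R \<union> S"]) (auto simp: wderiv_def)
qed

lemma wderiv_Dx_eq:
  assumes "wderiv v g"
  obtains S where "finite S" "\<forall>x\<in>{0..1} - S. Dx v x = g x"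
proof -
  obtain R where "finite R" "\<forall>x\<in>{0..1} - R. (v has_real_derivative g x) (at x within {0..1})"
    using wderivE[OF assms(1)] by blast
  then show ?thesis
    by (intro that[of R]) (auto intro: Dx_eqI)
qed

lemma wderiv_cong:
  assumes "wderiv v g" "\<And>x. x \<in> {0..1} \<Longrightarrow> v x = w x"
  shows "wderiv w g"
proof -
  obtain R where "finite R" "\<forall>x\<in>{0..1} - R. (v has_real_derivative g x) (at x within {0..1})"
    using wderivE[OF assms(1)] by blast
  moreover have "continuous_on {0..1} w"
    using assms continuous_on_cong[of "{0..1}" "{0..1}" v w] by (auto simp: wderiv_def)
  ultimately show ?thesis
    using assms
    by (intro wderivI[of _ _ R])
       (auto simp: wderiv_def has_field_derivative_def intro!: has_derivative_transform[of _ _ w v])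
qed

lemma wderiv_const [simp]: "wderiv (\<lambda>x. c) (\<lambda>x. 0)"
  by (rule wderiv_C1) auto

lemma wderiv_add:
  assumes "wderiv v g" "wderiv w k"
  shows "wderiv (\<lambda>x. v x + w x) (\<lambda>x. g x + k x)"
proof -
  obtain R where R: "finite R" "\<forall>x\<in>{0..1} - R. (v has_real_derivative g x) (at x within {0..1})"
    using wderivE[OF assms(1)] by blast
  obtain S where S: "finite S" "\<forall>x\<in>{0..1} - S. (w has_real_derivative k x) (at x within {0..1})"
    using wderivE[OF assms(2)] by blast
  show ?thesis
    using assms R S
    by (intro wderivI[of _ _ "R \<union> S"]) (auto simp: wderiv_def intro!: continuous_intros derivative_intros)
qed

lemma wderiv_mult:
  assumes "wderiv v g" "wderiv w k"
  shows "wderiv (\<lambda>x. v x * w x) (\<lambda>x. g x * w x + v x * k x)"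
proof -
  obtain R where R: "finite R" "\<forall>x\<in>{0..1} - R. (v has_real_derivative g x) (at x within {0..1})"
    using wderivE[OF assms(1)] by blast
  obtain S where S: "finite S" "\<forall>x\<in>{0..1} - S. (w has_real_derivative k x) (at x within {0..1})"
    using wderivE[OF assms(2)] by blast
  have "((\<lambda>x. v x * w x) has_real_derivative g x * w x + v x * k x) (at x within {0..1})"
    if "x \<in> {0..1} - (R \<union> S)" for x
    using DERIV_mult[OF R(2)[rule_format, of x] S(2)[rule_format, of x]] that by (simp add: ac_simps)
  then show ?thesis
    using assms R(1) S(1) wderiv_bmeas[OF assms(1)] wderiv_bmeas[OF assms(2)]
    by (intro wderivI[of _ _ "R \<union> S"]) (auto simp: wderiv_def intro!: continuous_intros)
qed

lemma wderiv_cmult: "wderiv v g \<Longrightarrow> wderiv (\<lambda>x. c * v x) (\<lambda>x. c * g x)"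
  using wderiv_mult[of "\<lambda>x. c" "\<lambda>x. 0" v g] by simp

lemma wderiv_diff: "wderiv v g \<Longrightarrow> wderiv w k \<Longrightarrow> wderiv (\<lambda>x. v x - w x) (\<lambda>x. g x - k x)"
  using wderiv_add[of v g "\<lambda>x. -1 * w x" "\<lambda>x. -1 * k x"] wderiv_cmult[of w k "-1"] by simp

lemma wderiv_sum:
  "finite A \<Longrightarrow> (\<And>i. i \<in> A \<Longrightarrow> wderiv (v i) (g i)) \<Longrightarrow> wderiv (\<lambda>x. \<Sum>i\<in>A. v i x) (\<lambda>x. \<Sum>i\<in>A. g i x)"
  by (induction A rule: finite_induct) (auto intro: wderiv_add)

lemma wderiv_has_integral:
  assumes "wderiv v g" "0 \<le> a" "a \<le> b" "b \<le> 1"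
  shows "(g has_integral (v b - v a)) {a..b}"
proof -
  obtain R where R: "finite R" "\<forall>x\<in>{0..1} - R. (v has_real_derivative g x) (at x within {0..1})"
    using wderivE[OF assms(1)] by blast
  have "(v has_vector_derivative g x) (at x)" if "x \<in> {a<..<b} - R" for x
  proof -
    have "(v has_real_derivative g x) (at x within {0<..<1})"
      using R(2)[rule_format, of x] that assms by (auto intro: DERIV_subset)
    then show ?thesis
      using that assms at_within_open[of x "{0<..<1}"]
      by (auto simp: has_real_derivative_iff_has_vector_derivative)
  qed
  moreover have "continuous_on {a..b} v"
    using assms continuous_on_subset[of "{0..1}" v "{a..b}"] by (auto simp: wderiv_def)
  ultimately show ?thesis
    by (intro fundamental_theorem_of_calculus_interior_strong[OF R(1) assms(3)])
qed

lemma wderiv_int01_indicator: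
  assumes "wderiv v g" "0 \<le> a" "a \<le> b" "b \<le> 1"
  shows "int01 (\<lambda>x. indicator {a..b} x * g x) = v b - v a"
  using assms by (intro int01_indicator_has_integral wderiv_has_integral) (auto simp: wderiv_bmeas)

lemma wderiv_int01:
  assumes "wderiv v g"
  shows "int01 g = v 1 - v 0"
proof -
  have "int01 g = int01 (\<lambda>x. indicator {0..1} x * g x)"
    by (rule int01_cong) simp
  then show ?thesis
    using wderiv_int01_indicator[OF assms, of 0 1] by simp
qed

lemma int01_by_parts:
  assumes "wderiv v g" "wderiv w k" "v 0 * w 0 = 0" "v 1 * w 1 = 0"
  shows "int01 (\<lambda>x. g x * w x) = - int01 (\<lambda>x. v x * k x)"
proof -
  have "int01 (\<lambda>x. g x * w x + v x * k x) = 0"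
    using wderiv_int01[OF wderiv_mult[OF assms(1,2)]] assms(3,4) by simp
  then show ?thesis
    using wderiv_bmeas[OF assms(1)] wderiv_bmeas[OF assms(2)] by (simp add: int01_add)
qed

lemma wderiv_antideriv:
  assumes "continuous_on {0..1} f"
  obtains F where "F 0 = 0" "\<And>x. x \<in> {0..1} \<Longrightarrow> (F has_real_derivative f x) (at x within {0..1})"
proof (rule that[of "\<lambda>x. integral {0..x} f"])
  show "integral {0..0} f = 0" by simp
  show "((\<lambda>x. integral {0..x} f) has_real_derivative f x) (at x within {0..1})" if "x \<in> {0..1}" for x
    using integral_has_real_derivative[OF assms that] .
qed

section \<open>Semi-inner products and projections\<close>

locale semi_inner =
  fixes W :: "(real \<Rightarrow> real) set" and B :: "(real \<Rightarrow> real) \<Rightarrow> (real \<Rightarrow> real) \<Rightarrow> real"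
  assumes zero_mem [simp]: "(\<lambda>x. 0) \<in> W"
    and add_mem [simp]: "f \<in> W \<Longrightarrow> g \<in> W \<Longrightarrow> (\<lambda>x. f x + g x) \<in> W"
    and cmult_mem [simp]: "f \<in> W \<Longrightarrow> (\<lambda>x. c * f x) \<in> W"
    and B_add: "f \<in> W \<Longrightarrow> g \<in> W \<Longrightarrow> h \<in> W \<Longrightarrow> B (\<lambda>x. f x + g x) h = B f h + B g h"
    and B_cmult: "f \<in> W \<Longrightarrow> h \<in> W \<Longrightarrow> B (\<lambda>x. c * f x) h = c * B f h"
    and B_sym: "f \<in> W \<Longrightarrow> g \<in> W \<Longrightarrow> B f g = B g f"
    and B_psd: "f \<in> W \<Longrightarrow> 0 \<le> B f f"
    and B_cong: "f \<in> W \<Longrightarrow> g \<in> W \<Longrightarrow> h \<in> W \<Longrightarrow> (\<And>x. x \<in> {0..1} \<Longrightarrow> f x = g x) \<Longrightarrow> B f h = B g h"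
begin

lemma diff_mem [simp]:
  assumes "f \<in> W" "g \<in> W"
  shows "(\<lambda>x. f x - g x) \<in> W"
  using add_mem[OF assms(1) cmult_mem[OF assms(2), of "-1"]] by simp

lemma sum_mem [simp]: "(\<And>k. k \<in> K \<Longrightarrow> b k \<in> W) \<Longrightarrow> (\<lambda>x. \<Sum>k\<in>K. b k x) \<in> W"
  by (induction K rule: infinite_finite_induct) simp_all

lemma B_diff:
  assumes "f \<in> W" "g \<in> W" "h \<in> W"
  shows "B (\<lambda>x. f x - g x) h = B f h - B g h"
  using B_add[OF assms(1) cmult_mem[OF assms(2), of "-1"] assms(3)] B_cmult[OF assms(2,3), of "-1"] by simp

lemma B_add_right: "f \<in> W \<Longrightarrow> g \<in> W \<Longrightarrow> h \<in> W \<Longrightarrow> B h (\<lambda>x. f x + g x) = B h f + B h g"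
  by (simp add: B_sym[of h] B_add)

lemma B_cmult_right: "f \<in> W \<Longrightarrow> h \<in> W \<Longrightarrow> B h (\<lambda>x. c * f x) = c * B h f"
  by (simp add: B_sym[of h] B_cmult)

lemma B_diff_right: "f \<in> W \<Longrightarrow> g \<in> W \<Longrightarrow> h \<in> W \<Longrightarrow> B h (\<lambda>x. f x - g x) = B h f - B h g"
  by (simp add: B_sym[of h] B_diff)

lemma B_sum:
  assumes "\<And>k. k \<in> K \<Longrightarrow> b k \<in> W" "h \<in> W"
  shows "B (\<lambda>x. \<Sum>k\<in>K. b k x) h = (\<Sum>k\<in>K. B (b k) h)"
proof -
  have zero: "B (\<lambda>x. 0) h = 0"
    using B_cmult[OF zero_mem assms(2), of 0] by simp
  show ?thesis
    using assms(1) by (induction K rule: infinite_finite_induct) (simp_all add: zero B_add assms(2))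
qed

lemma B_sum_right: "(\<And>k. k \<in> K \<Longrightarrow> b k \<in> W) \<Longrightarrow> h \<in> W \<Longrightarrow> B h (\<lambda>x. \<Sum>k\<in>K. b k x) = (\<Sum>k\<in>K. B h (b k))"
  by (simp add: B_sym[of h] B_sum)

lemma Cauchy_Schwarz_sq:
  assumes "f \<in> W" "g \<in> W"
  shows "(B f g)\<^sup>2 \<le> B f f * B g g"
proof -
  define a b c where "a = B f f" and "b = B f g" and "c = B g g"
  have quad: "0 \<le> s\<^sup>2 * a + 2 * s * t * b + t\<^sup>2 * c" for s t
  proof -
    have "0 \<le> B (\<lambda>x. s * f x + t * g x) (\<lambda>x. s * f x + t * g x)"
      using assms by (intro B_psd) simp
    also have "\<dots> = s\<^sup>2 * a + 2 * s * t * b + t\<^sup>2 * c"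
      using assms by (simp add: B_add B_add_right B_cmult B_cmult_right a_def b_def c_def
          B_sym[of g f] power2_eq_square algebra_simps)
    finally show ?thesis .
  qed
  have "a \<ge> 0" "c \<ge> 0"
    using assms by (auto simp: a_def c_def B_psd)
  have "b\<^sup>2 \<le> a * c"
  proof (cases "a = 0")
    case True
    have "b = 0"
    proof (rule ccontr)
      assume "b \<noteq> 0"
      with quad[of "- (c + 1) / (2 * b)" 1] True show False by (simp add: field_simps)
    qed
    with True show ?thesis by simp
  next
    case False
    with quad[of "- b" a] \<open>a \<ge> 0\<close> show ?thesis
      by (simp add: power2_eq_square algebra_simps)
  qed
  then show ?thesis
    by (simp add: a_def b_def c_def)
qed

lemma Cauchy_Schwarz:
  assumes "f \<in> W" "g \<in> W"
  shows "\<bar>B f g\<bar> \<le> sqrt (B f f) * sqrt (B g g)"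
proof (rule power2_le_imp_le)
  show "\<bar>B f g\<bar>\<^sup>2 \<le> (sqrt (B f f) * sqrt (B g g))\<^sup>2"
    using Cauchy_Schwarz_sq[OF assms] assms by (simp add: power_mult_distrib B_psd)
qed (use assms in \<open>simp add: B_psd\<close>)

lemma norm_triangle:
  assumes "f \<in> W" "g \<in> W"
  shows "sqrt (B (\<lambda>x. f x + g x) (\<lambda>x. f x + g x)) \<le> sqrt (B f f) + sqrt (B g g)"
proof (rule power2_le_imp_le)
  have "B (\<lambda>x. f x + g x) (\<lambda>x. f x + g x) = B f f + 2 * B f g + B g g"
    using assms by (simp add: B_add B_add_right B_sym[of g f])
  also have "\<dots> \<le> (sqrt (B f f) + sqrt (B g g))\<^sup>2"
    using Cauchy_Schwarz[OF assms] assms by (simp add: power2_sum B_psd)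
  finally show "(sqrt (B (\<lambda>x. f x + g x) (\<lambda>x. f x + g x)))\<^sup>2 \<le> (sqrt (B f f) + sqrt (B g g))\<^sup>2"
    using assms by (simp add: B_psd)
qed (use assms in \<open>simp add: B_psd\<close>)

lemma best_approx:
  assumes "f \<in> W" "g \<in> W" "s \<in> W" "B (\<lambda>x. f x - g x) (\<lambda>x. g x - s x) = 0"
  shows "sqrt (B (\<lambda>x. f x - g x) (\<lambda>x. f x - g x)) \<le> sqrt (B (\<lambda>x. f x - s x) (\<lambda>x. f x - s x))"
proof -
  define a b where "a = (\<lambda>x. f x - g x)" and "b = (\<lambda>x. g x - s x)"
  have ab: "a \<in> W" "b \<in> W" "B a b = 0"
    using assms by (simp_all add: a_def b_def)
  have "(\<lambda>x. f x - s x) = (\<lambda>x. a x + b x)"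
    by (simp add: a_def b_def)
  then have "B (\<lambda>x. f x - s x) (\<lambda>x. f x - s x) = B a a + B b b"
    using ab by (simp add: B_add B_add_right B_sym[of b a])
  then show ?thesis
    using B_psd[OF ab(2)] by (simp add: a_def)
qed

text \<open>Gram--Schmidt; when the component \<open>v\<close> of the new vector orthogonal to the old ones has
  seminorm zero, \<open>\<gamma>\<close> is \<open>0 / 0 = 0\<close> and the old projection still works.\<close>

lemma projection_exists_basis:
  assumes "finite K" "\<And>k. k \<in> K \<Longrightarrow> b k \<in> W" "f \<in> W"
  shows "\<exists>c. \<forall>k\<in>K. B (\<lambda>x. f x - (\<Sum>i\<in>K. c i * b i x)) (b k) = 0"
  using assms
proof (induction K arbitrary: f rule: finite_induct)
  case empty
  then show ?case by simp
next
  case (insert q K)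
  have bK: "\<And>k. k \<in> K \<Longrightarrow> b k \<in> W" and bq: "b q \<in> W" and f: "f \<in> W"
    using insert.prems by simp_all
  obtain cf where cf: "\<And>k. k \<in> K \<Longrightarrow> B (\<lambda>x. f x - (\<Sum>i\<in>K. cf i * b i x)) (b k) = 0"
    using insert.IH[of f] bK f by blast
  obtain cq where cq: "\<And>k. k \<in> K \<Longrightarrow> B (\<lambda>x. b q x - (\<Sum>i\<in>K. cq i * b i x)) (b k) = 0"
    using insert.IH[of "b q"] bK bq by blast
  define g where "g = (\<lambda>x. f x - (\<Sum>i\<in>K. cf i * b i x))"
  define v where "v = (\<lambda>x. b q x - (\<Sum>i\<in>K. cq i * b i x))"
  have gv: "g \<in> W" "v \<in> W"
    unfolding g_def v_def using bK bq f by simp_all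
  define \<gamma> where "\<gamma> = B g v / B v v"
  define w where "w = (\<lambda>x. g x - \<gamma> * v x)"
  have w: "w \<in> W" unfolding w_def using gv by simp
  have Bw: "B w h = B g h - \<gamma> * B v h" if "h \<in> W" for h
    unfolding w_def using gv that by (simp add: B_diff B_cmult)
  have wK: "B w (b k) = 0" if "k \<in> K" for k
    using Bw[OF bK[OF that]] cf[OF that] cq[OF that] by (simp add: g_def v_def)
  have "B w v = 0"
    using Cauchy_Schwarz_sq[OF gv] by (cases "B v v = 0") (simp_all add: Bw[OF gv(2)] \<gamma>_def)
  moreover have "b q = (\<lambda>x. v x + (\<Sum>i\<in>K. cq i * b i x))"
    by (simp add: v_def)
  ultimately have wq: "B w (b q) = 0"
    using bK gv w by (simp add: B_add_right B_sum_right B_cmult_right wK)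
  define c where "c i = (if i = q then \<gamma> else cf i - \<gamma> * cq i)" for i
  have "f x - (\<Sum>i\<in>insert q K. c i * b i x) = w x" for x
  proof -
    have "(\<Sum>i\<in>K. c i * b i x) = (\<Sum>i\<in>K. (cf i - \<gamma> * cq i) * b i x)"
      using insert.hyps by (intro sum.cong) (auto simp: c_def)
    then show ?thesis
      using insert.hyps by (simp add: c_def w_def g_def v_def algebra_simps sum_subtractf sum_distrib_left)
  qed
  then show ?case
    using wK wq by (intro exI[of _ c]) auto
qed

lemma projection_exists:
  assumes "finite K" and b: "\<And>k. k \<in> K \<Longrightarrow> b k \<in> W" and f: "f \<in> W"
  obtains c where "\<And>d. B (\<lambda>x. f x - (\<Sum>k\<in>K. c k * b k x)) (\<lambda>x. \<Sum>k\<in>K. d k * b k x) = 0"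
proof -
  obtain c where c: "\<And>k. k \<in> K \<Longrightarrow> B (\<lambda>x. f x - (\<Sum>i\<in>K. c i * b i x)) (b k) = 0"
    using projection_exists_basis[of K b f] assms by blast
  have "(\<lambda>x. f x - (\<Sum>i\<in>K. c i * b i x)) \<in> W"
    using b f by simp
  then show ?thesis
    using b c by (intro that[of c]) (simp add: B_sum_right B_cmult_right)
qed

end

interpretation L2: semi_inner "{f. bmeas f}" L2_inner
proof
  show "L2_inner f h = L2_inner g h" if "\<And>x. x \<in> {0..1} \<Longrightarrow> f x = g x" for f g h
    unfolding L2_inner_int01 using that by (intro int01_cong) simp
  show "L2_inner (\<lambda>x. c * f x) h = c * L2_inner f h" for c f h
    by (simp add: L2_inner_int01 mult.assoc int01_cmult)
  show "0 \<le> L2_inner f f" for f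
    by (simp add: L2_inner_int01 int01_nonneg)
  show "L2_inner f g = L2_inner g f" for f g
    by (simp add: L2_inner_int01 mult.commute)
qed (auto simp: L2_inner_int01 distrib_right int01_add)


lemma L2_norm_nonneg [simp]: "0 \<le> L2_norm f"
  by (simp add: L2_norm_def L2_inner_int01 int01_nonneg)

lemma L2_norm_sq: "(L2_norm f)\<^sup>2 = int01 (\<lambda>x. f x * f x)"
  by (simp add: L2_norm_def L2_inner_int01 int01_nonneg)

lemma int01_Cauchy_Schwarz_sq:
  "bmeas f \<Longrightarrow> bmeas g \<Longrightarrow>
    (int01 (\<lambda>x. f x * g x))\<^sup>2 \<le> int01 (\<lambda>x. f x * f x) * int01 (\<lambda>x. g x * g x)"
  using L2.Cauchy_Schwarz_sq[of f g] by (simp add: L2_inner_int01)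

lemma int01_Cauchy_Schwarz:
  "bmeas f \<Longrightarrow> bmeas g \<Longrightarrow> \<bar>int01 (\<lambda>x. f x * g x)\<bar> \<le> L2_norm f * L2_norm g"
  using L2.Cauchy_Schwarz[of f g] by (simp add: L2_inner_int01 L2_norm_def)

lemma int01_triple_bound:
  assumes "bmeas a" "bmeas f" "bmeas g" "\<And>x. x \<in> {0..1} \<Longrightarrow> \<bar>a x\<bar> \<le> A"
  shows "\<bar>int01 (\<lambda>x. a x * (f x * g x))\<bar> \<le> A * (L2_norm f * L2_norm g)"
proof -
  have "\<bar>a 0\<bar> \<le> A" using assms(4)[of 0] by simp
  then have A: "0 \<le> A" by linarith
  have abs_bm: "bmeas (\<lambda>x. \<bar>f x\<bar>)" if "bmeas f" for f :: "real \<Rightarrow> real"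
    using that by (auto simp: bmeas_def)
  have "\<bar>int01 (\<lambda>x. a x * (f x * g x))\<bar> \<le> int01 (\<lambda>x. A * (\<bar>f x\<bar> * \<bar>g x\<bar>))"
    using assms by (intro int01_abs_le) (auto simp: abs_bm abs_mult intro!: mult_right_mono)
  also have "\<dots> \<le> A * (L2_norm (\<lambda>x. \<bar>f x\<bar>) * L2_norm (\<lambda>x. \<bar>g x\<bar>))"
    unfolding int01_cmult using A assms int01_Cauchy_Schwarz[of "\<lambda>x. \<bar>f x\<bar>" "\<lambda>x. \<bar>g x\<bar>"]
    by (intro mult_left_mono) (auto simp: abs_bm)
  also have "\<dots> = A * (L2_norm f * L2_norm g)"
    by (simp add: L2_norm_def L2_inner_int01 flip: abs_mult)
  finally show ?thesis .
qed

lemma L2_norm_triangle: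
  "bmeas f \<Longrightarrow> bmeas g \<Longrightarrow> L2_norm (\<lambda>x. f x + g x) \<le> L2_norm f + L2_norm g"
  using L2.norm_triangle[of f g] by (simp add: L2_norm_def)

lemma L2_norm_cmult: "L2_norm (\<lambda>x. c * f x) = \<bar>c\<bar> * L2_norm f"
proof -
  have "int01 (\<lambda>x. c * f x * (c * f x)) = c\<^sup>2 * int01 (\<lambda>x. f x * f x)"
    by (simp add: int01_cmult[symmetric] power2_eq_square ac_simps)
  then show ?thesis
    by (simp add: L2_norm_def L2_inner_int01 real_sqrt_mult)
qed

lemma L2_norm_triangle_diff:
  assumes "bmeas f" "bmeas g"
  shows "L2_norm (\<lambda>x. f x - g x) \<le> L2_norm f + L2_norm g"
  using L2_norm_triangle[OF assms(1), of "\<lambda>x. -1 * g x"] assms L2_norm_cmult[of "-1" g] by simp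

lemma L2_norm_mono:
  assumes "bmeas f" "bmeas g" "\<And>x. x \<in> {0..1} \<Longrightarrow> \<bar>f x\<bar> \<le> \<bar>g x\<bar>"
  shows "L2_norm f \<le> L2_norm g"
proof -
  have "f x * f x \<le> g x * g x" if "x \<in> {0..1}" for x
    using assms(3)[OF that] by (metis abs_le_square_iff power2_eq_square)
  then show ?thesis
    using assms by (auto simp: L2_norm_def L2_inner_int01 intro!: int01_mono)
qed

lemma L2_norm_const: "L2_norm (\<lambda>x. c) = \<bar>c\<bar>"
  by (simp add: L2_norm_def L2_inner_int01 int01_const)

lemma L2_norm_le_bound:
  assumes "bmeas f" "\<And>x. x \<in> {0..1} \<Longrightarrow> \<bar>f x\<bar> \<le> B"
  shows "L2_norm f \<le> B"
proof -
  have "\<bar>f 0\<bar> \<le> B" using assms(2)[of 0] by simp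
  then have B: "\<bar>B\<bar> = B" by linarith
  then have "L2_norm f \<le> L2_norm (\<lambda>x. B)"
    using assms by (intro L2_norm_mono) auto
  then show ?thesis by (simp add: L2_norm_const B)
qed

lemma L2_norm_cong: "(\<And>x. x \<in> {0..1} \<Longrightarrow> f x = g x) \<Longrightarrow> L2_norm f = L2_norm g"
  unfolding L2_norm_def L2_inner_int01 by (intro arg_cong[of _ _ sqrt] int01_cong) simp

lemma L2_norm_cong_finite:
  assumes "finite S" "\<And>x. x \<in> {0..1} - S \<Longrightarrow> f x = g x"
  shows "L2_norm f = L2_norm g"
  unfolding L2_norm_def L2_inner_int01
  using assms by (intro arg_cong[of _ _ sqrt] int01_cong_finite[of S]) auto

lemma wderiv_sup_bound:
  assumes "wderiv v g" "v 0 = 0" "x \<in> {0..1}"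
  shows "\<bar>v x\<bar> \<le> L2_norm g"
proof -
  have "v x = int01 (\<lambda>y. indicator {0..x} y * g y)"
    using wderiv_int01_indicator[OF assms(1), of 0 x] assms by simp
  also have "\<bar>\<dots>\<bar> \<le> L2_norm (indicator {0..x}) * L2_norm g"
    using assms wderiv_bmeas by (intro int01_Cauchy_Schwarz) auto
  also have "\<dots> \<le> 1 * L2_norm g"
    by (intro mult_right_mono L2_norm_le_bound) (auto simp: indicator_def)
  finally show ?thesis by simp
qed

lemma A_form_int01:
  assumes "wderiv v g" "wderiv w k"
  shows "A_form v w = int01 (\<lambda>x. v x * w x) + int01 (\<lambda>x. g x * k x)"
proof -
  obtain S where S: "finite S" "\<forall>x\<in>{0..1} - S. Dx v x = g x"
    using wderiv_Dx_eq[OF assms(1)] by blast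
  obtain S' where S': "finite S'" "\<forall>x\<in>{0..1} - S'. Dx w x = k x"
    using wderiv_Dx_eq[OF assms(2)] by blast
  have "int01 (\<lambda>x. Dx v x * Dx w x) = int01 (\<lambda>x. g x * k x)"
    by (rule int01_cong_finite[of "S \<union> S'"]) (use S S' in auto)
  then show ?thesis
    by (simp add: A_form_def L2_inner_int01)
qed

interpretation A: semi_inner "{v. \<exists>g. wderiv v g}" A_form
proof
  fix f g h :: "real \<Rightarrow> real" and c :: real
  assume "f \<in> {v. \<exists>g. wderiv v g}"
  then obtain f1 where f: "wderiv f f1" by blast
  then have bf: "bmeas f" "bmeas f1" by (auto dest: wderiv_bmeas)
  show "0 \<le> A_form f f"
    unfolding A_form_int01[OF f f] by (simp add: int01_nonneg add_nonneg_nonneg)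
  show "(\<lambda>x. c * f x) \<in> {v. \<exists>g. wderiv v g}"
    using f by (auto intro: wderiv_cmult)
  {
    assume "h \<in> {v. \<exists>g. wderiv v g}"
    then obtain h1 where h: "wderiv h h1" by blast
    show "A_form (\<lambda>x. c * f x) h = c * A_form f h"
      unfolding A_form_int01[OF wderiv_cmult[OF f] h] A_form_int01[OF f h]
      by (simp add: mult.assoc int01_cmult distrib_left)
  }
  assume "g \<in> {v. \<exists>g. wderiv v g}"
  then obtain g1 where g: "wderiv g g1" by blast
  then have bg: "bmeas g" "bmeas g1" by (auto dest: wderiv_bmeas)
  show "(\<lambda>x. f x + g x) \<in> {v. \<exists>g. wderiv v g}"
    using f g by (auto intro: wderiv_add)
  show "A_form f g = A_form g f"
    unfolding A_form_int01[OF f g] A_form_int01[OF g f] by (simp add: mult.commute)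
  assume "h \<in> {v. \<exists>g. wderiv v g}"
  then obtain h1 where h: "wderiv h h1" by blast
  then have bh: "bmeas h" "bmeas h1" by (auto dest: wderiv_bmeas)
  show "A_form (\<lambda>x. f x + g x) h = A_form f h + A_form g h"
    unfolding A_form_int01[OF wderiv_add[OF f g] h] A_form_int01[OF f h] A_form_int01[OF g h]
    using bf bg bh by (simp add: distrib_right int01_add)
  show "A_form f h = A_form g h" if "\<And>x. x \<in> {0..1} \<Longrightarrow> f x = g x"
  proof -
    have gf: "wderiv g f1" using f that by (rule wderiv_cong)
    have "int01 (\<lambda>x. f x * h x) = int01 (\<lambda>x. g x * h x)"
      using that by (intro int01_cong) simp
    then show ?thesis
      unfolding A_form_int01[OF f h] A_form_int01[OF gf h] by simp
  qed
qed (use wderiv_const in blast)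

section \<open>Approximation by splines\<close>

lemma partition_mono:
  assumes "partition_01 N z" "1 \<le> i" "i \<le> j" "j \<le> N + 1"
  shows "z i \<le> z j"
  using assms(3,2,4)
proof (induction j rule: dec_induct)
  case base
  then show ?case by simp
next
  case (step n)
  then have "n \<in> {1..N}" by simp
  then have "z n < z (n + 1)"
    using assms(1) unfolding partition_01_def by blast
  with step show ?case by simp
qed

lemma partition_range:
  assumes "partition_01 N z" "i \<in> {1..N + 1}"
  shows "0 \<le> z i" "z i \<le> 1"
  using partition_mono[OF assms(1), of 1 i] partition_mono[OF assms(1), of i "N + 1"] assms
  by (auto simp: partition_01_def)

lemma partition_less: "partition_01 N z \<Longrightarrow> i \<in> {1..N} \<Longrightarrow> z i < z (i + 1)"
  by (auto simp: partition_01_def)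

lemma partition_indicator_sum:
  fixes x :: real
  assumes "partition_01 N z" "0 \<le> x" "x < 1"
  shows "(\<Sum>i=1..N. indicator {z i..<z (i + 1)} x) = (1::real)"
proof -
  have "(\<Sum>i=1..N. indicator {z i..<z (i + 1)} x) =
      (\<Sum>i=1..N. indicator {..<z (Suc i)} x - (indicator {..<z i} x :: real))"
    using partition_less[OF assms(1)] by (intro sum.cong) (fastforce simp: indicator_def)+
  also have "\<dots> = indicator {..<z (Suc N)} x - indicator {..<z 1} x"
    by (subst sum_Suc_diff) auto
  also have "\<dots> = 1"
    using assms by (auto simp: partition_01_def)
  finally show ?thesis .
qed

lemma partition_interval:
  assumes "partition_01 N z" "0 \<le> x" "x < 1"
  obtains i where "i \<in> {1..N}" "z i \<le> x" "x < z (i + 1)"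
proof -
  have "(\<Sum>i=1..N. indicator {z i..<z (i + 1)} x) \<noteq> (0::real)"
    using partition_indicator_sum[OF assms] by simp
  then obtain i where "i \<in> {1..N}" "indicator {z i..<z (i + 1)} x \<noteq> (0::real)"
    by (meson sum.neutral)
  then show ?thesis
    by (intro that[of i]) (auto simp: indicator_def split: if_splits)
qed

lemma int01_partition:
  assumes "partition_01 N z" "bmeas f"
  shows "int01 f = (\<Sum>i=1..N. int01 (\<lambda>x. indicator {z i..<z (i + 1)} x * f x))"
proof -
  have "int01 f = int01 (\<lambda>x. \<Sum>i=1..N. indicator {z i..<z (i + 1)} x * f x)"
    by (rule int01_cong_finite[of "{1}"])
       (use partition_indicator_sum[OF assms(1)] in \<open>auto simp: sum_distrib_right[symmetric]\<close>)
  also have "\<dots> = (\<Sum>i=1..N. int01 (\<lambda>x. indicator {z i..<z (i + 1)} x * f x))"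
    using assms by (intro int01_sum bmeas_mult bmeas_indicator)
  finally show ?thesis .
qed

lemma max_mesh_ge: "i \<in> {1..N} \<Longrightarrow> z (i + 1) - z i \<le> max_mesh N z"
  unfolding max_mesh_def by (intro Max_ge) auto

lemma min_mesh_le: "i \<in> {1..N} \<Longrightarrow> min_mesh N z \<le> z (i + 1) - z i"
  unfolding min_mesh_def by (intro Min_le) auto

lemma min_mesh_pos: "partition_01 N z \<Longrightarrow> 0 < min_mesh N z"
  unfolding min_mesh_def partition_01_def by (subst Min_gr_iff) auto

lemma max_mesh_pos:
  assumes "partition_01 N z"
  shows "0 < max_mesh N z"
proof -
  have "1 \<in> {1..N}" using assms by (auto simp: partition_01_def)
  then show ?thesis
    using max_mesh_ge[of 1 N z] partition_less[OF assms, of 1] by linarith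
qed

lemma int01_indicator_const:
  assumes "0 \<le> a" "a \<le> b" "b \<le> 1"
  shows "int01 (\<lambda>x. indicator {a..b} x * c) = c * (b - a)"
  using int01_indicator_has_integral[of "\<lambda>x. c" a b "(b - a) * c"] has_integral_const_real[of c a b] assms
  by (simp add: ac_simps)

lemma int01_Ico_eq_Icc:
  "int01 (\<lambda>x. indicator {a..<b} x * f x) = int01 (\<lambda>x. indicator {a..b} x * f x)"
  by (rule int01_cong_finite[of "{b}"]) (auto simp: indicator_def)

lemma piecewise_constant_approx:
  assumes z: "partition_01 N z"
    and v: "\<And>x. x \<in> {0..1} \<Longrightarrow> (v has_real_derivative g x) (at x within {0..1})" "continuous_on {0..1} g"
    and s: "\<And>i x. i \<in> {1..N} \<Longrightarrow> z i \<le> x \<Longrightarrow> x < z (i + 1) \<Longrightarrow> s x = v (z i)"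
    and "bmeas s"
  shows "L2_norm (\<lambda>x. v x - s x) \<le> max_mesh N z * L2_norm g"
proof -
  define h where "h = max_mesh N z"
  define J where "J i = int01 (\<lambda>x. indicator {z i..<z (i + 1)} x * (g x * g x))" for i
  have vg: "wderiv v g" using v by (rule wderiv_C1)
  have bm: "bmeas v" "bmeas g" using wderiv_bmeas[OF vg] by auto
  have J: "0 \<le> J i" for i
    unfolding J_def by (intro int01_nonneg) simp
  have h: "0 < h" unfolding h_def using z by (rule max_mesh_pos)
  have local: "(v x - s x) * (v x - s x) \<le> h * J i" if i: "i \<in> {1..N}" "z i \<le> x" "x < z (i + 1)" for i x
  proof -
    have zi: "0 \<le> z i" "z (i + 1) \<le> 1"
      using partition_range[OF z, of i] partition_range[OF z, of "i + 1"] i by auto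
    have "v x - s x = int01 (\<lambda>y. indicator {z i..x} y * g y)"
      using s[OF i] wderiv_int01_indicator[OF vg, of "z i" x] i zi by simp
    also have "\<dots> = int01 (\<lambda>y. indicator {z i..x} y * (indicator {z i..x} y * g y))"
      by (intro int01_cong) (auto simp: indicator_def)
    finally have "(v x - s x)\<^sup>2 \<le> int01 (\<lambda>y. indicator {z i..x} y * indicator {z i..x} y) *
        int01 (\<lambda>y. (indicator {z i..x} y * g y) * (indicator {z i..x} y * g y))"
      using int01_Cauchy_Schwarz_sq[of "indicator {z i..x}" "\<lambda>y. indicator {z i..x} y * g y"] bm by simp
    also have "\<dots> \<le> h * J i"
    proof (intro mult_mono)
      have "int01 (\<lambda>y. indicator {z i..x} y * indicator {z i..x} y) =
          int01 (\<lambda>y. indicator {z i..x} y * 1)"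
        by (intro int01_cong) (auto simp: indicator_def)
      also have "\<dots> = 1 * (x - z i)"
        using zi i by (intro int01_indicator_const) auto
      finally show "int01 (\<lambda>y. indicator {z i..x} y * indicator {z i..x} y) \<le> h"
        using i max_mesh_ge[OF i(1), of z] by (simp add: h_def)
      show "int01 (\<lambda>y. (indicator {z i..x} y * g y) * (indicator {z i..x} y * g y)) \<le> J i"
        unfolding J_def using bm i by (intro int01_mono bmeas_mult bmeas_indicator) (auto simp: indicator_def)
    qed (use h in \<open>auto intro: int01_nonneg\<close>)
    finally show ?thesis by (simp add: power2_eq_square)
  qed
  have "(L2_norm (\<lambda>x. v x - s x))\<^sup>2 \<le> (\<Sum>i=1..N. int01 (\<lambda>x. indicator {z i..<z (i + 1)} x * (h * J i)))"
    unfolding L2_norm_sq using bm \<open>bmeas s\<close> local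
    by (subst int01_partition[OF z])
       (auto intro!: sum_mono int01_mono bmeas_mult bmeas_indicator split: split_indicator)
  also have "\<dots> = (\<Sum>i=1..N. (h * J i) * (z (i + 1) - z i))"
  proof (intro sum.cong refl)
    fix i assume "i \<in> {1..N}"
    then show "int01 (\<lambda>x. indicator {z i..<z (i + 1)} x * (h * J i)) = (h * J i) * (z (i + 1) - z i)"
      unfolding int01_Ico_eq_Icc
      using partition_range[OF z, of i] partition_range[OF z, of "i + 1"] partition_less[OF z, of i]
      by (intro int01_indicator_const) auto
  qed
  also have "\<dots> \<le> (\<Sum>i=1..N. (h * J i) * h)"
    using h J max_mesh_ge[of _ N z] by (intro sum_mono mult_left_mono) (auto simp: h_def)
  also have "\<dots> = (h * L2_norm g)\<^sup>2"
    unfolding power_mult_distrib L2_norm_sq J_def using bm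
    by (subst (2) int01_partition[OF z]) (auto simp: sum_distrib_left power2_eq_square ac_simps)
  finally show ?thesis
    unfolding h_def[symmetric] using h by (intro power2_le_imp_le[of "L2_norm (\<lambda>x. v x - s x)"]) auto
qed

definition tpow :: "nat \<Rightarrow> real \<Rightarrow> real \<Rightarrow> real" where
  "tpow k a x = (if x < a then 0 else (x - a) ^ k)"

definition spline :: "nat \<Rightarrow> nat \<Rightarrow> (nat \<Rightarrow> real) \<Rightarrow> (nat \<Rightarrow> real) \<Rightarrow> (nat \<Rightarrow> real) \<Rightarrow> real \<Rightarrow> real" where
  "spline r N z c d x = (\<Sum>j<r. c j * x ^ j) + (\<Sum>i=2..N. d i * tpow (r - 1) (z i) x)"

lemma bmeas_id [simp]: "bmeas (\<lambda>x. x)"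
  by (rule bmeas_continuous) auto

lemma bmeas_tpow [simp]: "bmeas (tpow k a)" "bmeas (\<lambda>x. tpow k a x)"
proof -
  show "bmeas (tpow k a)"
    by (rule bmeas_cong_finite[of "{}" "\<lambda>x. indicator {a..1} x * (x - a) ^ k", OF _ _ bmeas_mult])
       (auto simp: tpow_def)
  then show "bmeas (\<lambda>x. tpow k a x)" by simp
qed

lemma bmeas_spline [simp]: "bmeas (\<lambda>x. spline r N z c d x)"
  unfolding spline_def by simp

lemma tpow_Suc_eq: "tpow (Suc k) a x = (max (x - a) 0) ^ Suc k"
  by (auto simp: tpow_def max_def)

lemma tpow_has_derivative:
  assumes "x \<noteq> a \<or> 0 < k"
  shows "(tpow (Suc k) a has_real_derivative real (Suc k) * tpow k a x) (at x within S)"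
proof -
  consider "x < a" | "a < x" | "x = a" "0 < k" using assms by linarith
  then have "(tpow (Suc k) a has_real_derivative real (Suc k) * tpow k a x) (at x)"
  proof cases
    case 1
    then have "eventually (\<lambda>y. y < a) (nhds x)"
      using eventually_nhds_in_open[of "{..<a}" x] by auto
    then have ev: "eventually (\<lambda>y. tpow (Suc k) a y = 0) (nhds x)"
      by eventually_elim (auto simp: tpow_def)
    show ?thesis
      using iffD2[OF DERIV_cong_ev[OF refl ev refl], of 0] 1 by (simp add: tpow_def[of k])
  next
    case 2
    then have "eventually (\<lambda>y. a < y) (nhds x)"
      using eventually_nhds_in_open[of "{a<..}" x] by auto
    then have ev: "eventually (\<lambda>y. tpow (Suc k) a y = (y - a) ^ Suc k) (nhds x)"
      by eventually_elim (auto simp: tpow_def)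
    have "((\<lambda>y. y - a) has_real_derivative 1) (at x)"
      by (auto intro!: derivative_eq_intros)
    from DERIV_power[OF this, of "Suc k"]
    have "((\<lambda>y. (y - a) ^ Suc k) has_real_derivative real (Suc k) * (x - a) ^ k) (at x)"
      by (simp del: power_Suc of_nat_Suc)
    then show ?thesis
      using iffD2[OF DERIV_cong_ev[OF refl ev refl]] 2 by (simp add: tpow_def[of k])
  next
    case 3
    then obtain k' where k: "k = Suc k'" by (cases k) auto
    have "((\<lambda>y. tpow (Suc k) a y / (y - a)) \<longlongrightarrow> 0) (at a)"
    proof (rule Lim_transform_eventually)
      have "(max (a - a) 0) ^ k = 0"
        using 3 by simp
      moreover have "((\<lambda>y. (max (y - a) 0) ^ k) \<longlongrightarrow> (max (a - a) 0) ^ k) (at a)"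
        by (intro tendsto_intros)
      ultimately show "((\<lambda>y. (max (y - a) 0) ^ k) \<longlongrightarrow> 0) (at a)"
        by (simp only:)
      show "\<forall>\<^sub>F y in at a. max (y - a) 0 ^ k = tpow (Suc k) a y / (y - a)"
        using eventually_neq_at_within[of a a UNIV]
        by eventually_elim (auto simp: tpow_def max_def k)
    qed
    then show ?thesis
      unfolding 3 by (simp add: has_field_derivative_iff tpow_def k)
  qed
  then show ?thesis
    by (rule has_field_derivative_at_within)
qed

lemma continuous_on_tpow_Suc: "continuous_on S (tpow (Suc k) a)"
proof -
  have "continuous_on S (\<lambda>x. (max (x - a) 0) ^ Suc k)"
    by (intro continuous_intros)
  then show ?thesis
    by (simp add: tpow_Suc_eq[abs_def] cong: continuous_on_cong)
qed

lemma wderiv_tpow: "wderiv (tpow (Suc k) a) (\<lambda>x. real (Suc k) * tpow k a x)"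
  by (rule wderivI[of _ _ "{a}"])
     (auto intro: continuous_on_tpow_Suc tpow_has_derivative simp del: of_nat_Suc)

lemma wderiv_power: "wderiv (\<lambda>x. x ^ Suc j) (\<lambda>x. real (Suc j) * x ^ j)"
proof (rule wderiv_C1)
  show "((\<lambda>x. x ^ Suc j) has_real_derivative real (Suc j) * x ^ j) (at x within {0..1})" for x
    using DERIV_pow[of "Suc j" x] by (simp del: power_Suc of_nat_Suc)
qed (intro continuous_intros)

lemma spline_antideriv:
  assumes "r \<ge> 1"
  obtains c' d' where "wderiv (spline (Suc r) N z c' d') (spline r N z c d)" "c' 0 = a"
proof -
  obtain k where k: "r = Suc k" using assms by (cases r) auto
  define c' where "c' j = (if j = 0 then a else c (j - 1) / real j)" for j
  define d' where "d' i = d i / real r" for i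
  have "wderiv (\<lambda>x. a + (\<Sum>j<r. c' (Suc j) * x ^ Suc j) + (\<Sum>i=2..N. d' i * tpow (Suc k) (z i) x))
      (\<lambda>x. 0 + (\<Sum>j<r. c' (Suc j) * (real (Suc j) * x ^ j)) +
        (\<Sum>i=2..N. d' i * (real (Suc k) * tpow k (z i) x)))"
    by (intro wderiv_add wderiv_const wderiv_sum wderiv_cmult wderiv_power wderiv_tpow) auto
  also have "(\<lambda>x. a + (\<Sum>j<r. c' (Suc j) * x ^ Suc j) + (\<Sum>i=2..N. d' i * tpow (Suc k) (z i) x)) =
      spline (Suc r) N z c' d'"
    by (simp add: spline_def[abs_def] sum.lessThan_Suc_shift k c'_def del: sum.lessThan_Suc)
  also have "(\<lambda>x. 0 + (\<Sum>j<r. c' (Suc j) * (real (Suc j) * x ^ j)) +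
        (\<Sum>i=2..N. d' i * (real (Suc k) * tpow k (z i) x))) = spline r N z c d"
  proof -
    have "c' (Suc j) * real (Suc j) = c j" "d' i * real (Suc k) = d i" for i j
      by (auto simp: c'_def d'_def k)
    then show ?thesis
      by (simp only: spline_def[abs_def] k mult.assoc[symmetric] add_0 diff_Suc_1)
  qed
  finally show ?thesis
    by (rule that) (simp add: c'_def)
qed

lemma spline_L2_projection:
  assumes "bmeas f"
  obtains c d where "\<And>c' d'. int01 (\<lambda>x. (f x - spline r N z c d x) * spline r N z c' d' x) = 0"
proof -
  define K :: "(nat + nat) set" where "K = {..<r} <+> {2..N}"
  define b where "b k x = (case k of Inl j \<Rightarrow> x ^ j | Inr i \<Rightarrow> tpow (r - 1) (z i) x)" for k :: "nat + nat" and x :: real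
  have K: "(\<Sum>k\<in>K. e k * b k x) = spline r N z (e \<circ> Inl) (e \<circ> Inr) x" for e x
    by (simp add: K_def sum.Plus b_def spline_def)
  have "bmeas (b k)" for k
    by (cases k) (auto simp: b_def[abs_def])
  then obtain e where e: "\<And>d. int01 (\<lambda>x. (f x - (\<Sum>k\<in>K. e k * b k x)) * (\<Sum>k\<in>K. d k * b k x)) = 0"
    using L2.projection_exists[of K b f] assms by (auto simp: K_def L2_inner_int01)
  show ?thesis
  proof (rule that[of "e \<circ> Inl" "e \<circ> Inr"])
    fix c' d' :: "nat \<Rightarrow> real"
    have "case_sum c' d' \<circ> Inl = c'" "case_sum c' d' \<circ> Inr = d'" by auto
    then show "int01 (\<lambda>x. (f x - spline r N z (e \<circ> Inl) (e \<circ> Inr) x) * spline r N z c' d' x) = 0"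
      using e[of "case_sum c' d'"] unfolding K by simp
  qed
qed

lemma spline_diff: "spline r N z c d x - spline r N z c' d' x = spline r N z (\<lambda>j. c j - c' j) (\<lambda>i. d i - d' i) x"
  by (simp add: spline_def left_diff_distrib sum_subtractf)

text \<open>With \<open>e = v - s\<close>, orthogonality of \<open>e'\<close> to constants gives \<open>e 1 = 0\<close>, and orthogonality to the
  splines of lower order gains a factor \<open>h\<close> by duality: \<open>(e, e) = - (e', W) = - (e', W - \<chi>)\<close> for the
  antiderivative \<open>W\<close> of \<open>e\<close> and every spline \<open>\<chi>\<close>.\<close>

lemma spline_lift:
  assumes r: "r \<ge> 1" and h: "0 < h"
    and poincare: "\<And>W w. (\<And>x. x \<in> {0..1} \<Longrightarrow> (W has_real_derivative w x) (at x within {0..1})) \<Longrightarrow>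
        continuous_on {0..1} w \<Longrightarrow> \<exists>c d. L2_norm (\<lambda>x. W x - spline r N z c d x) \<le> h * L2_norm w"
    and v: "wderiv v g"
  obtains c d c' d' where "wderiv (spline (Suc r) N z c d) (spline r N z c' d')"
    "spline (Suc r) N z c d 0 = v 0" "spline (Suc r) N z c d 1 = v 1"
    "L2_norm (\<lambda>x. v x - spline (Suc r) N z c d x) \<le> h * L2_norm (\<lambda>x. g x - spline r N z c' d' x)"
    "\<And>a b. L2_norm (\<lambda>x. g x - spline r N z c' d' x) \<le> L2_norm (\<lambda>x. g x - spline r N z a b x)"
proof -
  have bm: "bmeas v" "bmeas g" using wderiv_bmeas[OF v] by auto
  obtain c' d' where orth: "\<And>a b. int01 (\<lambda>x. (g x - spline r N z c' d' x) * spline r N z a b x) = 0"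
    using spline_L2_projection[OF bm(2)] by blast
  define s' where "s' = spline r N z c' d'"
  obtain c0 d where c0d: "wderiv (spline (Suc r) N z c0 d) s'" "c0 0 = 0"
    unfolding s'_def using spline_antideriv[OF r] by blast
  define c where "c j = (if j = 0 then v 0 - spline (Suc r) N z c0 d 0 else c0 j)" for j
  have shift: "spline (Suc r) N z c d x = spline (Suc r) N z c0 d x + (v 0 - spline (Suc r) N z c0 d 0)" for x
    using c0d(2) by (simp add: spline_def sum.lessThan_Suc_shift c_def del: sum.lessThan_Suc)
  define s where "s = spline (Suc r) N z c d"
  have s: "wderiv s s'" "s 0 = v 0"
    using wderiv_add[OF c0d(1) wderiv_const[of "v 0 - spline (Suc r) N z c0 d 0"]]
    by (simp_all add: s_def shift[abs_def] shift)
  define e where "e x = v x - s x" for x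
  define e1 where "e1 x = g x - s' x" for x
  have e: "wderiv e e1"
    unfolding e_def[abs_def] e1_def[abs_def] by (intro wderiv_diff v s)
  have bme: "bmeas e" "bmeas e1" using wderiv_bmeas[OF e] by auto
  have "spline r N z (\<lambda>j. if j = 0 then 1 else 0) (\<lambda>i. 0) x = 1" for x
    using r by (cases r) (auto simp: spline_def sum.lessThan_Suc_shift simp del: sum.lessThan_Suc)
  then have "int01 e1 = 0"
    using orth[of "\<lambda>j. if j = 0 then 1 else 0" "\<lambda>i. 0"] by (simp add: e1_def[abs_def] s'_def)
  moreover have e0: "e 0 = 0" by (simp add: e_def s)
  ultimately have e_1: "e 1 = 0"
    using wderiv_int01[OF e] by simp
  obtain W where W: "W 0 = 0" "\<And>x. x \<in> {0..1} \<Longrightarrow> (W has_real_derivative e x) (at x within {0..1})"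
    using wderiv_antideriv[of e] e by (auto simp: wderiv_def)
  have ce: "continuous_on {0..1} e" using e by (simp add: wderiv_def)
  have We: "wderiv W e" by (rule wderiv_C1[OF W(2) ce])
  have bW: "bmeas W" using wderiv_bmeas[OF We] by simp
  obtain a b where ab: "L2_norm (\<lambda>x. W x - spline r N z a b x) \<le> h * L2_norm e"
    using poincare[OF W(2) ce] by blast
  have "(L2_norm e)\<^sup>2 = - int01 (\<lambda>x. e1 x * W x)"
    unfolding L2_norm_sq using int01_by_parts[OF e We] e0 e_1 by simp
  also have "int01 (\<lambda>x. e1 x * W x) = int01 (\<lambda>x. e1 x * (W x - spline r N z a b x))"
  proof -
    have "int01 (\<lambda>x. e1 x * (W x - spline r N z a b x)) =
        int01 (\<lambda>x. e1 x * W x) - int01 (\<lambda>x. e1 x * spline r N z a b x)"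
      using bme bW by (simp add: right_diff_distrib int01_diff)
    then show ?thesis
      using orth[of a b] by (simp add: e1_def s'_def)
  qed
  also have "- \<dots> \<le> L2_norm e1 * L2_norm (\<lambda>x. W x - spline r N z a b x)"
    using int01_Cauchy_Schwarz[of e1 "\<lambda>x. W x - spline r N z a b x"] bme bW by (simp add: abs_le_iff)
  also have "\<dots> \<le> L2_norm e1 * (h * L2_norm e)"
    by (intro mult_left_mono ab) simp
  finally have "L2_norm e * L2_norm e \<le> (h * L2_norm e1) * L2_norm e"
    by (simp add: power2_eq_square ac_simps)
  then have main: "L2_norm e \<le> h * L2_norm e1"
    using h by (cases "L2_norm e = 0") (auto simp: mult_le_cancel_right less_le)
  have best: "L2_norm e1 \<le> L2_norm (\<lambda>x. g x - spline r N z a b x)" for a b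
    unfolding e1_def[abs_def] s'_def L2_norm_def
    using bm orth by (intro L2.best_approx) (auto simp: spline_diff L2_inner_int01)
  show ?thesis
  proof (rule that[of c d c' d'])
    show "wderiv (spline (Suc r) N z c d) (spline r N z c' d')" using s by (simp add: s_def s'_def)
    show "spline (Suc r) N z c d 0 = v 0" using s by (simp add: s_def)
    show "spline (Suc r) N z c d 1 = v 1" using e_1 by (simp add: s_def e_def)
  qed (use main best in \<open>auto simp: e_def[abs_def] e1_def[abs_def] s_def s'_def\<close>)
qed

lemma spline_approx_step:
  assumes r: "1 \<le> r" and z: "partition_01 N z" and j: "1 \<le> j" "j \<le> Suc r"
    and f: "\<And>i x. i < j \<Longrightarrow> x \<in> {0..1} \<Longrightarrow> (f i has_real_derivative f (Suc i) x) (at x within {0..1})"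
    and fj: "continuous_on {0..1} (f j)"
    and approx: "\<And>f j. 1 \<le> j \<Longrightarrow> j \<le> r \<Longrightarrow>
        (\<And>i x. i < j \<Longrightarrow> x \<in> {0..1} \<Longrightarrow> (f i has_real_derivative f (Suc i) x) (at x within {0..1})) \<Longrightarrow>
        continuous_on {0..1} (f j) \<Longrightarrow>
        \<exists>c d. L2_norm (\<lambda>x. f 0 x - spline r N z c d x) \<le> max_mesh N z ^ j * L2_norm (f j)"
  obtains c d c' d' where "wderiv (spline (Suc r) N z c d) (spline r N z c' d')"
    "spline (Suc r) N z c d 0 = f 0 0" "spline (Suc r) N z c d 1 = f 0 1"
    "L2_norm (\<lambda>x. f 0 x - spline (Suc r) N z c d x) \<le> max_mesh N z ^ j * L2_norm (f j)"
    "L2_norm (\<lambda>x. f 1 x - spline r N z c' d' x) \<le> max_mesh N z ^ (j - 1) * L2_norm (f j)"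
proof -
  have poincare: "\<exists>c d. L2_norm (\<lambda>x. W x - spline r N z c d x) \<le> max_mesh N z * L2_norm w"
    if "\<And>x. x \<in> {0..1} \<Longrightarrow> (W has_real_derivative w x) (at x within {0..1})" "continuous_on {0..1} w" for W w
    using approx[of 1 "\<lambda>i. if i = 0 then W else w"] that r by simp
  have "continuous_on {0..1} (f 1)"
  proof (cases "j = 1")
    case False
    then show ?thesis
      using f j by (intro DERIV_continuous_on[of _ _ "f 2"]) (auto simp: numeral_2_eq_2)
  qed (use fj in auto)
  then have vg: "wderiv (f 0) (f 1)"
    using f j by (intro wderiv_C1) auto
  obtain c d c' d' where s: "wderiv (spline (Suc r) N z c d) (spline r N z c' d')"
    "spline (Suc r) N z c d 0 = f 0 0" "spline (Suc r) N z c d 1 = f 0 1"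
    and dual: "L2_norm (\<lambda>x. f 0 x - spline (Suc r) N z c d x) \<le> max_mesh N z * L2_norm (\<lambda>x. f 1 x - spline r N z c' d' x)"
    and best: "\<And>a b. L2_norm (\<lambda>x. f 1 x - spline r N z c' d' x) \<le> L2_norm (\<lambda>x. f 1 x - spline r N z a b x)"
  proof (rule spline_lift[OF r max_mesh_pos[OF z] _ vg])
    show "\<exists>c d. L2_norm (\<lambda>x. W x - spline r N z c d x) \<le> max_mesh N z * L2_norm w"
      if "\<And>x. x \<in> {0..1} \<Longrightarrow> (W has_real_derivative w x) (at x within {0..1})" "continuous_on {0..1} w" for W w
      using poincare[OF that] .
  qed (rule that)
  have "\<exists>a b. L2_norm (\<lambda>x. f 1 x - spline r N z a b x) \<le> max_mesh N z ^ (j - 1) * L2_norm (f j)"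
  proof (cases "j = 1")
    case True
    have "spline r N z (\<lambda>_. 0) (\<lambda>_. 0) x = 0" for x
      by (simp add: spline_def)
    then show ?thesis
      using True by (intro exI[of _ "\<lambda>_. 0"]) simp
  next
    case False
    then show ?thesis
      using approx[of "j - 1" "\<lambda>i. f (Suc i)"] f fj j by auto
  qed
  then obtain a b where "L2_norm (\<lambda>x. f 1 x - spline r N z a b x) \<le> max_mesh N z ^ (j - 1) * L2_norm (f j)"
    by blast
  with best[of a b] have 1: "L2_norm (\<lambda>x. f 1 x - spline r N z c' d' x) \<le> max_mesh N z ^ (j - 1) * L2_norm (f j)"
    by linarith
  have "L2_norm (\<lambda>x. f 0 x - spline (Suc r) N z c d x) \<le>
      max_mesh N z * (max_mesh N z ^ (j - 1) * L2_norm (f j))"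
    using dual 1 max_mesh_pos[OF z] by (meson less_imp_le mult_left_mono order_trans)
  also have "\<dots> = max_mesh N z ^ j * L2_norm (f j)"
    using j by (cases j) auto
  finally show ?thesis
    using s 1 by (intro that)
qed

lemma spline_approx:
  assumes "1 \<le> r" and z: "partition_01 N z" and "1 \<le> j" "j \<le> r"
    and "\<And>i x. i < j \<Longrightarrow> x \<in> {0..1} \<Longrightarrow> (f i has_real_derivative f (Suc i) x) (at x within {0..1})"
    and "continuous_on {0..1} (f j)"
  shows "\<exists>c d. L2_norm (\<lambda>x. f 0 x - spline r N z c d x) \<le> max_mesh N z ^ j * L2_norm (f j)"
  using assms(1,3-6)
proof (induction r arbitrary: f j rule: nat_induct_at_least)
  case base
  then have j: "j = 1" by simp
  define d where "d i = f 0 (z i) - f 0 (z (i - 1))" for i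
  define c where "c i = f 0 (z 1)" for i :: nat
  have "spline 1 N z c d x = f 0 (z i)" if i: "i \<in> {1..N}" "z i \<le> x" "x < z (i + 1)" for i x
  proof -
    have "(\<Sum>k=2..N. d k * tpow 0 (z k) x) = (\<Sum>k=2..i. d k)"
    proof (rule sum.mono_neutral_cong_right)
      show "\<forall>k\<in>{2..N} - {2..i}. d k * tpow 0 (z k) x = 0"
      proof
        fix k assume "k \<in> {2..N} - {2..i}"
        then show "d k * tpow 0 (z k) x = 0"
          using i partition_mono[OF z, of "i + 1" k] by (auto simp: tpow_def)
      qed
      show "d k * tpow 0 (z k) x = d k" if "k \<in> {2..i}" for k
        using i partition_mono[OF z, of k i] that by (auto simp: tpow_def)
    qed (use i in auto)
    also have "\<dots> = (\<Sum>k=Suc 1..i. f 0 (z k) - f 0 (z (k - 1)))"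
      by (simp add: d_def numeral_2_eq_2)
    also have "\<dots> = f 0 (z i) - f 0 (z 1)"
      using i by (intro sum_telescope'') auto
    finally show ?thesis
      by (simp add: spline_def c_def)
  qed
  then have "L2_norm (\<lambda>x. f 0 x - spline 1 N z c d x) \<le> max_mesh N z * L2_norm (f 1)"
    using base j by (intro piecewise_constant_approx[OF z]) auto
  then show ?case
    using j by auto
next
  case (Suc r)
  show ?case
    by (rule spline_approx_step[OF Suc.hyps z Suc.prems Suc.IH]) blast+
qed

lemma spline_approx_boundary:
  assumes "1 \<le> r" and z: "partition_01 N z" and "1 \<le> j" "j \<le> Suc r"
    and "\<And>i x. i < j \<Longrightarrow> x \<in> {0..1} \<Longrightarrow> (f i has_real_derivative f (Suc i) x) (at x within {0..1})"
    and "continuous_on {0..1} (f j)"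
  obtains c d c' d' where "wderiv (spline (Suc r) N z c d) (spline r N z c' d')"
    "spline (Suc r) N z c d 0 = f 0 0" "spline (Suc r) N z c d 1 = f 0 1"
    "L2_norm (\<lambda>x. f 0 x - spline (Suc r) N z c d x) \<le> max_mesh N z ^ j * L2_norm (f j)"
    "L2_norm (\<lambda>x. f 1 x - spline r N z c' d' x) \<le> max_mesh N z ^ (j - 1) * L2_norm (f j)"
  by (rule spline_approx_step[OF assms spline_approx[OF assms(1) z]]) (rule that | assumption)+

section \<open>Inverse estimates for polynomials\<close>

lemma bmeas_poly [simp]: "bmeas (poly p)" "bmeas (\<lambda>x. poly p x)"
  by (auto intro!: bmeas_continuous continuous_intros)

lemma pderiv_sum_monom:
  "finite A \<Longrightarrow> pderiv (\<Sum>i\<in>A. monom (c i) i) = (\<Sum>i\<in>A. monom (of_nat i * c i) (i - 1))"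
  by (induction A rule: finite_induct) (simp_all add: pderiv_add pderiv_monom)

lemma poly_L2_zero:
  assumes "int01 (\<lambda>x. poly p x * poly p x) = 0"
  shows "p = 0"
proof (rule ccontr)
  assume "p \<noteq> 0"
  then have "finite {x. poly p x = 0}" by (rule poly_roots_finite)
  moreover have "{0..1} \<subseteq> {x. poly p x = 0}"
  proof -
    have "continuous_on {0..1} (\<lambda>x. poly p x * poly p x)"
      by (intro continuous_intros)
    then have "\<forall>x\<in>{0..1}. poly p x * poly p x = 0"
      using assms integralL_eq_0_iff[of 0 1 "\<lambda>x. poly p x * poly p x"] by (simp add: int01_def)
    then show ?thesis by auto
  qed
  ultimately have "finite {0..1::real}" by (rule finite_subset[rotated])
  then show False using infinite_Icc[of "0::real" 1] by simp
qed

text \<open>If \<open>e\<close> is the component of \<open>x ^ l\<close> orthogonal to the other monomials, then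
  \<open>(p, e) = coeff p l * (e, e)\<close>.\<close>

lemma poly_coeff_bound:
  assumes l: "l \<le> n"
  shows "\<exists>D\<ge>0. \<forall>p. degree p \<le> n \<longrightarrow> \<bar>coeff p l\<bar> \<le> D * L2_norm (poly p)"
proof -
  define K where "K = {..n} - {l}"
  have pw: "bmeas (\<lambda>x. x ^ k)" for k by simp
  have "\<exists>c. \<forall>k\<in>K. L2_inner (\<lambda>x. x ^ l - (\<Sum>i\<in>K. c i * x ^ i)) (\<lambda>x. x ^ k) = 0"
    by (rule L2.projection_exists_basis) (simp_all add: K_def)
  then obtain c where c: "\<And>k. k \<in> K \<Longrightarrow> L2_inner (\<lambda>x. x ^ l - (\<Sum>i\<in>K. c i * x ^ i)) (\<lambda>x. x ^ k) = 0"
    by blast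
  define P where "P = monom 1 l - (\<Sum>i\<in>K. monom (c i) i)"
  define e where "e = poly P"
  have e: "e = (\<lambda>x. x ^ l - (\<Sum>i\<in>K. c i * x ^ i))"
    by (simp add: e_def P_def fun_eq_iff poly_sum poly_monom)
  have be: "bmeas e" by (simp add: e_def)
  have "coeff (\<Sum>i\<in>K. monom (c i) i) l = 0"
    by (simp add: coeff_sum K_def)
  then have "coeff P l = 1" by (simp add: P_def)
  then have "P \<noteq> 0" by auto
  then have "L2_norm e \<noteq> 0"
    using poly_L2_zero[of P] by (auto simp: e_def L2_norm_sq[symmetric])
  then have pos: "0 < L2_norm e" using L2_norm_nonneg[of e] by linarith
  have orth: "L2_inner e (\<lambda>x. x ^ k) = 0" if "k \<in> K" for k
    using c[OF that] by (simp add: e)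
  have "L2_inner e (\<lambda>x. x ^ l - (\<Sum>i\<in>K. c i * x ^ i)) = L2_inner e (\<lambda>x. x ^ l)"
    using be by (simp add: L2.B_diff_right L2.B_sum_right L2.B_cmult_right orth)
  then have el: "L2_inner e (\<lambda>x. x ^ l) = (L2_norm e)\<^sup>2"
    by (simp add: e[symmetric] L2_norm_sq L2_inner_int01)
  have "\<bar>coeff p l\<bar> \<le> 1 / L2_norm e * L2_norm (poly p)" if p: "degree p \<le> n" for p
  proof -
    have "poly p = (\<lambda>x. \<Sum>k\<le>n. coeff p k * x ^ k)"
      using arg_cong[OF poly_as_sum_of_monoms'[OF p], of poly] by (simp add: fun_eq_iff poly_sum poly_monom)
    then have "L2_inner e (poly p) = (\<Sum>k\<le>n. coeff p k * L2_inner e (\<lambda>x. x ^ k))"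
      using be by (simp add: L2.B_sum_right L2.B_cmult_right)
    also have "\<dots> = (\<Sum>k\<in>insert l K. coeff p k * L2_inner e (\<lambda>x. x ^ k))"
      using l by (intro sum.cong) (auto simp: K_def)
    also have "\<dots> = coeff p l * (L2_norm e)\<^sup>2"
      by (subst sum.insert) (auto simp: K_def el orth)
    finally have "\<bar>coeff p l\<bar> * (L2_norm e)\<^sup>2 \<le> L2_norm e * L2_norm (poly p)"
      using int01_Cauchy_Schwarz[OF be, of "poly p"] by (simp add: L2_inner_int01 abs_mult)
    then show ?thesis
      using pos by (simp add: field_simps power2_eq_square)
  qed
  then show ?thesis
    using pos by (intro exI[of _ "1 / L2_norm e"]) auto
qed

lemma poly_norm_bounds:
  obtains C where "C \<ge> 0"
    "\<And>p x. degree p \<le> n \<Longrightarrow> x \<in> {0..1} \<Longrightarrow> \<bar>poly p x\<bar> \<le> C * L2_norm (poly p)"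
    "\<And>p x. degree p \<le> n \<Longrightarrow> x \<in> {0..1} \<Longrightarrow> \<bar>poly (pderiv p) x\<bar> \<le> C * L2_norm (poly p)"
proof -
  have "\<forall>l\<in>{..n}. \<exists>D. 0 \<le> D \<and> (\<forall>p. degree p \<le> n \<longrightarrow> \<bar>coeff p l\<bar> \<le> D * L2_norm (poly p))"
    using poly_coeff_bound by auto
  from bchoice[OF this] obtain D
    where D': "\<forall>l\<in>{..n}. 0 \<le> D l \<and> (\<forall>p. degree p \<le> n \<longrightarrow> \<bar>coeff p l\<bar> \<le> D l * L2_norm (poly p))" ..
  have D: "0 \<le> D l" and coeff: "\<And>p. degree p \<le> n \<Longrightarrow> \<bar>coeff p l\<bar> \<le> D l * L2_norm (poly p)"
    if "l \<le> n" for l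
    using D' that by simp_all
  define C where "C = (\<Sum>l\<le>n. (1 + real l) * D l)"
  have C: "0 \<le> C"
    unfolding C_def by (intro sum_nonneg mult_nonneg_nonneg D) simp_all
  have bound: "\<bar>\<Sum>l\<le>n. e l * (coeff p l * x ^ m l)\<bar> \<le> C * L2_norm (poly p)"
    if "degree p \<le> n" "x \<in> {0..1}" "\<And>l. 0 \<le> e l \<and> e l \<le> 1 + real l" for p and x :: real and m e
  proof -
    have "\<bar>\<Sum>l\<le>n. e l * (coeff p l * x ^ m l)\<bar> \<le> (\<Sum>l\<le>n. (1 + real l) * (D l * L2_norm (poly p)))"
    proof (rule order_trans[OF sum_abs], rule sum_mono)
      fix l assume l: "l \<in> {..n}"
      have "\<bar>e l * (coeff p l * x ^ m l)\<bar> = \<bar>e l\<bar> * (\<bar>coeff p l\<bar> * \<bar>x ^ m l\<bar>)"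
        by (simp add: abs_mult)
      also have "\<dots> \<le> (1 + real l) * ((D l * L2_norm (poly p)) * 1)"
        using that l coeff[OF _ that(1), of l] D[of l]
        by (intro mult_mono) (auto simp: power_abs power_le_one)
      finally show "\<bar>e l * (coeff p l * x ^ m l)\<bar> \<le> (1 + real l) * (D l * L2_norm (poly p))" by simp
    qed
    then show ?thesis by (simp add: C_def sum_distrib_right mult.assoc)
  qed
  show ?thesis
  proof (rule that[OF C])
    fix p :: "real poly" and x :: real
    assume p: "degree p \<le> n" and x: "x \<in> {0..1}"
    have p_eq: "p = (\<Sum>i\<le>n. monom (coeff p i) i)"
      using poly_as_sum_of_monoms'[OF p] by simp
    have "poly p x = (\<Sum>i\<le>n. 1 * (coeff p i * x ^ i))"
      using arg_cong[OF p_eq, of "\<lambda>q. poly q x"] by (simp add: poly_sum poly_monom)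
    then show "\<bar>poly p x\<bar> \<le> C * L2_norm (poly p)"
      using bound[OF p x, of "\<lambda>_. 1" "\<lambda>i. i"] by simp
    have "poly (pderiv p) x = (\<Sum>i\<le>n. real i * (coeff p i * x ^ (i - 1)))"
      using arg_cong[OF p_eq, of "\<lambda>q. poly (pderiv q) x"]
      by (simp add: pderiv_sum_monom poly_sum poly_monom mult.assoc)
    then show "\<bar>poly (pderiv p) x\<bar> \<le> C * L2_norm (poly p)"
      using bound[OF p x, of "\<lambda>i. real i" "\<lambda>i. i - 1"] by simp
  qed
qed

lemma int01_poly_rescale:
  assumes "0 \<le> a" "a < b" "b \<le> 1"
  shows "(b - a) * int01 (\<lambda>s. poly (pcompose p [:a, b - a:]) s * poly (pcompose p [:a, b - a:]) s) =
    int01 (\<lambda>x. indicator {a..b} x * (poly p x * poly p x))"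
proof -
  define f where "f x = poly p x * poly p x" for x
  have cf: "continuous_on {0..1} f" unfolding f_def by (intro continuous_intros)
  obtain F where F: "\<And>x. x \<in> {0..1} \<Longrightarrow> (F has_real_derivative f x) (at x within {0..1})"
    using wderiv_antideriv[OF cf] by blast
  have "wderiv F f" using F cf by (rule wderiv_C1)
  then have 1: "int01 (\<lambda>x. indicator {a..b} x * f x) = F b - F a"
    using assms by (intro wderiv_int01_indicator) auto
  have "wderiv (\<lambda>s. F (a + (b - a) * s)) (\<lambda>s. (b - a) * f (a + (b - a) * s))"
  proof (rule wderiv_C1)
    fix s :: real assume s: "s \<in> {0..1}"
    have sub: "(\<lambda>s. a + (b - a) * s) ` {0..1} \<subseteq> {0..1}"
    proof
      fix y assume "y \<in> (\<lambda>s. a + (b - a) * s) ` {0..1}"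
      then obtain s where s: "0 \<le> s" "s \<le> 1" "y = a + (b - a) * s" by auto
      define t where "t = (b - a) * s"
      have "t \<le> b - a" "0 \<le> t"
        unfolding t_def using assms s mult_left_le[of s "b - a"] by simp_all
      then have "0 \<le> y" "y \<le> 1" unfolding s(3) t_def[symmetric] using assms by linarith+
      then show "y \<in> {0..1}" by simp
    qed
    have inner: "((\<lambda>s. a + (b - a) * s) has_real_derivative (b - a)) (at s within {0..1})"
      by (auto intro!: derivative_eq_intros)
    have "(F has_real_derivative f (a + (b - a) * s)) (at (a + (b - a) * s) within (\<lambda>s. a + (b - a) * s) ` {0..1})"
      using subsetD[OF sub imageI[OF s]] by (intro DERIV_subset[OF F sub])
    from DERIV_image_chain[OF this inner] show "((\<lambda>s. F (a + (b - a) * s)) has_real_derivative (b - a) * f (a + (b - a) * s)) (at s within {0..1})"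
      by (simp add: o_def mult.commute)
  qed (auto simp: f_def intro!: continuous_intros)
  then have "int01 (\<lambda>s. (b - a) * f (a + (b - a) * s)) = F b - F a"
    by (subst wderiv_int01) auto
  then show ?thesis
    using 1 by (simp add: int01_cmult f_def poly_pcompose ac_simps)
qed

lemma poly_interval_bounds:
  obtains C where "C \<ge> 0"
    "\<And>a b p x. 0 \<le> a \<Longrightarrow> a < b \<Longrightarrow> b \<le> 1 \<Longrightarrow> degree p \<le> n \<Longrightarrow> x \<in> {a..b} \<Longrightarrow>
      (poly p x)\<^sup>2 * (b - a) \<le> C * int01 (\<lambda>x. indicator {a..b} x * (poly p x * poly p x))"
    "\<And>a b p x. 0 \<le> a \<Longrightarrow> a < b \<Longrightarrow> b \<le> 1 \<Longrightarrow> degree p \<le> n \<Longrightarrow> x \<in> {a..b} \<Longrightarrow>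
      (poly (pderiv p) x)\<^sup>2 * (b - a) ^ 3 \<le> C * int01 (\<lambda>x. indicator {a..b} x * (poly p x * poly p x))"
proof -
  obtain C where C: "C \<ge> 0"
    "\<And>p x. degree p \<le> n \<Longrightarrow> x \<in> {0..1} \<Longrightarrow> \<bar>poly p x\<bar> \<le> C * L2_norm (poly p)"
    "\<And>p x. degree p \<le> n \<Longrightarrow> x \<in> {0..1} \<Longrightarrow> \<bar>poly (pderiv p) x\<bar> \<le> C * L2_norm (poly p)"
    using poly_norm_bounds[of n] by blast
  have main: "(poly p x)\<^sup>2 * (b - a) \<le> C\<^sup>2 * int01 (\<lambda>x. indicator {a..b} x * (poly p x * poly p x)) \<and>
      (poly (pderiv p) x)\<^sup>2 * (b - a) ^ 3 \<le> C\<^sup>2 * int01 (\<lambda>x. indicator {a..b} x * (poly p x * poly p x))"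
    if ab: "0 \<le> a" "a < b" "b \<le> 1" and p: "degree p \<le> n" and x: "x \<in> {a..b}" for a b p x
  proof -
    define d where "d = b - a"
    define q where "q = pcompose p [:a, d:]"
    define J where "J = int01 (\<lambda>x. indicator {a..b} x * (poly p x * poly p x))"
    define s where "s = (x - a) / d"
    have d: "d > 0" using ab by (simp add: d_def)
    have s: "s \<in> {0..1}" "a + s * d = x" using x d by (auto simp: s_def d_def)
    have J: "d * (L2_norm (poly q))\<^sup>2 = J"
      using int01_poly_rescale[OF ab] by (simp add: L2_norm_sq q_def J_def d_def)
    have q: "degree q \<le> n"
      using degree_pcompose[of p "[:a, d:]"] p d by (simp add: q_def)
    have "poly q s = poly p x" "poly (pderiv q) s = d * poly (pderiv p) x"
      using s by (simp_all add: q_def poly_pcompose pderiv_pcompose pderiv_pCons)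
    with C(2,3)[OF q s(1)] have b: "\<bar>poly p x\<bar> \<le> C * L2_norm (poly q)" "\<bar>d * poly (pderiv p) x\<bar> \<le> C * L2_norm (poly q)"
      by simp_all
    have sq: "y\<^sup>2 * d \<le> C\<^sup>2 * J" if "\<bar>y\<bar> \<le> C * L2_norm (poly q)" for y
    proof -
      have "y\<^sup>2 \<le> (C * L2_norm (poly q))\<^sup>2"
        using power_mono[OF that, of 2] by simp
      then have "y\<^sup>2 * d \<le> (C * L2_norm (poly q))\<^sup>2 * d"
        using d by (intro mult_right_mono) auto
      then show ?thesis
        by (simp add: J[symmetric] power_mult_distrib ac_simps)
    qed
    show ?thesis
      using sq[OF b(1)] sq[OF b(2)]
      by (simp add: J_def d_def[symmetric] power_mult_distrib power3_eq_cube power2_eq_square ac_simps)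
  qed
  show ?thesis
    by (rule that[of "C\<^sup>2"]) (use main in auto)
qed

section \<open>The finite element space\<close>

lemma Ck_has_derivative:
  assumes "v \<in> Ck k" "j < k" "x \<in> {0..1}"
  shows "((Dx ^^ j) v has_real_derivative (Dx ^^ Suc j) v x) (at x within {0..1})"
proof -
  have "(Dx ^^ j) v differentiable (at x within {0..1})"
    using assms by (simp add: Ck_def)
  then obtain d where "((Dx ^^ j) v has_real_derivative d) (at x within {0..1})"
    by (auto simp: real_differentiable_def)
  moreover from this have "(Dx ^^ Suc j) v x = d"
    using assms(3) by (simp add: Dx_eqI)
  ultimately show ?thesis by simp
qed

lemma Ck_continuous: "v \<in> Ck k \<Longrightarrow> j \<le> k \<Longrightarrow> continuous_on {0..1} ((Dx ^^ j) v)"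
  by (simp add: Ck_def)

lemma has_real_derivative_cong_on:
  assumes "(f has_real_derivative d) (at x within S)" "x \<in> S" "\<And>y. y \<in> S \<Longrightarrow> f y = g y"
  shows "(g has_real_derivative d) (at x within S)"
  using assms unfolding has_field_derivative_def
  by (auto intro: has_derivative_transform[of x S g f])

lemma funpow_Dx_eq:
  assumes "\<And>j x. j < k \<Longrightarrow> x \<in> {0..1} \<Longrightarrow> (f j has_real_derivative f (Suc j) x) (at x within {0..1})"
    "\<And>x. x \<in> {0..1} \<Longrightarrow> v x = f 0 x" "j \<le> k" "x \<in> {0..1}"
  shows "(Dx ^^ j) v x = f j x"
  using assms(3,4)
proof (induction j arbitrary: x)
  case 0
  then show ?case using assms by simp
next
  case (Suc j)
  have "((Dx ^^ j) v has_real_derivative f (Suc j) x) (at x within {0..1})"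
    by (rule has_real_derivative_cong_on[of "f j"]) (use assms Suc in auto)
  then show ?case
    using Dx_eqI[of "(Dx ^^ j) v"] Suc.prems by simp
qed

lemma CkI:
  assumes f: "\<And>j x. j < k \<Longrightarrow> x \<in> {0..1} \<Longrightarrow> (f j has_real_derivative f (Suc j) x) (at x within {0..1})"
    and c: "continuous_on {0..1} (f k)"
    and v: "\<And>x. x \<in> {0..1} \<Longrightarrow> v x = f 0 x"
  shows "v \<in> Ck k"
proof -
  have eq: "(Dx ^^ j) v x = f j x" if "j \<le> k" "x \<in> {0..1}" for j x
    by (rule funpow_Dx_eq[of k]) (use f v that in auto)
  have "(Dx ^^ j) v differentiable (at x within {0..1})" if "j < k" "x \<in> {0..1}" for j x
    unfolding real_differentiable_def
    using has_real_derivative_cong_on[OF f[OF that] that(2), of "(Dx ^^ j) v"] eq that by fastforce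
  moreover have "continuous_on {0..1} ((Dx ^^ j) v)" if "j \<le> k" for j
  proof -
    have "continuous_on {0..1} (f j)"
      using f c that by (cases "j = k") (auto intro: DERIV_continuous_on[of _ _ "f (Suc j)"])
    then show ?thesis
      using continuous_on_cong[of "{0..1}" "{0..1}" "f j" "(Dx ^^ j) v"] eq[OF that] by simp
  qed
  ultimately show ?thesis
    by (simp add: Ck_def)
qed

lemma Ck_SucI:
  assumes "\<And>x. x \<in> {0..1} \<Longrightarrow> (v has_real_derivative w x) (at x within {0..1})" "w \<in> Ck k"
  shows "v \<in> Ck (Suc k)"
proof (rule CkI[of _ "\<lambda>j. if j = 0 then v else (Dx ^^ (j - 1)) w"])
  show "((if j = 0 then v else (Dx ^^ (j - 1)) w) has_real_derivative
      (if Suc j = 0 then v else (Dx ^^ (Suc j - 1)) w) x) (at x within {0..1})"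
    if "j < Suc k" "x \<in> {0..1}" for j x
    using that assms Ck_has_derivative[OF assms(2), of "j - 1" x] by (cases j) auto
qed (use assms Ck_continuous in auto)

lemma Ck_linear:
  assumes "v \<in> Ck k" "w \<in> Ck k"
  shows "(\<lambda>x. a * v x + b * w x) \<in> Ck k"
proof (rule CkI[of _ "\<lambda>j x. a * (Dx ^^ j) v x + b * (Dx ^^ j) w x"])
  show "((\<lambda>x. a * (Dx ^^ j) v x + b * (Dx ^^ j) w x) has_real_derivative
      a * (Dx ^^ Suc j) v x + b * (Dx ^^ Suc j) w x) (at x within {0..1})"
    if "j < k" "x \<in> {0..1}" for j x
    by (intro DERIV_add DERIV_cmult Ck_has_derivative[OF assms(1) that] Ck_has_derivative[OF assms(2) that])
  show "continuous_on {0..1} (\<lambda>x. a * (Dx ^^ k) v x + b * (Dx ^^ k) w x)"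
    by (intro continuous_intros Ck_continuous[OF assms(1)] Ck_continuous[OF assms(2)]) auto
qed simp

lemma Ck_zero: "(\<lambda>x. 0) \<in> Ck k"
  by (rule CkI[of _ "\<lambda>j x. 0"]) auto

lemma Ck_sum:
  "finite A \<Longrightarrow> (\<And>i. i \<in> A \<Longrightarrow> v i \<in> Ck k) \<Longrightarrow> (\<lambda>x. \<Sum>i\<in>A. c i * v i x) \<in> Ck k"
proof (induction A rule: finite_induct)
  case (insert i A)
  then show ?case
    using Ck_linear[of "v i" k "\<lambda>x. \<Sum>i\<in>A. c i * v i x" "c i" 1] by simp
qed (simp add: Ck_zero)

lemma Ck_mono: "j \<le> k \<Longrightarrow> Ck k \<subseteq> Ck j"
  by (auto simp: Ck_def)

lemma Ck_cmult: "v \<in> Ck k \<Longrightarrow> (\<lambda>x. c * v x) \<in> Ck k"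
  using Ck_linear[of v k v c 0] by simp

lemma Ck_power: "(\<lambda>x. x ^ j) \<in> Ck k"
proof (induction k arbitrary: j)
  case 0
  show ?case by (rule CkI[of _ "\<lambda>i x. x ^ j"]) (auto intro!: continuous_intros)
next
  case (Suc k)
  show ?case
  proof (rule Ck_SucI)
    show "((\<lambda>x. x ^ j) has_real_derivative real j * x ^ (j - Suc 0)) (at x within {0..1})" for x
      by (rule DERIV_pow)
    show "(\<lambda>x. real j * x ^ (j - Suc 0)) \<in> Ck k"
      by (intro Ck_cmult Suc)
  qed
qed

lemma Ck_tpow: "tpow (Suc k) a \<in> Ck k"
proof (induction k)
  case 0
  show ?case by (rule CkI[of _ "\<lambda>i. tpow (Suc 0) a"]) (auto intro: continuous_on_tpow_Suc)
next
  case (Suc k)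
  show ?case
  proof (rule Ck_SucI)
    show "(tpow (Suc (Suc k)) a has_real_derivative real (Suc (Suc k)) * tpow (Suc k) a x) (at x within {0..1})" for x
      by (rule tpow_has_derivative) simp
    show "(\<lambda>x. real (Suc (Suc k)) * tpow (Suc k) a x) \<in> Ck k"
      by (intro Ck_cmult Suc)
  qed
qed

lemma Ck_spline:
  assumes "2 \<le> r"
  shows "spline r N z c d \<in> Ck (r - 2)"
proof -
  have "tpow (r - 1) a \<in> Ck (r - 2)" for a
    using Ck_tpow[of "r - 2" a] assms by (simp add: numeral_2_eq_2 Suc_diff_Suc)
  then have "(\<lambda>x. 1 * (\<Sum>j<r. c j * x ^ j) + 1 * (\<Sum>i=2..N. d i * tpow (r - 1) (z i) x)) \<in> Ck (r - 2)"
    by (intro Ck_linear Ck_sum Ck_power) auto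
  then show ?thesis
    by (simp add: spline_def[abs_def])
qed

lemma spline_piece:
  assumes z: "partition_01 N z" and r: "2 \<le> r" and i: "i \<in> {1..N}"
  obtains p where "degree p \<le> r - 1" "\<And>x. x \<in> {z i..z (i + 1)} \<Longrightarrow> spline r N z c d x = poly p x"
proof -
  define q :: "nat \<Rightarrow> real poly" where "q k = (if k \<le> i then [:- z k, 1:] ^ (r - 1) else 0)" for k
  define p where "p = (\<Sum>j<r. monom (c j) j) + (\<Sum>k=2..N. smult (d k) (q k))"
  have "degree (q k) \<le> r - 1" for k
    using degree_power_le[of "[:- z k, 1:]" "r - 1"] by (simp add: q_def)
  then have "degree (smult (d k) (q k)) \<le> r - 1" for k
    by (rule order_trans[OF degree_smult_le])
  moreover have "degree (monom (c j) j) \<le> r - 1" if "j < r" for j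
    using degree_monom_le[of "c j" j] that by linarith
  ultimately have "degree p \<le> r - 1"
    unfolding p_def by (intro degree_add_le degree_sum_le) auto
  moreover have "spline r N z c d x = poly p x" if x: "x \<in> {z i..z (i + 1)}" for x
  proof -
    have "tpow (r - 1) (z k) x = poly (q k) x" if k: "k \<in> {2..N}" for k
    proof (cases "k \<le> i")
      case True
      then have "z k \<le> x"
        using partition_mono[OF z, of k i] k i x by auto
      then show ?thesis
        using True by (simp add: tpow_def q_def poly_power)
    next
      case False
      then have "x \<le> z k"
        using partition_mono[OF z, of "i + 1" k] k i x by auto
      then have "tpow (r - 1) (z k) x = 0"
        using r by (auto simp: tpow_def)
      then show ?thesis
        using False by (simp add: q_def)
    qed
    then show ?thesis
      by (simp add: spline_def p_def poly_sum poly_monom)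
  qed
  ultimately show ?thesis by (rule that)
qed

lemma H10I:
  assumes v: "wderiv v g" and "v 0 = 0" "v 1 = 0"
  shows "v \<in> H10"
proof -
  have g: "bmeas g" using wderiv_bmeas[OF v] by simp
  have "set_borel_measurable lebesgue {0..1} g"
    using g borel_measurable_restrict_space_iff[of "{0..1}" lebesgue g]
    by (simp add: set_borel_measurable_def bmeas_def)
  moreover have "set_integrable lebesgue {0..1} (\<lambda>x. (g x)\<^sup>2)"
    using bmeas_integrable[of "\<lambda>x. (g x)\<^sup>2"] g
    by (simp add: set_integrable_def integrable_restrict_space)
  ultimately have "g \<in> L2"
    by (simp add: L2_def)
  moreover have "v x = v 0 + (LINT y:{0..x}|lebesgue. g y)" if x: "x \<in> {0..1}" for x
  proof -
    have "(LINT y:{0..x}|lebesgue. g y) = (LINT y|lebesgue. indicator {0..1} y *\<^sub>R (indicator {0..x} y * g y))"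
      unfolding set_lebesgue_integral_def using x
      by (intro Bochner_Integration.integral_cong) (auto simp: indicator_def)
    also have "\<dots> = int01 (\<lambda>y. indicator {0..x} y * g y)"
      unfolding int01_def by (subst integral_restrict_space) auto
    also have "\<dots> = v x - v 0"
      using x by (intro wderiv_int01_indicator[OF v]) auto
    finally show ?thesis by simp
  qed
  ultimately show ?thesis
    using assms by (auto simp: H10_def H1_def)
qed

lemma bmeas_piecewise_poly:
  assumes z: "partition_01 N z"
    and f: "\<And>i x. i \<in> {1..N} \<Longrightarrow> z i < x \<Longrightarrow> x < z (i + 1) \<Longrightarrow> f x = poly (p i) x"
  shows "bmeas f"
proof (rule bmeas_cong_finite)
  show "finite (z ` {1..N+1})" by simp
  show "(\<Sum>i=1..N. indicator {z i..<z (i + 1)} x * poly (p i) x) = f x" if x: "x \<in> {0..1} - z ` {1..N+1}" for x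
  proof -
    have "z (N + 1) = 1" using z by (simp add: partition_01_def)
    then have "x \<noteq> 1" using x by force
    with x have x1: "0 \<le> x" "x < 1" by auto
    have "(\<Sum>i=1..N. indicator {z i..<z (i + 1)} x * poly (p i) x) =
        (\<Sum>i=1..N. indicator {z i..<z (i + 1)} x * f x)"
    proof (intro sum.cong refl)
      fix i assume i: "i \<in> {1..N}"
      then have "x \<noteq> z i" using x by auto
      then show "indicator {z i..<z (i + 1)} x * poly (p i) x = indicator {z i..<z (i + 1)} x * f x"
        using f[OF i, of x] by (simp add: indicator_def)
    qed
    also have "\<dots> = f x"
      using partition_indicator_sum[OF z x1] by (simp only: sum_distrib_right[symmetric] mult_1)
    finally show ?thesis .
  qed
  show "bmeas (\<lambda>x. \<Sum>i=1..N. indicator {z i..<z (i + 1)} x * poly (p i) x)"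
    by (intro bmeas_sum bmeas_mult bmeas_indicator bmeas_continuous continuous_intros)
qed

lemma fe_space0_basic:
  assumes z: "partition_01 N z" and \<phi>: "\<phi> \<in> fe_space0 r \<mu> N z"
  shows "\<phi> 0 = 0" "\<phi> 1 = 0" "wderiv \<phi> (Dx \<phi>)" "continuous_on {0..1} \<phi>" "\<phi> \<in> Ck \<mu>"
    and "\<And>i. i \<in> {1..N} \<Longrightarrow> \<exists>p. degree p \<le> r - 1 \<and> (\<forall>x\<in>{z i..z (i + 1)}. \<phi> x = poly p x) \<and>
      (\<forall>x\<in>{z i<..<z (i + 1)}. Dx \<phi> x = poly (pderiv p) x)"
proof -
  show "\<phi> 0 = 0" "\<phi> 1 = 0" and ck: "\<phi> \<in> Ck \<mu>"
    using \<phi> by (auto simp: fe_space0_def fe_space_def H10_def)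
  then show cont: "continuous_on {0..1} \<phi>"
    using Ck_continuous[of \<phi> \<mu> 0] by simp
  obtain p where p: "\<And>i. i \<in> {1..N} \<Longrightarrow> degree (p i) \<le> r - 1"
    "\<And>i x. i \<in> {1..N} \<Longrightarrow> x \<in> {z i..z (i + 1)} \<Longrightarrow> \<phi> x = poly (p i) x"
  proof -
    have "\<forall>i\<in>{1..N}. \<exists>p. degree p \<le> r - 1 \<and> (\<forall>x\<in>{z i..z (i + 1)}. \<phi> x = poly p x)"
      using \<phi> by (simp add: fe_space0_def fe_space_def)
    from bchoice[OF this] obtain p
      where "\<forall>i\<in>{1..N}. degree (p i) \<le> r - 1 \<and> (\<forall>x\<in>{z i..z (i + 1)}. \<phi> x = poly (p i) x)" ..
    then show ?thesis by (intro that) auto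
  qed
  have der: "(\<phi> has_real_derivative poly (pderiv (p i)) x) (at x within {0..1})"
    if i: "i \<in> {1..N}" and x: "z i < x" "x < z (i + 1)" for i x
  proof -
    have "eventually (\<lambda>y. y \<in> {z i<..<z (i + 1)}) (nhds x)"
      using x by (intro eventually_nhds_in_open) auto
    then have ev: "eventually (\<lambda>y. \<phi> y = poly (p i) y) (nhds x)"
      by eventually_elim (use p(2)[OF i] in auto)
    have "(\<phi> has_real_derivative poly (pderiv (p i)) x) (at x)"
      by (rule iffD2[OF DERIV_cong_ev[OF refl ev refl] poly_DERIV])
    then show ?thesis
      by (rule has_field_derivative_at_within)
  qed
  have range: "x \<in> {0..1}" if "i \<in> {1..N}" "z i < x" "x < z (i + 1)" for i x
    using partition_range[OF z, of i] partition_range[OF z, of "i + 1"] that by auto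
  have Dx: "Dx \<phi> x = poly (pderiv (p i)) x" if "i \<in> {1..N}" "z i < x" "x < z (i + 1)" for i x
    by (rule Dx_eqI[OF der[OF that] range[OF that]])
  show "wderiv \<phi> (Dx \<phi>)"
  proof (rule wderivI)
    show "bmeas (Dx \<phi>)"
      by (rule bmeas_piecewise_poly[OF z Dx])
    show "finite (z ` {1..N+1})" by simp
    show "(\<phi> has_real_derivative Dx \<phi> x) (at x within {0..1})" if x: "x \<in> {0..1} - z ` {1..N+1}" for x
    proof -
      have "z (N + 1) = 1" using z by (simp add: partition_01_def)
      then have "x \<noteq> 1" using x by force
      then obtain i where i: "i \<in> {1..N}" "z i \<le> x" "x < z (i + 1)"
        using x by (auto intro: partition_interval[OF z, of x])
      moreover have "x \<noteq> z i" using x i by auto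
      ultimately have "z i < x" by simp
      then show ?thesis
        using der[OF i(1) _ i(3)] Dx[OF i(1) _ i(3)] by simp
    qed
  qed (rule cont)
  show "\<exists>p. degree p \<le> r - 1 \<and> (\<forall>x\<in>{z i..z (i + 1)}. \<phi> x = poly p x) \<and>
      (\<forall>x\<in>{z i<..<z (i + 1)}. Dx \<phi> x = poly (pderiv p) x)" if "i \<in> {1..N}" for i
    using p[OF that] Dx[OF that] by (intro exI[of _ "p i"]) auto
qed

lemma fe_space0I:
  assumes "\<phi> \<in> Ck \<mu>" "wderiv \<phi> g" "\<phi> 0 = 0" "\<phi> 1 = 0"
    "\<And>i. i \<in> {1..N} \<Longrightarrow> \<exists>p. degree p \<le> r - 1 \<and> (\<forall>x\<in>{z i..z (i + 1)}. \<phi> x = poly p x)"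
  shows "\<phi> \<in> fe_space0 r \<mu> N z"
  using assms H10I[of \<phi> g] by (simp add: fe_space0_def fe_space_def)

lemma fe_space0_linear:
  assumes z: "partition_01 N z" and \<phi>: "\<phi> \<in> fe_space0 r \<mu> N z" and \<psi>: "\<psi> \<in> fe_space0 r \<mu> N z"
  shows "(\<lambda>x. a * \<phi> x + b * \<psi> x) \<in> fe_space0 r \<mu> N z"
proof (rule fe_space0I)
  note f = fe_space0_basic[OF z \<phi>] and g = fe_space0_basic[OF z \<psi>]
  show "(\<lambda>x. a * \<phi> x + b * \<psi> x) \<in> Ck \<mu>"
    by (intro Ck_linear f g)
  show "wderiv (\<lambda>x. a * \<phi> x + b * \<psi> x) (\<lambda>x. a * Dx \<phi> x + b * Dx \<psi> x)"
    by (intro wderiv_add wderiv_cmult f g)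
  show "a * \<phi> 0 + b * \<psi> 0 = 0" "a * \<phi> 1 + b * \<psi> 1 = 0"
    using f g by simp_all
  show "\<exists>p. degree p \<le> r - 1 \<and> (\<forall>x\<in>{z i..z (i + 1)}. a * \<phi> x + b * \<psi> x = poly p x)" if i: "i \<in> {1..N}" for i
  proof -
    obtain p where p: "degree p \<le> r - 1" "\<forall>x\<in>{z i..z (i + 1)}. \<phi> x = poly p x"
      using f(6)[OF i] by blast
    obtain q where q: "degree q \<le> r - 1" "\<forall>x\<in>{z i..z (i + 1)}. \<psi> x = poly q x"
      using g(6)[OF i] by blast
    have "degree (smult a p + smult b q) \<le> r - 1"
      using p(1) q(1) by (intro degree_add_le order_trans[OF degree_smult_le]) auto
    moreover have "\<forall>x\<in>{z i..z (i + 1)}. a * \<phi> x + b * \<psi> x = poly (smult a p + smult b q) x"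
      using p(2) q(2) by simp
    ultimately show ?thesis by blast
  qed
qed

lemma fe_space0_diff:
  assumes "partition_01 N z" "\<phi> \<in> fe_space0 r \<mu> N z" "\<psi> \<in> fe_space0 r \<mu> N z"
  shows "(\<lambda>x. \<phi> x - \<psi> x) \<in> fe_space0 r \<mu> N z"
  using fe_space0_linear[OF assms, of 1 "-1"] by simp

lemma spline_mem_fe_space0:
  assumes z: "partition_01 N z" and "2 \<le> r" "\<mu> \<le> r - 2" "wderiv (spline r N z c d) g"
    "spline r N z c d 0 = 0" "spline r N z c d 1 = 0"
  shows "spline r N z c d \<in> fe_space0 r \<mu> N z"
proof (rule fe_space0I)
  show "spline r N z c d \<in> Ck \<mu>"
    using Ck_spline[OF assms(2)] Ck_mono[OF assms(3)] by blast
  show "\<exists>p. degree p \<le> r - 1 \<and> (\<forall>x\<in>{z i..z (i + 1)}. spline r N z c d x = poly p x)" if "i \<in> {1..N}" for i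
    by (rule spline_piece[OF z assms(2) that, of c d]) blast
qed (use assms in auto)

lemma nodal_basis:
  fixes V :: "(real \<Rightarrow> real) set"
  assumes "finite X"
    and lin: "\<And>f g a b. f \<in> V \<Longrightarrow> g \<in> V \<Longrightarrow> (\<lambda>x. a * f x + b * g x) \<in> V"
    and det: "\<And>f x. f \<in> V \<Longrightarrow> (\<And>p. p \<in> X \<Longrightarrow> f p = 0) \<Longrightarrow> x \<in> {0..1} \<Longrightarrow> f x = 0"
  shows "\<exists>X' L. X' \<subseteq> X \<and> (\<forall>p\<in>X'. L p \<in> V) \<and> (\<forall>f\<in>V. \<forall>x\<in>{0..1}. f x = (\<Sum>p\<in>X'. f p * L p x))"
  using assms
proof (induction X arbitrary: V rule: finite_induct)
  case empty
  then show ?case by (intro exI[of _ "{}"]) auto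
next
  case (insert q X)
  show ?case
  proof (cases "\<forall>f\<in>V. f q = 0")
    case True
    have "\<exists>X' L. X' \<subseteq> X \<and> (\<forall>p\<in>X'. L p \<in> V) \<and> (\<forall>f\<in>V. \<forall>x\<in>{0..1}. f x = (\<Sum>p\<in>X'. f p * L p x))"
    proof (rule insert.IH[OF insert.prems(1)])
      show "f x = 0" if "f \<in> V" "\<And>p. p \<in> X \<Longrightarrow> f p = 0" "x \<in> {0..1}" for f x
        using that True by (intro insert.prems(2)[OF that(1) _ that(3)]) auto
    qed
    then obtain X' L where "X' \<subseteq> X" and "\<forall>p\<in>X'. L p \<in> V"
      and "\<forall>f\<in>V. \<forall>x\<in>{0..1}. f x = (\<Sum>p\<in>X'. f p * L p x)"
      by (elim exE conjE) (rule that)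
    then show ?thesis
      by (intro exI[of _ X'] exI[of _ L] conjI subset_insertI2)
  next
    case False
    then obtain v0 where v0: "v0 \<in> V" "v0 q \<noteq> 0" unfolding Ball_def by auto
    define v where "v x = (1 / v0 q) * v0 x + 0 * v0 x" for x
    have v: "v \<in> V" "v q = 1"
      subgoal unfolding v_def[abs_def] by (rule insert.prems(1)[OF v0(1) v0(1)])
      subgoal unfolding v_def using v0(2) by simp
      done
    define V' where "V' = {f \<in> V. f q = 0}"
    have "\<exists>X' L. X' \<subseteq> X \<and> (\<forall>p\<in>X'. L p \<in> V') \<and> (\<forall>f\<in>V'. \<forall>x\<in>{0..1}. f x = (\<Sum>p\<in>X'. f p * L p x))"
    proof (rule insert.IH)
      show "(\<lambda>x. a * f x + b * g x) \<in> V'" if "f \<in> V'" "g \<in> V'" for f g a b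
        using insert.prems(1)[of f g a b] that by (simp add: V'_def)
      show "f x = 0" if "f \<in> V'" "\<And>p. p \<in> X \<Longrightarrow> f p = 0" "x \<in> {0..1}" for f x
        using insert.prems(2)[of f x] that by (auto simp: V'_def)
    qed
    then obtain X' L where X': "X' \<subseteq> X" and "\<forall>p\<in>X'. L p \<in> V'"
      and "\<forall>f\<in>V'. \<forall>x\<in>{0..1}. f x = (\<Sum>p\<in>X'. f p * L p x)"
      by (elim exE conjE) (rule that)
    then have L: "\<And>p. p \<in> X' \<Longrightarrow> L p \<in> V'"
      and rep: "\<And>f x. f \<in> V' \<Longrightarrow> x \<in> {0..1} \<Longrightarrow> f x = (\<Sum>p\<in>X'. f p * L p x)"
      by (auto simp only:)
    have finX': "finite X'" using X' insert.hyps(1) by (rule finite_subset)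
    have q: "q \<notin> X'" using X' insert.hyps(2) by blast
    have zero: "(\<lambda>x. 0) \<in> V" using insert.prems(1)[OF v(1) v(1), of 0 0] by simp
    have comb: "(\<lambda>x. \<Sum>p\<in>Y. c p * L p x) \<in> V" if "finite Y" "Y \<subseteq> X'" for Y c
      using that
    proof (induction Y rule: finite_induct)
      case (insert y Y)
      then have "L y \<in> V" using L[of y] by (simp add: V'_def)
      then show ?case
        using insert \<open>\<And>f g a b. f \<in> V \<Longrightarrow> g \<in> V \<Longrightarrow> (\<lambda>x. a * f x + b * g x) \<in> V\<close>[of "L y" "\<lambda>x. \<Sum>p\<in>Y. c p * L p x" "c y" 1]
        by simp
    qed (simp add: zero)
    define w where "w x = 1 * v x + (-1) * (\<Sum>p\<in>X'. v p * L p x)" for x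
    have w: "w \<in> V"
      unfolding w_def[abs_def] by (rule insert.prems(1)[OF v(1) comb[OF finX' order_refl]])
    show ?thesis
    proof (intro exI[of _ "insert q X'"] exI[of _ "L(q := w)"] conjI ballI)
      show "insert q X' \<subseteq> insert q X" using X' by blast
      show "(L(q := w)) p \<in> V" if "p \<in> insert q X'" for p
        using that w L[of p] by (auto simp: V'_def)
      show "f x = (\<Sum>p\<in>insert q X'. f p * (L(q := w)) p x)" if f: "f \<in> V" and x: "x \<in> {0..1}" for f x
      proof -
        define g where "g x = 1 * f x + (- f q) * v x" for x
        have g: "g \<in> V'"
          unfolding V'_def g_def[abs_def] using insert.prems(1)[OF f v(1), of 1 "- f q"] v(2) by simp
        have "f x = f q * v x + (\<Sum>p\<in>X'. g p * L p x)"
          using rep[OF g x] by (simp add: g_def)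
        also have "(\<Sum>p\<in>X'. g p * L p x) = (\<Sum>p\<in>X'. f p * L p x) - f q * (\<Sum>p\<in>X'. v p * L p x)"
          by (simp add: g_def left_diff_distrib sum_subtractf sum_distrib_left mult.assoc)
        also have "f q * v x + ((\<Sum>p\<in>X'. f p * L p x) - f q * (\<Sum>p\<in>X'. v p * L p x)) =
            f q * w x + (\<Sum>p\<in>X'. f p * L p x)"
          by (simp add: w_def right_diff_distrib)
        also have "(\<Sum>p\<in>X'. f p * L p x) = (\<Sum>p\<in>X'. f p * (L(q := w)) p x)"
          using q by (intro sum.cong) auto
        finally show ?thesis
          using finX' q by simp
      qed
    qed
  qed
qed

lemma fe_space0_nodal_basis:
  assumes z: "partition_01 N z" and r: "1 \<le> r"
  shows "\<exists>X L. finite X \<and> X \<subseteq> {0..1} \<and> (\<forall>p\<in>X. L p \<in> fe_space0 r \<mu> N z) \<and>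
    (\<forall>\<phi>\<in>fe_space0 r \<mu> N z. \<forall>x\<in>{0..1}. \<phi> x = (\<Sum>p\<in>X. \<phi> p * L p x))"
proof -
  define node where "node i j = z i + real j * ((z (i + 1) - z i) / real r)" for i j
  define X where "X = (\<Union>i\<in>{1..N}. node i ` {..<r})"
  have node: "node i j \<in> {z i..z (i + 1)}" if "i \<in> {1..N}" "j < r" for i j
  proof -
    define d where "d = (z (i + 1) - z i) / real r"
    have d: "d > 0" "real r * d = z (i + 1) - z i"
      using partition_less[OF z that(1)] r by (simp_all add: d_def)
    have "real j * d \<le> real r * d"
      using d that by (intro mult_right_mono) auto
    then show ?thesis
      unfolding node_def d_def[symmetric] using d by simp
  qed
  have X01: "X \<subseteq> {0..1}"
  proof
    fix p assume "p \<in> X"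
    then obtain i j where ij: "i \<in> {1..N}" "j < r" "p = node i j"
      by (auto simp: X_def)
    then show "p \<in> {0..1}"
      using node[OF ij(1,2)] partition_range[OF z, of i] partition_range[OF z, of "i + 1"] by auto
  qed
  have det: "\<phi> x = 0" if \<phi>: "\<phi> \<in> fe_space0 r \<mu> N z" and X: "\<And>p. p \<in> X \<Longrightarrow> \<phi> p = 0" and x: "x \<in> {0..1}" for \<phi> x
  proof (cases "x = 1")
    case True
    then show ?thesis using fe_space0_basic[OF z \<phi>] by simp
  next
    case False
    with x have "0 \<le> x" "x < 1" by auto
    then obtain i where i: "i \<in> {1..N}" "z i \<le> x" "x < z (i + 1)"
      using partition_interval[OF z] by blast
    obtain p where p: "degree p \<le> r - 1" "\<forall>x\<in>{z i..z (i + 1)}. \<phi> x = poly p x"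
      using fe_space0_basic(6)[OF z \<phi> i(1)] by blast
    have "inj_on (node i) {..<r}"
      using partition_less[OF z i(1)] r by (auto simp: inj_on_def node_def)
    then have card: "card (node i ` {..<r}) = r"
      by (simp add: card_image)
    have "p = 0"
    proof (rule poly_eqI_degree[where A = "node i ` {..<r}"])
      fix y assume "y \<in> node i ` {..<r}"
      then have "y \<in> X" "y \<in> {z i..z (i + 1)}"
        using node[OF i(1)] i(1) by (auto simp: X_def)
      then show "poly p y = poly 0 y"
        using X[of y] p(2) by simp
    qed (use card p(1) r in auto)
    then show ?thesis
      using p(2) i by auto
  qed
  have "finite X" by (simp add: X_def)
  have "\<exists>X' L. X' \<subseteq> X \<and> (\<forall>p\<in>X'. L p \<in> fe_space0 r \<mu> N z) \<and>
      (\<forall>f\<in>fe_space0 r \<mu> N z. \<forall>x\<in>{0..1}. f x = (\<Sum>p\<in>X'. f p * L p x))"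
    by (rule nodal_basis[OF \<open>finite X\<close>]) (fact fe_space0_linear[OF z], fact det)
  then obtain X' L where "X' \<subseteq> X"
    "\<forall>p\<in>X'. L p \<in> fe_space0 r \<mu> N z" "\<forall>f\<in>fe_space0 r \<mu> N z. \<forall>x\<in>{0..1}. f x = (\<Sum>p\<in>X'. f p * L p x)"
    by blast
  then show ?thesis
    using finite_subset[OF \<open>X' \<subseteq> X\<close> \<open>finite X\<close>] X01 by (intro exI[of _ X'] exI[of _ L]) auto
qed

lemma (in semi_inner) fe_projection:
  assumes z: "partition_01 N z" and r: "1 \<le> r"
    and W: "fe_space0 r \<mu> N z \<subseteq> W" and f: "f \<in> W"
  obtains w where "w \<in> fe_space0 r \<mu> N z" "\<And>\<phi>. \<phi> \<in> fe_space0 r \<mu> N z \<Longrightarrow> B (\<lambda>x. f x - w x) \<phi> = 0"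
proof -
  let ?S = "fe_space0 r \<mu> N z"
  obtain X L where X: "finite X" and "\<forall>p\<in>X. L p \<in> ?S"
    and "\<forall>\<phi>\<in>?S. \<forall>x\<in>{0..1}. \<phi> x = (\<Sum>p\<in>X. \<phi> p * L p x)"
    using fe_space0_nodal_basis[OF z r, of \<mu>] by (elim exE conjE) (rule that)
  then have L: "\<And>p. p \<in> X \<Longrightarrow> L p \<in> ?S"
    and rep: "\<And>\<phi> x. \<phi> \<in> ?S \<Longrightarrow> x \<in> {0..1} \<Longrightarrow> \<phi> x = (\<Sum>p\<in>X. \<phi> p * L p x)"
    by (auto simp only:)
  have LW: "L p \<in> W" if "p \<in> X" for p using L[OF that] W by blast
  obtain c where c: "\<And>d. B (\<lambda>x. f x - (\<Sum>k\<in>X. c k * L k x)) (\<lambda>x. \<Sum>k\<in>X. d k * L k x) = 0"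
    by (rule projection_exists[OF X LW f]) blast+
  have zero: "(\<lambda>x. 0) \<in> ?S"
    by (rule fe_space0I[OF Ck_zero wderiv_const]) (auto intro: exI[of _ 0])
  have comb: "(\<lambda>x. \<Sum>p\<in>Y. c p * L p x) \<in> ?S" if "finite Y" "Y \<subseteq> X" for Y
    using that
  proof (induction Y rule: finite_induct)
    case (insert y Y)
    then show ?case
      using fe_space0_linear[OF z L[of y], of "\<lambda>x. \<Sum>p\<in>Y. c p * L p x" "c y" 1] by simp
  qed (simp add: zero)
  define w where "w x = (\<Sum>k\<in>X. c k * L k x)" for x
  have w: "w \<in> ?S"
    unfolding w_def[abs_def] by (rule comb[OF X order_refl])
  show ?thesis
  proof (rule that[OF w])
    fix \<phi> assume \<phi>: "\<phi> \<in> ?S"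
    have fw: "(\<lambda>x. f x - w x) \<in> W"
      using f w W by auto
    have sum: "(\<lambda>x. \<Sum>k\<in>X. \<phi> k * L k x) \<in> W"
      using LW by simp
    have "B (\<lambda>x. f x - w x) \<phi> = B \<phi> (\<lambda>x. f x - w x)"
      using \<phi> W fw by (intro B_sym) auto
    also have "\<dots> = B (\<lambda>x. \<Sum>k\<in>X. \<phi> k * L k x) (\<lambda>x. f x - w x)"
      using \<phi> W fw sum rep[OF \<phi>] by (intro B_cong) auto
    also have "\<dots> = 0"
      using c[of \<phi>] fw sum by (simp add: B_sym w_def[abs_def])
    finally show "B (\<lambda>x. f x - w x) \<phi> = 0" .
  qed
qed

section \<open>Inverse estimates, approximation and duality in the finite element space\<close>

lemma int01_mono_finite:
  assumes "finite S" "bmeas f" "bmeas g" "\<And>x. x \<in> {0..1} - S \<Longrightarrow> f x \<le> g x"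
  shows "int01 f \<le> int01 g"
proof -
  define f' where "f' x = (if x \<in> S then g x else f x)" for x
  have "int01 f = int01 f'"
    by (rule int01_cong_finite[OF assms(1)]) (simp add: f'_def)
  also have "\<dots> \<le> int01 g"
  proof (rule int01_mono)
    show "bmeas f'"
      by (rule bmeas_cong_finite[OF assms(1) _ assms(2)]) (simp add: f'_def)
    show "f' x \<le> g x" if "x \<in> {0..1}" for x
      using assms(4)[of x] that by (cases "x \<in> S") (simp_all add: f'_def)
  qed (rule assms)
  finally show ?thesis .
qed

lemma L2_norm_indicator:
  assumes "0 \<le> a" "a \<le> b" "b \<le> 1"
  shows "L2_norm (\<lambda>x. indicator {a..b} x * c) = \<bar>c\<bar> * sqrt (b - a)"
proof -
  have "(L2_norm (\<lambda>x. indicator {a..b} x * c))\<^sup>2 = int01 (\<lambda>x. indicator {a..b} x * (c * c))"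
    unfolding L2_norm_sq by (intro int01_cong) (simp add: indicator_def)
  also have "\<dots> = (\<bar>c\<bar> * sqrt (b - a))\<^sup>2"
    using int01_indicator_const[OF assms, of "c * c"] assms
    by (simp add: power_mult_distrib) (simp add: power2_eq_square)
  finally show ?thesis
    by (rule power2_eq_imp_eq) (use assms in auto)
qed

lemma interval_inside:
  assumes z: "partition_01 N z" and x: "x \<in> {0..1} - z ` {1..N+1}"
  obtains i where "i \<in> {1..N}" "z i < x" "x < z (i + 1)"
proof -
  have "z (N + 1) = 1" using z by (simp add: partition_01_def)
  then have "x \<noteq> 1" using x by force
  then have x1: "0 \<le> x" "x < 1" using x by auto
  obtain i where i: "i \<in> {1..N}" "z i \<le> x" "x < z (i + 1)"
    by (rule partition_interval[OF z x1])
  moreover have "x \<noteq> z i" using x i by auto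
  ultimately show ?thesis by (intro that[of i]) auto
qed

lemma fe_inverse_estimates:
  fixes r :: nat
  obtains C where "C \<ge> 0"
    "\<And>N z \<mu> \<phi>. partition_01 N z \<Longrightarrow> \<phi> \<in> fe_space0 r \<mu> N z \<Longrightarrow>
      L2_norm (Dx \<phi>) \<le> C / min_mesh N z * L2_norm \<phi>"
    "\<And>N z \<mu> \<phi> g M x. partition_01 N z \<Longrightarrow> \<phi> \<in> fe_space0 r \<mu> N z \<Longrightarrow> bmeas g \<Longrightarrow>
      (\<And>x. x \<in> {0..1} \<Longrightarrow> \<bar>g x\<bar> \<le> M) \<Longrightarrow> x \<in> {0..1} - z ` {1..N+1} \<Longrightarrow>
      \<bar>Dx \<phi> x\<bar> \<le> C * (L2_norm (\<lambda>x. Dx \<phi> x - g x) / sqrt (min_mesh N z) + M)"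
proof -
  obtain c where c0: "c \<ge> 0" and c1: "\<And>a b p x. 0 \<le> a \<Longrightarrow> a < b \<Longrightarrow> b \<le> 1 \<Longrightarrow> degree p \<le> r - 1 \<Longrightarrow> x \<in> {a..b} \<Longrightarrow>
      (poly p x)\<^sup>2 * (b - a) \<le> c * int01 (\<lambda>x. indicator {a..b} x * (poly p x * poly p x))"
    and c2: "\<And>a b p x. 0 \<le> a \<Longrightarrow> a < b \<Longrightarrow> b \<le> 1 \<Longrightarrow> degree p \<le> r - 1 \<Longrightarrow> x \<in> {a..b} \<Longrightarrow>
      (poly (pderiv p) x)\<^sup>2 * (b - a) ^ 3 \<le> c * int01 (\<lambda>x. indicator {a..b} x * (poly p x * poly p x))"
    by (rule poly_interval_bounds[of "r - 1"]) blast
  show ?thesis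
  proof (rule that[of "sqrt c"])
    show "0 \<le> sqrt c" using c0 by simp
  next
    fix N z \<mu> \<phi>
    assume z: "partition_01 N z" and \<phi>: "\<phi> \<in> fe_space0 r \<mu> N z"
    note f = fe_space0_basic[OF z \<phi>]
    have bm: "bmeas \<phi>" "bmeas (Dx \<phi>)" using wderiv_bmeas[OF f(3)] by auto
    define k where "k = min_mesh N z"
    have k: "k > 0" using min_mesh_pos[OF z] by (simp add: k_def)
    define J where "J i = int01 (\<lambda>x. indicator {z i..z (i + 1)} x * (\<phi> x * \<phi> x))" for i
    have J: "J i \<ge> 0" for i unfolding J_def by (intro int01_nonneg) simp
    have piece: "int01 (\<lambda>x. indicator {z i..<z (i + 1)} x * (Dx \<phi> x * Dx \<phi> x)) \<le> c / k\<^sup>2 * J i"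
      if i: "i \<in> {1..N}" for i
    proof -
      define d where "d = z (i + 1) - z i"
      have d: "k \<le> d" "d > 0" using min_mesh_le[OF i, of z] k by (auto simp: d_def k_def)
      have zi: "0 \<le> z i" "z i < z (i + 1)" "z (i + 1) \<le> 1"
        using partition_range[OF z, of i] partition_range[OF z, of "i + 1"] partition_less[OF z i] i by auto
      obtain p where p: "degree p \<le> r - 1" "\<forall>x\<in>{z i..z (i + 1)}. \<phi> x = poly p x"
        "\<forall>x\<in>{z i<..<z (i + 1)}. Dx \<phi> x = poly (pderiv p) x"
        using f(6)[OF i] by blast
      have Jp: "int01 (\<lambda>x. indicator {z i..z (i + 1)} x * (poly p x * poly p x)) = J i"
        unfolding J_def using p(2) by (intro int01_cong) (simp add: indicator_def)
      have pt: "Dx \<phi> x * Dx \<phi> x \<le> c * J i / d ^ 3" if x: "x \<in> {z i<..<z (i + 1)}" for x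
      proof -
        have "(poly (pderiv p) x)\<^sup>2 * d ^ 3 \<le> c * J i"
          using c2[OF zi p(1), of x] x unfolding Jp d_def by simp
        then show ?thesis
          using d p(3) x by (simp add: pos_le_divide_eq power2_eq_square)
      qed
      have "int01 (\<lambda>x. indicator {z i..<z (i + 1)} x * (Dx \<phi> x * Dx \<phi> x)) \<le>
          int01 (\<lambda>x. indicator {z i..<z (i + 1)} x * (c * J i / d ^ 3))"
        by (rule int01_mono_finite[of "{z i}"])
           (use bm pt in \<open>auto intro!: bmeas_mult bmeas_indicator split: split_indicator\<close>)
      also have "\<dots> = (c * J i / d ^ 3) * d"
        unfolding int01_Ico_eq_Icc using zi by (subst int01_indicator_const) (auto simp: d_def)
      also have "\<dots> = c * J i / d\<^sup>2"
        using d by (simp add: power2_eq_square power3_eq_cube)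
      also have "\<dots> \<le> c * J i / k\<^sup>2"
        using d k c0 J by (intro divide_left_mono power_mono mult_pos_pos) auto
      finally show ?thesis by simp
    qed
    have "(L2_norm (Dx \<phi>))\<^sup>2 \<le> (\<Sum>i=1..N. c / k\<^sup>2 * J i)"
      unfolding L2_norm_sq using bm piece by (subst int01_partition[OF z]) (auto intro!: sum_mono)
    also have "\<dots> = (sqrt c / k * L2_norm \<phi>)\<^sup>2"
      unfolding power_mult_distrib L2_norm_sq J_def int01_Ico_eq_Icc[symmetric] using bm c0
      by (subst (2) int01_partition[OF z]) (auto simp: sum_distrib_left power_divide)
    finally show "L2_norm (Dx \<phi>) \<le> sqrt c / min_mesh N z * L2_norm \<phi>"
      unfolding k_def[symmetric] using c0 k by (intro power2_le_imp_le[of "L2_norm (Dx \<phi>)"]) auto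
  next
    fix N z \<mu> \<phi> g M x
    assume z: "partition_01 N z" and \<phi>: "\<phi> \<in> fe_space0 r \<mu> N z" and g: "bmeas g"
      and M: "\<And>x. x \<in> {0..1} \<Longrightarrow> \<bar>g x\<bar> \<le> M" and x: "x \<in> {0..1} - z ` {1..N+1}"
    note f = fe_space0_basic[OF z \<phi>]
    have bm: "bmeas \<phi>" "bmeas (Dx \<phi>)" using wderiv_bmeas[OF f(3)] by auto
    define k where "k = min_mesh N z"
    have k: "k > 0" using min_mesh_pos[OF z] by (simp add: k_def)
    have M0: "0 \<le> M" using M[of 0] by simp
    obtain i where i: "i \<in> {1..N}" "z i < x" "x < z (i + 1)"
      by (rule interval_inside[OF z x])
    define d where "d = z (i + 1) - z i"
    have d: "k \<le> d" "d > 0" using min_mesh_le[OF i(1), of z] k by (auto simp: d_def k_def)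
    have zi: "0 \<le> z i" "z i < z (i + 1)" "z (i + 1) \<le> 1"
      using partition_range[OF z, of i] partition_range[OF z, of "i + 1"] partition_less[OF z i(1)] i by auto
    obtain p where p: "degree p \<le> r - 1"
      "\<forall>x\<in>{z i<..<z (i + 1)}. Dx \<phi> x = poly (pderiv p) x"
      using f(6)[OF i(1)] by blast
    have dq: "degree (pderiv p) \<le> r - 1"
      using degree_pderiv[of p] p(1) by linarith
    define E where "E = L2_norm (\<lambda>x. Dx \<phi> x - g x)"
    define I :: "real \<Rightarrow> real" where "I x = indicator {z i..z (i + 1)} x" for x
    have bI: "bmeas I" unfolding I_def[abs_def] by (rule bmeas_indicator)
    have I: "\<bar>I y\<bar> \<le> 1" "0 \<le> I y" for y by (auto simp: I_def indicator_def)
    have "L2_norm (\<lambda>y. I y * poly (pderiv p) y) = L2_norm (\<lambda>y. I y * Dx \<phi> y)"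
      by (rule L2_norm_cong_finite[of "{z i, z (i + 1)}"])
         (use p(2) in \<open>auto simp: I_def indicator_def\<close>)
    also have "\<dots> = L2_norm (\<lambda>y. I y * (Dx \<phi> y - g y) + I y * g y)"
      by (intro L2_norm_cong) (simp add: algebra_simps)
    also have "\<dots> \<le> L2_norm (\<lambda>y. I y * (Dx \<phi> y - g y)) + L2_norm (\<lambda>y. I y * g y)"
      using bI bm g by (intro L2_norm_triangle) simp_all
    also have "\<dots> \<le> E + L2_norm (\<lambda>y. I y * M)"
      unfolding E_def
    proof (intro add_mono L2_norm_mono)
      show "\<bar>I y * (Dx \<phi> y - g y)\<bar> \<le> \<bar>Dx \<phi> y - g y\<bar>" for y
        unfolding abs_mult using I(1)[of y] by (intro mult_left_le_one_le) auto
      show "\<bar>I y * g y\<bar> \<le> \<bar>I y * M\<bar>" if "y \<in> {0..1}" for y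
        unfolding abs_mult using M[OF that] M0 by (intro mult_left_mono) auto
    qed (use bI bm g in simp_all)
    also have "L2_norm (\<lambda>y. I y * M) = M * sqrt d"
      unfolding I_def using L2_norm_indicator[of "z i" "z (i + 1)" M] zi M0 by (simp add: d_def)
    finally have b: "L2_norm (\<lambda>y. I y * poly (pderiv p) y) \<le> E + M * sqrt d" .
    have "(Dx \<phi> x)\<^sup>2 * d \<le> c * int01 (\<lambda>y. I y * (poly (pderiv p) y * poly (pderiv p) y))"
      using c1[OF zi dq, of x] i p(2) by (simp add: d_def I_def)
    also have "int01 (\<lambda>y. I y * (poly (pderiv p) y * poly (pderiv p) y)) =
        (L2_norm (\<lambda>y. I y * poly (pderiv p) y))\<^sup>2"
      unfolding L2_norm_sq I_def by (intro int01_cong) (simp add: indicator_def)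
    also have "c * \<dots> \<le> c * (E + M * sqrt d)\<^sup>2"
      by (intro mult_left_mono power_mono b c0) simp
    finally have "(\<bar>Dx \<phi> x\<bar> * sqrt d)\<^sup>2 \<le> (sqrt c * (E + M * sqrt d))\<^sup>2"
      using d c0 by (simp add: power_mult_distrib)
    then have "\<bar>Dx \<phi> x\<bar> * sqrt d \<le> sqrt c * (E + M * sqrt d)"
      by (rule power2_le_imp_le) (use c0 M0 d in \<open>simp add: E_def\<close>)
    then have "\<bar>Dx \<phi> x\<bar> \<le> sqrt c * (E + M * sqrt d) / sqrt d"
      using d by (simp add: pos_le_divide_eq)
    also have "\<dots> = sqrt c * (E / sqrt d + M)"
      using d by (simp add: field_simps)
    also have "\<dots> \<le> sqrt c * (E / sqrt k + M)"
      using d k c0 by (intro mult_left_mono add_right_mono divide_left_mono) (auto simp: E_def)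
    finally show "\<bar>Dx \<phi> x\<bar> \<le> sqrt c * (L2_norm (\<lambda>x. Dx \<phi> x - g x) / sqrt (min_mesh N z) + M)"
      by (simp add: E_def k_def)
  qed
qed

lemma fe_approx:
  assumes z: "partition_01 N z" and r: "2 \<le> r" and \<mu>: "\<mu> \<le> r - 2" and j: "1 \<le> j" "j \<le> r"
    and f: "\<And>i x. i < j \<Longrightarrow> x \<in> {0..1} \<Longrightarrow> (f i has_real_derivative f (Suc i) x) (at x within {0..1})"
    and fj: "continuous_on {0..1} (f j)" and bc: "f 0 0 = 0" "f 0 1 = 0"
  obtains s where "s \<in> fe_space0 r \<mu> N z"
    "L2_norm (\<lambda>x. f 0 x - s x) \<le> max_mesh N z ^ j * L2_norm (f j)"
    "L2_norm (\<lambda>x. f 1 x - Dx s x) \<le> max_mesh N z ^ (j - 1) * L2_norm (f j)"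
proof -
  obtain q where q: "r = Suc q" "1 \<le> q" using r by (cases r) auto
  obtain c d c' d' where s: "wderiv (spline (Suc q) N z c d) (spline q N z c' d')"
    "spline (Suc q) N z c d 0 = f 0 0" "spline (Suc q) N z c d 1 = f 0 1"
    "L2_norm (\<lambda>x. f 0 x - spline (Suc q) N z c d x) \<le> max_mesh N z ^ j * L2_norm (f j)"
    "L2_norm (\<lambda>x. f 1 x - spline q N z c' d' x) \<le> max_mesh N z ^ (j - 1) * L2_norm (f j)"
    by (rule spline_approx_boundary[OF q(2) z j(1) j(2)[unfolded q(1)] f fj]) assumption+
  have mem: "spline (Suc q) N z c d \<in> fe_space0 r \<mu> N z"
    using s bc unfolding q(1)[symmetric] by (intro spline_mem_fe_space0[OF z r \<mu> s(1)[folded q(1)]]) auto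
  obtain S where S: "finite S" "\<forall>x\<in>{0..1} - S. Dx (spline (Suc q) N z c d) x = spline q N z c' d' x"
    using wderiv_Dx_eq[OF s(1)] by blast
  have "L2_norm (\<lambda>x. f 1 x - Dx (spline (Suc q) N z c d) x) = L2_norm (\<lambda>x. f 1 x - spline q N z c' d' x)"
    by (rule L2_norm_cong_finite[OF S(1)]) (use S(2) in auto)
  then show ?thesis
    using s by (intro that[OF mem]) auto
qed

lemma H1_norm_sq:
  assumes "wderiv v g"
  shows "(H1_norm v)\<^sup>2 = (L2_norm v)\<^sup>2 + (L2_norm g)\<^sup>2"
  using A.B_psd[of v] assms by (auto simp: H1_norm_def A_form_int01[OF assms assms] L2_norm_sq)

lemma A_form_H1_norm: "wderiv v g \<Longrightarrow> A_form v v = (H1_norm v)\<^sup>2"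
  by (simp add: H1_norm_sq A_form_int01 L2_norm_sq)

lemma H1_norm_nonneg [simp]: "wderiv v g \<Longrightarrow> 0 \<le> H1_norm v"
  using A.B_psd[of v] by (auto simp: H1_norm_def)

lemma L2_norm_le_H1_norm:
  assumes "wderiv v g"
  shows "L2_norm v \<le> H1_norm v" "L2_norm g \<le> H1_norm v"
  using H1_norm_sq[OF assms] H1_norm_nonneg[OF assms]
  by (auto intro!: power2_le_imp_le[of _ "H1_norm v"])

lemma H1_norm_bound:
  assumes "wderiv v g" "L2_norm v \<le> b" "L2_norm g \<le> b"
  shows "H1_norm v \<le> 2 * b"
proof (rule power2_le_imp_le)
  have "0 \<le> b" using assms(2) L2_norm_nonneg[of v] by linarith
  have "(H1_norm v)\<^sup>2 \<le> b\<^sup>2 + b\<^sup>2"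
    unfolding H1_norm_sq[OF assms(1)] using assms by (intro add_mono power_mono) auto
  also have "\<dots> \<le> (2 * b)\<^sup>2" by (simp add: power_mult_distrib)
  finally show "(H1_norm v)\<^sup>2 \<le> (2 * b)\<^sup>2" .
  show "0 \<le> 2 * b" using \<open>0 \<le> b\<close> by simp
qed

lemma sup_le_H1_norm:
  assumes "wderiv v g" "v 0 = 0" "x \<in> {0..1}"
  shows "\<bar>v x\<bar> \<le> H1_norm v"
  using wderiv_sup_bound[OF assms] L2_norm_le_H1_norm(2)[OF assms(1)] by linarith

lemma H1_Cauchy_Schwarz: "wderiv v g \<Longrightarrow> wderiv w k \<Longrightarrow> \<bar>A_form v w\<bar> \<le> H1_norm v * H1_norm w"
  using A.Cauchy_Schwarz[of v w] by (auto simp: H1_norm_def)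

text \<open>The solution comes from variation of constants with \<open>sinh\<close> and \<open>cosh\<close>.\<close>

lemma elliptic_problem:
  assumes f: "continuous_on {0..1} f"
  obtains v v1 v2 where
    "\<And>x. x \<in> {0..1} \<Longrightarrow> (v has_real_derivative v1 x) (at x within {0..1})"
    "\<And>x. x \<in> {0..1} \<Longrightarrow> (v1 has_real_derivative v2 x) (at x within {0..1})"
    "continuous_on {0..1} v2" "v 0 = 0" "v 1 = 0" "\<And>x. v x - v2 x = f x"
    "L2_norm v2 \<le> L2_norm f"
proof -
  have "continuous_on {0..1} (\<lambda>x. cosh x * f x)" "continuous_on {0..1} (\<lambda>x. sinh x * f x)"
    using f by (intro continuous_intros; simp)+
  note cont = this
  obtain F where F: "F 0 = 0" "\<And>x. x \<in> {0..1} \<Longrightarrow> (F has_real_derivative cosh x * f x) (at x within {0..1})"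
    by (rule wderiv_antideriv[OF cont(1)]) blast
  obtain G where G: "G 0 = 0" "\<And>x. x \<in> {0..1} \<Longrightarrow> (G has_real_derivative sinh x * f x) (at x within {0..1})"
    by (rule wderiv_antideriv[OF cont(2)]) blast
  define c where "c = (sinh 1 * F 1 - cosh 1 * G 1) / sinh 1"
  define v where "v x = cosh x * G x - sinh x * F x + c * sinh x" for x
  define v1 where "v1 x = sinh x * G x - cosh x * F x + c * cosh x" for x
  define v2 where "v2 x = v x - f x" for x
  have v: "(v has_real_derivative v1 x) (at x within {0..1})" if "x \<in> {0..1}" for x
    unfolding v_def[abs_def] v1_def
    by (rule derivative_eq_intros F(2)[OF that] G(2)[OF that] refl)+ (simp add: algebra_simps)
  have cs: "(cosh x)\<^sup>2 - (sinh x)\<^sup>2 = 1" for x :: real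
    by (rule hyperbolic_pythagoras)
  have v1: "(v1 has_real_derivative v2 x) (at x within {0..1})" if "x \<in> {0..1}" for x
  proof -
    have "(v1 has_real_derivative (cosh x * G x + sinh x * (sinh x * f x)) -
        (sinh x * F x + cosh x * (cosh x * f x)) + c * sinh x) (at x within {0..1})"
      unfolding v1_def[abs_def]
      by (rule derivative_eq_intros F(2)[OF that] G(2)[OF that] refl)+ (simp add: algebra_simps)
    moreover have "(cosh x * G x + sinh x * (sinh x * f x)) - (sinh x * F x + cosh x * (cosh x * f x)) + c * sinh x
        = v x - ((cosh x)\<^sup>2 - (sinh x)\<^sup>2) * f x"
      by (simp add: v_def algebra_simps power2_eq_square)
    ultimately show ?thesis by (simp add: v2_def cs)
  qed
  have cv: "continuous_on {0..1} v" by (rule DERIV_continuous_on[OF v])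
  have c2: "continuous_on {0..1} v2"
    unfolding v2_def[abs_def] by (intro continuous_intros cv f)
  have cv1: "continuous_on {0..1} v1" by (rule DERIV_continuous_on[OF v1])
  have v0: "v 0 = 0" by (simp add: v_def F G)
  have "sinh (1::real) \<noteq> 0" by simp
  then have v_1: "v 1 = 0" by (simp add: v_def c_def)
  have wv: "wderiv v v1" by (rule wderiv_C1[OF v cv1])
  have wv1: "wderiv v1 v2" by (rule wderiv_C1[OF v1 c2])
  have bm: "bmeas v" "bmeas v1" "bmeas v2" using wderiv_bmeas[OF wv] wderiv_bmeas[OF wv1] by auto
  have "(L2_norm f)\<^sup>2 = int01 (\<lambda>x. v x * v x - 2 * (v2 x * v x) + v2 x * v2 x)"
    unfolding L2_norm_sq by (intro int01_cong) (simp add: v2_def algebra_simps)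
  also have "\<dots> = (L2_norm v)\<^sup>2 - 2 * int01 (\<lambda>x. v2 x * v x) + (L2_norm v2)\<^sup>2"
    using bm by (simp add: int01_add int01_diff int01_cmult L2_norm_sq)
  also have "int01 (\<lambda>x. v2 x * v x) = - (L2_norm v1)\<^sup>2"
    unfolding L2_norm_sq using int01_by_parts[OF wv1 wv] v0 v_1 by simp
  finally have "(L2_norm v2)\<^sup>2 \<le> (L2_norm f)\<^sup>2" by simp
  then have "L2_norm v2 \<le> L2_norm f" by (rule power2_le_imp_le) simp
  then show ?thesis
    using v v1 c2 v0 v_1 by (intro that[of v v1 v2]) (auto simp: v2_def)
qed

lemma elliptic_weak_form:
  assumes v: "wderiv v v1" "wderiv v1 v2" and f: "\<And>x. v x - v2 x = f x"
    and w: "wderiv w w1" "w 0 = 0" "w 1 = 0"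
  shows "A_form v w = int01 (\<lambda>x. f x * w x)"
proof -
  have bm: "bmeas v" "bmeas v2" "bmeas w"
    using v w by (auto dest: wderiv_bmeas)
  have "int01 (\<lambda>x. v1 x * w1 x) = - int01 (\<lambda>x. v2 x * w x)"
    using int01_by_parts[OF v(2) w(1)] w by simp
  moreover have "int01 (\<lambda>x. f x * w x) = int01 (\<lambda>x. v x * w x) - int01 (\<lambda>x. v2 x * w x)"
    using bm by (simp add: f[symmetric] left_diff_distrib int01_diff)
  ultimately show ?thesis
    by (simp add: A_form_int01[OF v(1) w(1)])
qed

lemma fe_approx_elliptic:
  assumes z: "partition_01 N z" and r: "2 \<le> r" "\<mu> \<le> r - 2" and h: "max_mesh N z \<le> 1"
    and v: "\<And>x. x \<in> {0..1} \<Longrightarrow> (v has_real_derivative v1 x) (at x within {0..1})"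
    "\<And>x. x \<in> {0..1} \<Longrightarrow> (v1 has_real_derivative v2 x) (at x within {0..1})"
    "continuous_on {0..1} v2" "v 0 = 0" "v 1 = 0"
  obtains s where "s \<in> fe_space0 r \<mu> N z" "H1_norm (\<lambda>x. v x - s x) \<le> 2 * (max_mesh N z * L2_norm v2)"
proof -
  define f where "f i = (if i = 0 then v else if i = 1 then v1 else v2)" for i :: nat
  define h' where "h' = max_mesh N z"
  have h': "0 < h'" "h' \<le> 1" using h max_mesh_pos[OF z] by (auto simp: h'_def)
  have "(f i has_real_derivative f (Suc i) x) (at x within {0..1})" if "i < 2" "x \<in> {0..1}" for i x
    using that v(1,2)[OF that(2)] by (auto simp: f_def less_Suc_eq numeral_2_eq_2)
  then obtain s where s: "s \<in> fe_space0 r \<mu> N z"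
    "L2_norm (\<lambda>x. f 0 x - s x) \<le> max_mesh N z ^ 2 * L2_norm (f 2)"
    "L2_norm (\<lambda>x. f 1 x - Dx s x) \<le> max_mesh N z ^ (2 - 1) * L2_norm (f 2)"
    using fe_approx[OF z r, of 2 f] r v(3-5) by (auto simp: f_def)
  have c1: "continuous_on {0..1} v1" by (rule DERIV_continuous_on[OF v(2)])
  have wd: "wderiv (\<lambda>x. v x - s x) (\<lambda>x. v1 x - Dx s x)"
    by (intro wderiv_diff wderiv_C1[OF v(1) c1] fe_space0_basic(3)[OF z s(1)])
  have "h' ^ 2 * L2_norm v2 \<le> h' * L2_norm v2"
    using h' by (intro mult_right_mono) (auto simp: power2_eq_square mult_left_le)
  then have "H1_norm (\<lambda>x. v x - s x) \<le> 2 * (h' * L2_norm v2)"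
    using s(2,3) by (intro H1_norm_bound[OF wd]) (auto simp: f_def h'_def)
  then show ?thesis
    using that[OF s(1)] by (simp add: h'_def)
qed

lemma elliptic_projection_best:
  assumes z: "partition_01 N z" and v: "wderiv v v1" and w: "w \<in> fe_space0 r \<mu> N z"
    and orth: "\<And>\<phi>. \<phi> \<in> fe_space0 r \<mu> N z \<Longrightarrow> A_form (\<lambda>x. v x - w x) \<phi> = 0"
    and s: "s \<in> fe_space0 r \<mu> N z"
  shows "H1_norm (\<lambda>x. v x - w x) \<le> H1_norm (\<lambda>x. v x - s x)"
  unfolding H1_norm_def
  using v fe_space0_basic(3)[OF z w] fe_space0_basic(3)[OF z s] orth[OF fe_space0_diff[OF z w s]]
  by (intro A.best_approx) auto

text \<open>Aubin--Nitsche duality.\<close>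

lemma elliptic_projection_L2:
  assumes z: "partition_01 N z" and r: "2 \<le> r" "\<mu> \<le> r - 2" and h: "max_mesh N z \<le> 1"
    and v: "wderiv v v1" "v 0 = 0" "v 1 = 0" and w: "w \<in> fe_space0 r \<mu> N z"
    and orth: "\<And>\<phi>. \<phi> \<in> fe_space0 r \<mu> N z \<Longrightarrow> A_form (\<lambda>x. v x - w x) \<phi> = 0"
  shows "L2_norm (\<lambda>x. v x - w x) \<le> 2 * (max_mesh N z * H1_norm (\<lambda>x. v x - w x))"
proof -
  define e where "e x = v x - w x" for x
  note wb = fe_space0_basic[OF z w]
  have e: "wderiv e (\<lambda>x. v1 x - Dx w x)" "e 0 = 0" "e 1 = 0"
    using v wb unfolding e_def[abs_def] by (auto intro: wderiv_diff)
  then have "continuous_on {0..1} e" by (simp add: wderiv_def)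
  then obtain g g1 g2 where g:
    "\<And>x. x \<in> {0..1} \<Longrightarrow> (g has_real_derivative g1 x) (at x within {0..1})"
    "\<And>x. x \<in> {0..1} \<Longrightarrow> (g1 has_real_derivative g2 x) (at x within {0..1})"
    "continuous_on {0..1} g2" "g 0 = 0" "g 1 = 0" "\<And>x. g x - g2 x = e x" "L2_norm g2 \<le> L2_norm e"
    by (rule elliptic_problem) blast
  obtain s where s: "s \<in> fe_space0 r \<mu> N z" "H1_norm (\<lambda>x. g x - s x) \<le> 2 * (max_mesh N z * L2_norm g2)"
    by (rule fe_approx_elliptic[OF z r h g(1-5)])
  have g1c: "continuous_on {0..1} g1" by (rule DERIV_continuous_on[OF g(2)])
  have wg: "wderiv g g1" "wderiv g1 g2"
    using wderiv_C1[OF g(1) g1c] wderiv_C1[OF g(2,3)] by simp_all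
  note sb = fe_space0_basic[OF z s(1)]
  have "(L2_norm e)\<^sup>2 = A_form g e"
    unfolding L2_norm_sq using elliptic_weak_form[OF wg g(6) e] by simp
  also have "\<dots> = A_form (\<lambda>x. g x - s x) e"
  proof -
    have W: "g \<in> {v. \<exists>k. wderiv v k}" "s \<in> {v. \<exists>k. wderiv v k}" "e \<in> {v. \<exists>k. wderiv v k}"
      using wg(1) sb(3) e(1) by blast+
    show ?thesis
      using A.B_diff[OF W] A.B_sym[OF W(2,3)] orth[OF s(1)] by (simp add: e_def[abs_def])
  qed
  also have "\<dots> \<le> H1_norm (\<lambda>x. g x - s x) * H1_norm e"
    using H1_Cauchy_Schwarz[OF wderiv_diff[OF wg(1) sb(3)] e(1)] by linarith
  also have "\<dots> \<le> 2 * (max_mesh N z * L2_norm e) * H1_norm e"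
    using s(2) g(7) max_mesh_pos[OF z] e
    by (intro mult_right_mono order_trans[OF s(2)] mult_left_mono) auto
  finally have "L2_norm e * L2_norm e \<le> (2 * (max_mesh N z * H1_norm e)) * L2_norm e"
    by (simp add: power2_eq_square ac_simps)
  then have "L2_norm e \<le> 2 * (max_mesh N z * H1_norm e)"
    using max_mesh_pos[OF z] e
    by (cases "L2_norm e = 0") (auto simp: mult_le_cancel_right less_le)
  then show ?thesis by (simp add: e_def[abs_def])
qed

section \<open>The error at a fixed time\<close>

locale error_setting =
  fixes r \<mu> N :: nat and z :: "nat \<Rightarrow> real" and C M \<kappa> :: real
    and u u1 u2 m m1 mh uh pm ru :: "real \<Rightarrow> real"
  assumes z: "partition_01 N z" and r: "2 \<le> r" and \<mu>: "\<mu> \<le> r - 2"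
    and h1: "max_mesh N z \<le> 1" and \<kappa>: "max_mesh N z \<le> \<kappa> * min_mesh N z"
    and C0: "0 \<le> C"
    and inverse: "\<And>\<phi>. \<phi> \<in> fe_space0 r \<mu> N z \<Longrightarrow> L2_norm (Dx \<phi>) \<le> C / min_mesh N z * L2_norm \<phi>"
    and inverse_sup: "\<And>\<phi> g B x. \<phi> \<in> fe_space0 r \<mu> N z \<Longrightarrow> bmeas g \<Longrightarrow>
      (\<And>x. x \<in> {0..1} \<Longrightarrow> \<bar>g x\<bar> \<le> B) \<Longrightarrow> x \<in> {0..1} - z ` {1..N+1} \<Longrightarrow>
      \<bar>Dx \<phi> x\<bar> \<le> C * (L2_norm (\<lambda>x. Dx \<phi> x - g x) / sqrt (min_mesh N z) + B)"
    and du: "\<And>x. x \<in> {0..1} \<Longrightarrow> (u has_real_derivative u1 x) (at x within {0..1})"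
    and du1: "\<And>x. x \<in> {0..1} \<Longrightarrow> (u1 has_real_derivative u2 x) (at x within {0..1})"
    and cu2: "continuous_on {0..1} u2"
    and dm: "\<And>x. x \<in> {0..1} \<Longrightarrow> (m has_real_derivative m1 x) (at x within {0..1})"
    and cm1: "continuous_on {0..1} m1"
    and ub: "\<And>x. x \<in> {0..1} \<Longrightarrow> \<bar>u x\<bar> \<le> M" "\<And>x. x \<in> {0..1} \<Longrightarrow> \<bar>u1 x\<bar> \<le> M"
      "\<And>x. x \<in> {0..1} \<Longrightarrow> \<bar>u2 x\<bar> \<le> M"
    and mb: "\<And>x. x \<in> {0..1} \<Longrightarrow> \<bar>m x\<bar> \<le> M" "\<And>x. x \<in> {0..1} \<Longrightarrow> \<bar>m1 x\<bar> \<le> M"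
    and bc: "u 0 = 0" "u 1 = 0" "m 0 = 0" "m 1 = 0"
    and m_eq: "\<And>x. x \<in> {0..1} \<Longrightarrow> m x = u x - u2 x"
    and approx_u: "\<exists>s\<in>fe_space0 r \<mu> N z. L2_norm (\<lambda>x. u x - s x) \<le> M * max_mesh N z ^ r \<and>
      L2_norm (\<lambda>x. u1 x - Dx s x) \<le> M * max_mesh N z ^ (r - 1)"
    and approx_m: "\<exists>s\<in>fe_space0 r \<mu> N z. L2_norm (\<lambda>x. m x - s x) \<le> M * max_mesh N z ^ r \<and>
      L2_norm (\<lambda>x. m1 x - Dx s x) \<le> M * max_mesh N z ^ (r - 1)"
    and mh: "mh \<in> fe_space0 r \<mu> N z" and uh: "uh \<in> fe_space0 r \<mu> N z"
    and weak: "\<And>\<phi>. \<phi> \<in> fe_space0 r \<mu> N z \<Longrightarrow> L2_inner mh \<phi> = A_form uh \<phi>"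
    and pm: "pm \<in> fe_space0 r \<mu> N z"
    and pm_orth: "\<And>\<phi>. \<phi> \<in> fe_space0 r \<mu> N z \<Longrightarrow> L2_inner (\<lambda>x. m x - pm x) \<phi> = 0"
    and ru: "ru \<in> fe_space0 r \<mu> N z"
    and ru_orth: "\<And>\<phi>. \<phi> \<in> fe_space0 r \<mu> N z \<Longrightarrow> A_form (\<lambda>x. u x - ru x) \<phi> = 0"
begin

abbreviation "h \<equiv> max_mesh N z"
abbreviation "S \<equiv> fe_space0 r \<mu> N z"

definition "\<rho> x = m x - pm x"
definition "\<rho>1 x = m1 x - Dx pm x"
definition "\<theta> x = pm x - mh x"
definition "\<theta>1 x = Dx pm x - Dx mh x"
definition "\<sigma> x = u x - ru x"
definition "\<sigma>1 x = u1 x - Dx ru x"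
definition "\<xi> x = ru x - uh x"

definition "rhs \<psi> = - L2_inner (\<lambda>x. u x * m1 x - uh x * Dx mh x) \<psi>
  - 2 * L2_inner (\<lambda>x. u1 x * m x - Dx uh x * mh x) \<psi>"

lemma hpos: "0 < h" using z by (rule max_mesh_pos)

lemma M0: "0 \<le> M" using ub(1)[of 0] by simp

lemma wu: "wderiv u u1"
proof -
  have "continuous_on {0..1} u1" by (rule DERIV_continuous_on[OF du1])
  from wderiv_C1[OF du this] show ?thesis .
qed

lemma wu1: "wderiv u1 u2" by (rule wderiv_C1[OF du1 cu2])

lemma wm: "wderiv m m1" by (rule wderiv_C1[OF dm cm1])

lemmas basic = fe_space0_basic[OF z]

lemma w\<rho>: "wderiv \<rho> \<rho>1" unfolding \<rho>_def[abs_def] \<rho>1_def[abs_def] by (intro wderiv_diff wm basic(3)[OF pm])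
lemma w\<theta>: "wderiv \<theta> \<theta>1" unfolding \<theta>_def[abs_def] \<theta>1_def[abs_def] by (intro wderiv_diff basic(3)[OF pm] basic(3)[OF mh])
lemma w\<sigma>: "wderiv \<sigma> \<sigma>1" unfolding \<sigma>_def[abs_def] \<sigma>1_def[abs_def] by (intro wderiv_diff wu basic(3)[OF ru])

lemma \<theta>S: "\<theta> \<in> S" unfolding \<theta>_def[abs_def] by (rule fe_space0_diff[OF z pm mh])
lemma \<xi>S: "\<xi> \<in> S" unfolding \<xi>_def[abs_def] by (rule fe_space0_diff[OF z ru uh])

lemma w\<xi>': "wderiv \<xi> (Dx \<xi>)" by (rule basic(3)[OF \<xi>S])

lemma zeros: "\<theta> 0 = 0" "\<theta> 1 = 0" "\<xi> 0 = 0" "\<xi> 1 = 0" "\<sigma> 0 = 0" "\<sigma> 1 = 0" "\<rho> 0 = 0" "\<rho> 1 = 0"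
    "uh 0 = 0" "uh 1 = 0"
  using basic(1,2)[OF \<theta>S] basic(1,2)[OF \<xi>S] basic(1,2)[OF ru] basic(1,2)[OF pm] basic(1,2)[OF uh] bc
  by (simp_all add: \<sigma>_def \<rho>_def)

lemma h_power: "h ^ r = h * h ^ (r - 1)"
  using r by (cases r) auto

lemma h_power_le: "h ^ r \<le> h ^ (r - 1)" "h ^ (r - 1) \<le> h" "h ^ (r - 1) * h ^ (r - 1) \<le> h ^ r"
    "h ^ r * h ^ r \<le> h * (h ^ (r - 1) * h ^ (r - 1))"
proof -
  have "h ^ n \<le> 1" for n
    using h1 hpos by (intro power_le_one) auto
  obtain k where k: "r = Suc (Suc k)"
    using r by (metis add_2_eq_Suc le_Suc_ex)
  have "h * h ^ (r - 1) \<le> 1 * h ^ (r - 1)"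
    using h1 hpos by (intro mult_right_mono) auto
  then show a: "h ^ r \<le> h ^ (r - 1)"
    by (simp add: h_power)
  have "h * h ^ k \<le> h * 1"
    using \<open>h ^ k \<le> 1\<close> hpos by (intro mult_left_mono) auto
  then show b: "h ^ (r - 1) \<le> h"
    by (simp add: k)
  have "h ^ (r - 1) * h ^ (r - 1) \<le> h * h ^ (r - 1)"
    using b hpos by (intro mult_right_mono) auto
  then show "h ^ (r - 1) * h ^ (r - 1) \<le> h ^ r"
    by (simp add: h_power)
  have "h ^ r * h ^ r \<le> (h * h ^ (r - 1)) * h ^ (r - 1)"
    using a hpos by (intro mult_mono) (auto simp: h_power)
  then show "h ^ r * h ^ r \<le> h * (h ^ (r - 1) * h ^ (r - 1))"
    by (simp add: ac_simps)
qed

lemma \<sigma>_H1: "H1_norm \<sigma> \<le> 2 * (M * h ^ (r - 1))"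
proof -
  obtain s where s: "s \<in> S" "L2_norm (\<lambda>x. u x - s x) \<le> M * h ^ r" "L2_norm (\<lambda>x. u1 x - Dx s x) \<le> M * h ^ (r - 1)"
    using approx_u by blast
  have "H1_norm \<sigma> \<le> H1_norm (\<lambda>x. u x - s x)"
    unfolding \<sigma>_def[abs_def] by (rule elliptic_projection_best[OF z wu ru ru_orth s(1)])
  also have "\<dots> \<le> 2 * (M * h ^ (r - 1))"
  proof (rule H1_norm_bound[OF wderiv_diff[OF wu basic(3)[OF s(1)]] _ s(3)])
    have "M * h ^ r \<le> M * h ^ (r - 1)"
      using h_power_le(1) M0 by (intro mult_left_mono)
    with s(2) show "L2_norm (\<lambda>x. u x - s x) \<le> M * h ^ (r - 1)" by linarith
  qed
  finally show ?thesis .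
qed

lemma \<sigma>_L2: "L2_norm \<sigma> \<le> 4 * (M * h ^ r)"
proof -
  have "L2_norm \<sigma> \<le> 2 * (h * H1_norm \<sigma>)"
    unfolding \<sigma>_def[abs_def] by (rule elliptic_projection_L2[OF z r \<mu> h1 wu bc(1,2) ru ru_orth])
  also have "\<dots> \<le> 2 * (h * (2 * (M * h ^ (r - 1))))"
    using \<sigma>_H1 hpos by (intro mult_left_mono) auto
  finally show ?thesis by (simp add: h_power ac_simps)
qed

lemma L2_best:
  assumes "s \<in> S"
  shows "L2_norm \<rho> \<le> L2_norm (\<lambda>x. m x - s x)"
  unfolding \<rho>_def[abs_def] L2_norm_def
  using wderiv_bmeas[OF wm] wderiv_bmeas[OF basic(3)[OF pm]] wderiv_bmeas[OF basic(3)[OF assms]]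
    pm_orth[OF fe_space0_diff[OF z pm assms]]
  by (intro L2.best_approx) auto

lemma \<rho>_L2: "L2_norm \<rho> \<le> M * h ^ r"
  using approx_m L2_best by force

lemma \<rho>1_L2: "L2_norm \<rho>1 \<le> (M + 2 * (C * \<kappa> * M)) * h ^ (r - 1)"
proof -
  obtain s where s: "s \<in> S" "L2_norm (\<lambda>x. m x - s x) \<le> M * h ^ r" "L2_norm (\<lambda>x. m1 x - Dx s x) \<le> M * h ^ (r - 1)"
    using approx_m by blast
  define q where "q x = s x - pm x" for x
  have qS: "q \<in> S" unfolding q_def[abs_def] by (rule fe_space0_diff[OF z s(1) pm])
  have ws: "wderiv s (Dx s)" and wp: "wderiv pm (Dx pm)" using basic(3) s(1) pm by auto
  have bm: "bmeas m" "bmeas m1" "bmeas s" "bmeas (Dx s)" "bmeas pm" "bmeas (Dx pm)" "bmeas \<rho>"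
    using wderiv_bmeas[OF wm] wderiv_bmeas[OF ws] wderiv_bmeas[OF wp] wderiv_bmeas[OF w\<rho>] by auto
  have "wderiv q (\<lambda>x. Dx s x - Dx pm x)"
    unfolding q_def[abs_def] by (rule wderiv_diff[OF ws wp])
  then obtain F where F: "finite F" "\<forall>x\<in>{0..1} - F. Dx q x = Dx s x - Dx pm x"
    by (rule wderiv_Dx_eq) blast
  have "L2_norm \<rho>1 = L2_norm (\<lambda>x. (m1 x - Dx s x) + (Dx s x - Dx pm x))"
    by (intro L2_norm_cong) (simp add: \<rho>1_def)
  also have "\<dots> \<le> L2_norm (\<lambda>x. m1 x - Dx s x) + L2_norm (\<lambda>x. Dx s x - Dx pm x)"
    using bm by (intro L2_norm_triangle) auto
  also have "L2_norm (\<lambda>x. Dx s x - Dx pm x) = L2_norm (Dx q)"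
    by (rule L2_norm_cong_finite[OF F(1)]) (use F(2) in auto)
  also have "\<dots> \<le> C / min_mesh N z * L2_norm q" by (rule inverse[OF qS])
  also have "\<dots> \<le> C * \<kappa> / h * (2 * (M * h ^ r))"
  proof (rule mult_mono)
    have "1 / min_mesh N z \<le> \<kappa> / h"
      using \<kappa> hpos min_mesh_pos[OF z] by (simp add: field_simps)
    then show "C / min_mesh N z \<le> C * \<kappa> / h"
      using mult_left_mono[OF _ C0, of "1 / min_mesh N z" "\<kappa> / h"] by simp
    then show "0 \<le> C * \<kappa> / h"
      using C0 min_mesh_pos[OF z] by (meson divide_nonneg_pos order_trans)
    have "L2_norm q = L2_norm (\<lambda>x. \<rho> x - (m x - s x))"
      by (intro L2_norm_cong) (simp add: q_def \<rho>_def)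
    also have "\<dots> \<le> L2_norm \<rho> + L2_norm (\<lambda>x. m x - s x)"
      using bm by (intro L2_norm_triangle_diff) auto
    finally show "L2_norm q \<le> 2 * (M * h ^ r)"
      using \<rho>_L2 s(2) by linarith
  qed simp
  also have "\<dots> = 2 * (C * \<kappa> * M) * h ^ (r - 1)"
    using hpos by (simp add: h_power)
  finally show ?thesis
    using s(3) by (simp add: algebra_simps)
qed

lemma \<xi>_weak:
  assumes "\<phi> \<in> S"
  shows "A_form \<xi> \<phi> = L2_inner \<theta> \<phi>"
proof -
  have W: "u \<in> {v. \<exists>k. wderiv v k}" "ru \<in> {v. \<exists>k. wderiv v k}" "uh \<in> {v. \<exists>k. wderiv v k}" "\<phi> \<in> {v. \<exists>k. wderiv v k}"
    using wu basic(3)[OF ru] basic(3)[OF uh] basic(3)[OF assms] by blast+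
  have bm: "bmeas m" "bmeas pm" "bmeas mh" "bmeas \<phi>"
    using wderiv_bmeas(1)[OF wm] wderiv_bmeas(1)[OF basic(3)[OF pm]] wderiv_bmeas(1)[OF basic(3)[OF mh]]
      wderiv_bmeas(1)[OF basic(3)[OF assms]] by auto
  have wv: "A_form u \<phi> = L2_inner m \<phi>"
  proof -
    have "A_form u \<phi> = int01 (\<lambda>x. (u x - u2 x) * \<phi> x)"
      by (rule elliptic_weak_form[OF wu wu1 refl basic(3)[OF assms] basic(1,2)[OF assms]])
    also have "\<dots> = L2_inner m \<phi>"
      unfolding L2_inner_int01 by (intro int01_cong) (simp add: m_eq)
    finally show ?thesis .
  qed
  have "A_form \<xi> \<phi> = A_form ru \<phi> - A_form uh \<phi>"
    unfolding \<xi>_def[abs_def] by (rule A.B_diff[OF W(2,3,4)])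
  also have "A_form ru \<phi> = A_form u \<phi>"
    using A.B_diff[OF W(1,2,4)] ru_orth[OF assms] by simp
  also have "A_form uh \<phi> = L2_inner mh \<phi>" using weak[OF assms] by simp
  also have "A_form u \<phi> - L2_inner mh \<phi> = L2_inner pm \<phi> - L2_inner mh \<phi>"
    using L2.B_diff[of m pm \<phi>] pm_orth[OF assms] bm wv by simp
  also have "\<dots> = L2_inner \<theta> \<phi>"
    unfolding \<theta>_def[abs_def] using bm by (simp add: L2.B_diff)
  finally show ?thesis .
qed

lemma \<xi>_le_\<theta>: "H1_norm \<xi> \<le> L2_norm \<theta>"
proof -
  have b: "bmeas \<theta>" "bmeas \<xi>" using wderiv_bmeas(1)[OF w\<theta>] wderiv_bmeas(1)[OF w\<xi>'] by auto
  have "(H1_norm \<xi>)\<^sup>2 = A_form \<xi> \<xi>"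
    using A_form_H1_norm[OF w\<xi>'] by simp
  also have "\<dots> = L2_inner \<theta> \<xi>" by (rule \<xi>_weak[OF \<xi>S])
  also have "\<dots> \<le> L2_norm \<theta> * L2_norm \<xi>"
    using int01_Cauchy_Schwarz[OF b] by (simp add: L2_inner_int01)
  also have "\<dots> \<le> L2_norm \<theta> * H1_norm \<xi>"
    using L2_norm_le_H1_norm(1)[OF w\<xi>'] by (intro mult_left_mono) auto
  finally have "H1_norm \<xi> * H1_norm \<xi> \<le> L2_norm \<theta> * H1_norm \<xi>"
    by (simp add: power2_eq_square)
  then show ?thesis
    using H1_norm_nonneg[OF w\<xi>'] by (cases "H1_norm \<xi> = 0") (auto simp: mult_le_cancel_right less_le)
qed

definition "K = C * ((2 * M + 1) * sqrt \<kappa> + M)"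

lemma uh_derivative_bound:
  assumes small: "(L2_norm \<theta>)\<^sup>2 \<le> h"
  obtains d where "wderiv uh d" "\<And>x. x \<in> {0..1} \<Longrightarrow> \<bar>d x\<bar> \<le> K" "\<And>x. x \<in> {0..1} \<Longrightarrow> \<bar>uh x\<bar> \<le> K"
proof -
  define k where "k = min_mesh N z"
  have k: "0 < k" using min_mesh_pos[OF z] by (simp add: k_def)
  have \<kappa>0: "0 < \<kappa>"
    using \<kappa> hpos k by (metis k_def less_le_trans zero_less_mult_pos2)
  define b where "b x = Dx uh x - u1 x" for x
  have wuh: "wderiv uh (Dx uh)" by (rule basic(3)[OF uh])
  have we: "wderiv (\<lambda>x. uh x - u x) b"
    unfolding b_def[abs_def] by (rule wderiv_diff[OF wuh wu])
  have "L2_norm b \<le> H1_norm (\<lambda>x. uh x - u x)" by (rule L2_norm_le_H1_norm(2)[OF we])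
  also have "\<dots> = H1_norm (\<lambda>x. (-1) * \<sigma> x + (-1) * \<xi> x)"
    by (rule arg_cong[of _ _ H1_norm]) (simp add: \<sigma>_def \<xi>_def fun_eq_iff)
  also have "\<dots> \<le> H1_norm \<sigma> + H1_norm \<xi>"
  proof -
    have W: "\<sigma> \<in> {v. \<exists>k. wderiv v k}" "\<xi> \<in> {v. \<exists>k. wderiv v k}"
      using w\<sigma> w\<xi>' by blast+
    have "H1_norm (\<lambda>x. (-1) * v x) = H1_norm v" if "v \<in> {v. \<exists>k. wderiv v k}" for v
      unfolding H1_norm_def using A.B_cmult[OF that A.cmult_mem[OF that, of "-1"], of "-1"]
        A.B_cmult_right[OF that that, of "-1"] by simp
    with W show ?thesis
      using A.norm_triangle[OF A.cmult_mem[OF W(1), of "-1"] A.cmult_mem[OF W(2), of "-1"]]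
      by (simp add: H1_norm_def)
  qed
  also have "\<dots> \<le> 2 * (M * h ^ (r - 1)) + L2_norm \<theta>"
    by (intro add_mono \<sigma>_H1 \<xi>_le_\<theta>)
  also have "\<dots> \<le> (2 * M + 1) * sqrt h"
  proof -
    have "L2_norm \<theta> \<le> sqrt h"
      using small real_le_rsqrt by blast
    moreover have "h \<le> sqrt h"
      using h1 hpos by (intro real_le_rsqrt) (auto simp: power2_eq_square mult_left_le)
    then have "M * h ^ (r - 1) \<le> M * sqrt h"
      using h_power_le(2) M0 by (intro mult_left_mono) auto
    ultimately show ?thesis by (simp add: algebra_simps)
  qed
  finally have b: "L2_norm b \<le> (2 * M + 1) * sqrt h" .
  have "sqrt h \<le> sqrt \<kappa> * sqrt k"
    using \<kappa> by (simp add: k_def real_sqrt_mult[symmetric])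
  then have "(2 * M + 1) * sqrt h \<le> (2 * M + 1) * (sqrt \<kappa> * sqrt k)"
    using M0 by (intro mult_left_mono) auto
  with b have "L2_norm b / sqrt k \<le> (2 * M + 1) * sqrt \<kappa>"
    using k by (simp add: pos_divide_le_eq mult.assoc)
  then have "C * (L2_norm b / sqrt k + M) \<le> K"
    unfolding K_def using C0 by (intro mult_left_mono) auto
  then have Dx_uh: "\<bar>Dx uh x\<bar> \<le> K" if "x \<in> {0..1} - z ` {1..N+1}" for x
    using inverse_sup[OF uh wderiv_bmeas(1)[OF wu1] ub(2) that] by (simp add: b_def[abs_def] k_def)
  have K0: "0 \<le> K"
    unfolding K_def using C0 M0 \<kappa>0 by (intro mult_nonneg_nonneg add_nonneg_nonneg) auto
  define d where "d x = (if x \<in> z ` {1..N+1} then 0 else Dx uh x)" for x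
  have d: "wderiv uh d"
    by (rule wderiv_cong_finite[OF wuh, of "z ` {1..N+1}"]) (auto simp: d_def)
  have dK: "\<bar>d x\<bar> \<le> K" if "x \<in> {0..1}" for x
    using Dx_uh[of x] K0 that by (auto simp: d_def)
  have "\<bar>uh x\<bar> \<le> K" if "x \<in> {0..1}" for x
    using wderiv_sup_bound[OF d zeros(9) that] L2_norm_le_bound[OF wderiv_bmeas(2)[OF d] dK] by linarith
  with d dK show ?thesis by (rule that)
qed

end

abbreviation trip :: "(real \<Rightarrow> real) \<Rightarrow> (real \<Rightarrow> real) \<Rightarrow> (real \<Rightarrow> real) \<Rightarrow> real" where
  "trip a f g \<equiv> int01 (\<lambda>x. a x * (f x * g x))"

locale error_bounded = error_setting +
  fixes d :: "real \<Rightarrow> real" and B :: real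
  assumes wuh: "wderiv uh d" and dB: "\<And>x. x \<in> {0..1} \<Longrightarrow> \<bar>d x\<bar> \<le> B"
    and uhB: "\<And>x. x \<in> {0..1} \<Longrightarrow> \<bar>uh x\<bar> \<le> B"
begin

definition "\<epsilon> x = u x - uh x"
definition "\<epsilon>1 x = u1 x - d x"
definition "\<xi>1 x = Dx ru x - d x"

lemma w\<epsilon>: "wderiv \<epsilon> \<epsilon>1" unfolding \<epsilon>_def[abs_def] \<epsilon>1_def[abs_def] by (intro wderiv_diff wu wuh)
lemma w\<xi>: "wderiv \<xi> \<xi>1" unfolding \<xi>_def[abs_def] \<xi>1_def[abs_def] by (intro wderiv_diff basic(3)[OF ru] wuh)

lemmas bms [simp] = wderiv_bmeas[OF wu] wderiv_bmeas(2)[OF wu1] wderiv_bmeas[OF wm] wderiv_bmeas[OF w\<rho>]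
  wderiv_bmeas[OF w\<theta>] wderiv_bmeas[OF w\<sigma>] wderiv_bmeas[OF w\<xi>] wderiv_bmeas[OF w\<epsilon>] wderiv_bmeas[OF wuh]
  wderiv_bmeas[OF basic(3)[OF pm]] wderiv_bmeas[OF basic(3)[OF mh]]

lemma B0: "0 \<le> B" using dB[of 0] by simp

lemma \<kappa>0: "0 \<le> \<kappa>"
proof -
  have "0 < \<kappa> * min_mesh N z"
    using \<kappa> hpos by linarith
  then show ?thesis
    using min_mesh_pos[OF z] by (simp add: zero_less_mult_iff)
qed

lemma \<epsilon>_split: "\<epsilon> x = \<sigma> x + \<xi> x" "\<epsilon>1 x = \<sigma>1 x + \<xi>1 x"
  by (simp_all add: \<epsilon>_def \<epsilon>1_def \<sigma>_def \<sigma>1_def \<xi>_def \<xi>1_def)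

lemma rhs_eq:
  assumes [simp]: "bmeas \<psi>"
  shows "rhs \<psi> = - (trip m1 \<epsilon> \<psi> + trip uh \<rho>1 \<psi> + trip uh \<theta>1 \<psi>)
    - 2 * (trip m \<epsilon>1 \<psi> + trip d \<rho> \<psi> + trip d \<theta> \<psi>)"
proof -
  have "L2_inner (\<lambda>x. u x * m1 x - uh x * Dx mh x) \<psi> =
      int01 (\<lambda>x. m1 x * (\<epsilon> x * \<psi> x) + uh x * (\<rho>1 x * \<psi> x) + uh x * (\<theta>1 x * \<psi> x))"
    unfolding L2_inner_int01 by (intro int01_cong) (simp add: \<epsilon>_def \<rho>1_def \<theta>1_def algebra_simps)
  moreover obtain F where F: "finite F" "\<forall>x\<in>{0..1} - F. Dx uh x = d x"
    by (rule wderiv_Dx_eq[OF wuh]) blast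
  have "L2_inner (\<lambda>x. u1 x * m x - Dx uh x * mh x) \<psi> =
      int01 (\<lambda>x. m x * (\<epsilon>1 x * \<psi> x) + d x * (\<rho> x * \<psi> x) + d x * (\<theta> x * \<psi> x))"
    unfolding L2_inner_int01
    by (rule int01_cong_finite[OF F(1)]) (use F(2) in \<open>simp add: \<epsilon>1_def \<rho>_def \<theta>_def algebra_simps\<close>)
  ultimately show ?thesis
    unfolding rhs_def by (simp add: int01_add)
qed

lemma \<epsilon>_norms: "L2_norm \<epsilon> \<le> 2 * (M * h ^ (r - 1)) + H1_norm \<xi>" "L2_norm \<epsilon>1 \<le> 2 * (M * h ^ (r - 1)) + H1_norm \<xi>"
  "\<And>x. x \<in> {0..1} \<Longrightarrow> \<bar>\<epsilon> x\<bar> \<le> 2 * (M * h ^ (r - 1)) + H1_norm \<xi>"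
  "L2_norm \<epsilon> \<le> 4 * (M * h ^ r) + H1_norm \<xi>"
proof -
  have "L2_norm \<epsilon> \<le> L2_norm \<sigma> + L2_norm \<xi>" "L2_norm \<epsilon>1 \<le> L2_norm \<sigma>1 + L2_norm \<xi>1"
    unfolding \<epsilon>_split[abs_def] by (intro L2_norm_triangle; simp)+
  then show "L2_norm \<epsilon> \<le> 2 * (M * h ^ (r - 1)) + H1_norm \<xi>" "L2_norm \<epsilon>1 \<le> 2 * (M * h ^ (r - 1)) + H1_norm \<xi>"
    "L2_norm \<epsilon> \<le> 4 * (M * h ^ r) + H1_norm \<xi>"
    using L2_norm_le_H1_norm[OF w\<sigma>] L2_norm_le_H1_norm[OF w\<xi>] \<sigma>_H1 \<sigma>_L2 by linarith+
  show "\<bar>\<epsilon> x\<bar> \<le> 2 * (M * h ^ (r - 1)) + H1_norm \<xi>" if "x \<in> {0..1}" for x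
    using sup_le_H1_norm[OF w\<sigma> zeros(5) that] sup_le_H1_norm[OF w\<xi> zeros(3) that] \<sigma>_H1
    unfolding \<epsilon>_split by linarith
qed

definition "A1 = 6 * (M * M) + 3 * M + B * (3 * M + 2 * (C * \<kappa> * M)) + 5 / 2 * B"

lemma theta_energy: "rhs \<theta> \<le> A1 * ((L2_norm \<theta>)\<^sup>2 + (h ^ (r - 1))\<^sup>2)"
proof -
  define T p where "T = L2_norm \<theta>" and "p = h ^ (r - 1)"
  have nn: "0 \<le> T" "0 \<le> p" using hpos by (auto simp: T_def p_def)
  define w where "w = T * T + p * p"
  have "0 \<le> (T - p) * (T - p)" by simp
  then have "2 * (p * T) \<le> w" unfolding w_def by (simp add: algebra_simps)
  then have pT: "p * T \<le> w" using nn by (smt (verit) mult_nonneg_nonneg)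
  have TT: "T * T \<le> w" using nn by (simp add: w_def)
  have e: "H1_norm \<xi> \<le> T" using \<xi>_le_\<theta> by (simp add: T_def)
  have ep: "L2_norm \<epsilon> \<le> 2 * (M * p) + T" "L2_norm \<epsilon>1 \<le> 2 * (M * p) + T"
    using \<epsilon>_norms(1,2) e by (auto simp: p_def)
  have E: "(2 * (M * p) + T) * T \<le> (2 * M + 1) * w"
  proof -
    have "(2 * M) * (p * T) \<le> (2 * M) * w" using pT M0 by (intro mult_left_mono) auto
    with TT show ?thesis by (simp add: algebra_simps)
  qed
  have t1: "\<bar>trip m1 \<epsilon> \<theta>\<bar> \<le> M * ((2 * M + 1) * w)"
    using mult_left_mono[OF order_trans[OF mult_right_mono[OF ep(1) nn(1)] E] M0]
    by (intro order_trans[OF int01_triple_bound[OF _ _ _ mb(2)]]) (simp_all add: T_def)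
  have t4: "\<bar>trip m \<epsilon>1 \<theta>\<bar> \<le> M * ((2 * M + 1) * w)"
    using mult_left_mono[OF order_trans[OF mult_right_mono[OF ep(2) nn(1)] E] M0]
    by (intro order_trans[OF int01_triple_bound[OF _ _ _ mb(1)]]) (simp_all add: T_def)
  have t2: "\<bar>trip uh \<rho>1 \<theta>\<bar> \<le> B * ((M + 2 * (C * \<kappa> * M)) * w)"
  proof -
    have "L2_norm \<rho>1 * T \<le> (M + 2 * (C * \<kappa> * M)) * p * T"
      using \<rho>1_L2 nn by (intro mult_right_mono) (auto simp: p_def)
    also have "\<dots> \<le> (M + 2 * (C * \<kappa> * M)) * w"
      unfolding mult.assoc[of _ p] using pT M0 C0 \<kappa>0 by (intro mult_left_mono) auto
    finally show ?thesis
      using mult_left_mono[OF _ B0]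
      by (intro order_trans[OF int01_triple_bound[OF _ _ _ uhB]]) (simp_all add: T_def)
  qed
  have t5: "\<bar>trip d \<rho> \<theta>\<bar> \<le> B * (M * w)"
  proof -
    have "M * h ^ r \<le> M * p" using h_power_le(1) M0 by (intro mult_left_mono) (auto simp: p_def)
    then have "L2_norm \<rho> * T \<le> M * p * T"
      using \<rho>_L2 nn by (intro mult_right_mono) auto
    also have "\<dots> \<le> M * w"
      unfolding mult.assoc[of _ p] using pT M0 by (intro mult_left_mono) auto
    finally show ?thesis
      using mult_left_mono[OF _ B0]
      by (intro order_trans[OF int01_triple_bound[OF _ _ _ dB]]) (simp_all add: T_def)
  qed
  have t6: "\<bar>trip d \<theta> \<theta>\<bar> \<le> B * w"
    using mult_left_mono[OF TT B0]
    by (intro order_trans[OF int01_triple_bound[OF _ _ _ dB]]) (simp_all add: T_def)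
  have "trip d \<theta> \<theta> = - int01 (\<lambda>x. uh x * (\<theta>1 x * \<theta> x + \<theta> x * \<theta>1 x))"
    by (rule int01_by_parts[OF wuh wderiv_mult[OF w\<theta> w\<theta>]]) (simp_all add: zeros)
  also have "int01 (\<lambda>x. uh x * (\<theta>1 x * \<theta> x + \<theta> x * \<theta>1 x)) = int01 (\<lambda>x. 2 * (uh x * (\<theta>1 x * \<theta> x)))"
    by (intro int01_cong) (simp add: algebra_simps)
  finally have t3: "trip uh \<theta>1 \<theta> = - trip d \<theta> \<theta> / 2"
    by (simp add: int01_cmult)
  have collect: "- (a + b + - f / 2) - 2 * (c + e + f) \<le> 3 * t + v + 2 * s + 5 / 2 * k"
    if "\<bar>a\<bar> \<le> t" "\<bar>b\<bar> \<le> v" "\<bar>c\<bar> \<le> t" "\<bar>e\<bar> \<le> s" "\<bar>f\<bar> \<le> k" for a b c e f t v s k :: real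
    using that unfolding abs_le_iff by simp
  have "rhs \<theta> \<le> 3 * (M * ((2 * M + 1) * w)) + B * ((M + 2 * (C * \<kappa> * M)) * w) + 2 * (B * (M * w)) + 5 / 2 * (B * w)"
    unfolding rhs_eq[OF wderiv_bmeas(1)[OF w\<theta>]] t3 by (rule collect[OF t1 t2 t4 t5 t6])
  also have "\<dots> = A1 * w"
    by (simp add: A1_def algebra_simps)
  finally show ?thesis
    by (simp add: w_def T_def p_def power2_eq_square)
qed

text \<open>Comparing \<open>\<xi>\<close> with the exact solution of \<open>v - v'' = \<theta>\<close> is what makes the terms
  containing \<open>\<theta>\<close> small: for \<open>v\<close> they can be integrated by parts without loss.\<close>

lemma theta_terms:
  "\<bar>trip u1 \<theta> \<xi>\<bar> \<le> 3 * M * ((H1_norm \<xi> + 2 * (h * L2_norm \<theta>)) * H1_norm \<xi>)"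
  "\<bar>trip u \<theta> \<xi>1\<bar> \<le>
    M * ((H1_norm \<xi> + 2 * (h * L2_norm \<theta>)) * (H1_norm \<xi> + 2 * (h * L2_norm \<theta>))) + M * (L2_norm \<theta> * (2 * (h * L2_norm \<theta>)))"
proof -
  obtain v v1 v2 where v:
    "\<And>x. x \<in> {0..1} \<Longrightarrow> (v has_real_derivative v1 x) (at x within {0..1})"
    "\<And>x. x \<in> {0..1} \<Longrightarrow> (v1 has_real_derivative v2 x) (at x within {0..1})"
    "continuous_on {0..1} v2" "v 0 = 0" "v 1 = 0" "\<And>x. v x - v2 x = \<theta> x" "L2_norm v2 \<le> L2_norm \<theta>"
    by (rule elliptic_problem[OF basic(4)[OF \<theta>S]]) blast
  have cv1: "continuous_on {0..1} v1" by (rule DERIV_continuous_on[OF v(2)])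
  have wv: "wderiv v v1" and wv1: "wderiv v1 v2"
    using wderiv_C1[OF v(1) cv1] wderiv_C1[OF v(2,3)] by simp_all
  note [simp] = wderiv_bmeas[OF wv] wderiv_bmeas(2)[OF wv1]
  obtain s where s: "s \<in> S" "H1_norm (\<lambda>x. v x - s x) \<le> 2 * (h * L2_norm v2)"
    by (rule fe_approx_elliptic[OF z r \<mu> h1 v(1-5)])
  define X where "X = H1_norm v"
  define y where "y = H1_norm \<xi>"
  define E where "E = 2 * (h * L2_norm \<theta>)"
  have orth: "A_form (\<lambda>x. v x - \<xi> x) \<phi> = 0" if \<phi>: "\<phi> \<in> S" for \<phi>
  proof -
    have W: "v \<in> {v. \<exists>k. wderiv v k}" "\<xi> \<in> {v. \<exists>k. wderiv v k}" "\<phi> \<in> {v. \<exists>k. wderiv v k}"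
      using wv w\<xi> basic(3)[OF \<phi>] by blast+
    have "A_form v \<phi> = L2_inner \<theta> \<phi>"
      unfolding L2_inner_int01 by (rule elliptic_weak_form[OF wv wv1 v(6) basic(3)[OF \<phi>] basic(1,2)[OF \<phi>]])
    then show ?thesis
      using A.B_diff[OF W] \<xi>_weak[OF \<phi>] by simp
  qed
  define e e1 where "e x = v x - \<xi> x" and "e1 x = v1 x - \<xi>1 x" for x
  have we: "wderiv e e1" unfolding e_def[abs_def] e1_def[abs_def] by (rule wderiv_diff[OF wv w\<xi>])
  note [simp] = wderiv_bmeas[OF we]
  have "H1_norm e \<le> H1_norm (\<lambda>x. v x - s x)"
    unfolding e_def[abs_def] by (rule elliptic_projection_best[OF z wv \<xi>S orth s(1)])
  also have "\<dots> \<le> E"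
    unfolding E_def using mult_left_mono[OF v(7), of h] s(2) hpos by linarith
  finally have eE: "H1_norm e \<le> E" .
  have Xy: "X \<le> y + E"
  proof -
    have W: "\<xi> \<in> {v. \<exists>k. wderiv v k}" "e \<in> {v. \<exists>k. wderiv v k}"
      using we w\<xi> by blast+
    have "v = (\<lambda>x. \<xi> x + e x)" by (simp add: e_def)
    then have "X \<le> y + H1_norm e"
      using A.norm_triangle[OF W] by (simp add: X_def y_def H1_norm_def)
    with eE show ?thesis by simp
  qed
  have nn: "0 \<le> X" "0 \<le> y" "0 \<le> E" using wv w\<xi> hpos by (auto simp: X_def y_def E_def)
  have Xn: "L2_norm v \<le> X" "L2_norm v1 \<le> X" and yn: "L2_norm \<xi> \<le> y" "L2_norm \<xi>1 \<le> y"
    using L2_norm_le_H1_norm[OF wv] L2_norm_le_H1_norm[OF w\<xi>] by (auto simp: X_def y_def)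
  have Xy_prod: "M * (L2_norm f * L2_norm g) \<le> M * (X * y)" if "L2_norm f \<le> X" "L2_norm g \<le> y" for f g
    using that M0 nn by (intro mult_left_mono mult_mono) auto
  have wu1\<xi>: "wderiv (\<lambda>x. u1 x * \<xi> x) (\<lambda>x. u2 x * \<xi> x + u1 x * \<xi>1 x)"
    by (rule wderiv_mult[OF wu1 w\<xi>])
  have "trip u1 \<theta> \<xi> = trip \<theta> u1 \<xi>"
    by (simp add: ac_simps)
  also have "\<dots> = A_form v (\<lambda>x. u1 x * \<xi> x)"
    by (rule elliptic_weak_form[OF wv wv1 v(6) wu1\<xi>, symmetric]) (simp_all add: zeros)
  also have "\<dots> = trip v u1 \<xi> + int01 (\<lambda>x. v1 x * (u2 x * \<xi> x + u1 x * \<xi>1 x))"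
    by (rule A_form_int01[OF wv wu1\<xi>])
  also have "int01 (\<lambda>x. v1 x * (u2 x * \<xi> x + u1 x * \<xi>1 x)) =
      int01 (\<lambda>x. u2 x * (v1 x * \<xi> x) + u1 x * (v1 x * \<xi>1 x))"
    by (intro int01_cong) (simp add: algebra_simps)
  also have "\<dots> = trip u2 v1 \<xi> + trip u1 v1 \<xi>1"
    by (intro int01_add) simp_all
  also have "trip v u1 \<xi> = trip u1 v \<xi>"
    by (simp add: ac_simps)
  finally have split: "trip u1 \<theta> \<xi> = trip u1 v \<xi> +
      (trip u2 v1 \<xi> + trip u1 v1 \<xi>1)" .
  have "\<bar>trip u1 v \<xi>\<bar> \<le> M * (X * y)"
    by (rule order_trans[OF int01_triple_bound[OF _ _ _ ub(2)] Xy_prod]) (use Xn yn in simp_all)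
  moreover have "\<bar>trip u2 v1 \<xi>\<bar> \<le> M * (X * y)"
    by (rule order_trans[OF int01_triple_bound[OF _ _ _ ub(3)] Xy_prod]) (use Xn yn in simp_all)
  moreover have "\<bar>trip u1 v1 \<xi>1\<bar> \<le> M * (X * y)"
    by (rule order_trans[OF int01_triple_bound[OF _ _ _ ub(2)] Xy_prod]) (use Xn yn in simp_all)
  ultimately have "\<bar>trip u1 \<theta> \<xi>\<bar> \<le> 3 * M * (X * y)"
    unfolding split by linarith
  also have "\<dots> \<le> 3 * M * ((y + E) * y)"
    using Xy nn M0 by (intro mult_left_mono mult_right_mono) auto
  finally show "\<bar>trip u1 \<theta> \<xi>\<bar> \<le> 3 * M * ((H1_norm \<xi> + 2 * (h * L2_norm \<theta>)) * H1_norm \<xi>)"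
    by (simp add: y_def E_def)
  have "trip u \<theta> \<xi>1 =
      int01 (\<lambda>x. u x * (v x * v1 x) - u x * (v2 x * v1 x) - u x * (\<theta> x * e1 x))"
    by (intro int01_cong) (simp add: v(6)[symmetric] e1_def algebra_simps)
  also have "\<dots> = trip u v v1 - trip u v2 v1 - trip u \<theta> e1"
    by (simp add: int01_diff)
  finally have split2: "trip u \<theta> \<xi>1 =
      trip u v v1 - trip u v2 v1 - trip u \<theta> e1" .
  have sq: "trip u g f = - trip u1 f f / 2" if f: "wderiv f g" for f g
  proof -
    have [simp]: "bmeas f" "bmeas g" using wderiv_bmeas[OF f] by auto
    have "trip u1 f f = - int01 (\<lambda>x. u x * (g x * f x + f x * g x))"
      by (rule int01_by_parts[OF wu wderiv_mult[OF f f]]) (simp_all add: bc)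
    also have "int01 (\<lambda>x. u x * (g x * f x + f x * g x)) = int01 (\<lambda>x. 2 * (u x * (g x * f x)))"
      by (intro int01_cong) (simp add: algebra_simps)
    finally show ?thesis by (simp add: int01_cmult)
  qed
  have XX: "\<bar>trip u1 f f\<bar> \<le> M * (X * X)" if "L2_norm f \<le> X" "bmeas f" for f
    using that M0 nn
    by (intro order_trans[OF int01_triple_bound[OF _ _ _ ub(2)]] mult_left_mono mult_mono) auto
  have a1: "\<bar>trip u v v1\<bar> \<le> M * (X * X) / 2"
  proof -
    have "trip u v v1 = trip u v1 v"
      by (intro int01_cong) simp
    with sq[OF wv] XX[OF Xn(1) wderiv_bmeas(1)[OF wv]] show ?thesis by linarith
  qed
  have a2: "\<bar>trip u v2 v1\<bar> \<le> M * (X * X) / 2"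
    using sq[OF wv1] XX[OF Xn(2) wderiv_bmeas(1)[OF wv1]] by linarith
  have a3: "\<bar>trip u \<theta> e1\<bar> \<le> M * (L2_norm \<theta> * E)"
    using L2_norm_le_H1_norm(2)[OF we] eE M0
    by (intro order_trans[OF int01_triple_bound[OF _ _ _ ub(1)]] mult_left_mono) auto
  have "M * (X * X) \<le> M * ((y + E) * (y + E))"
    using Xy nn M0 by (intro mult_left_mono mult_mono) auto
  with a1 a2 a3 have "\<bar>trip u \<theta> \<xi>1\<bar> \<le> M * ((y + E) * (y + E)) + M * (L2_norm \<theta> * E)"
    unfolding split2 by linarith
  then show "\<bar>trip u \<theta> \<xi>1\<bar> \<le>
    M * ((H1_norm \<xi> + 2 * (h * L2_norm \<theta>)) * (H1_norm \<xi> + 2 * (h * L2_norm \<theta>))) + M * (L2_norm \<theta> * (2 * (h * L2_norm \<theta>)))"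
    by (simp add: y_def E_def)
qed

definition "A2 D = M * (4 * M + 1) + 2 * (B * M) + 2 * (8 * (M * M) + M) +
  (2 * (D * (2 * M + D)) + 3 * M * (1 + 2 * D) + M * (2 + 8 * (D * D)) + 2 * (M * (D * D)))"

lemma xi_energy:
  assumes D: "0 \<le> D" "L2_norm \<theta> \<le> D * h ^ (r - 1)"
  shows "rhs \<xi> \<le> A2 D * ((H1_norm \<xi>)\<^sup>2 + h * (h ^ (r - 1))\<^sup>2)"
proof -
  define T p q y where "T = L2_norm \<theta>" and "p = h ^ (r - 1)" and "q = h ^ r" and "y = H1_norm \<xi>"
  have nn: "0 \<le> T" "0 \<le> p" "0 \<le> q" "0 \<le> y"
    using hpos w\<xi> by (auto simp: T_def p_def q_def y_def)
  have q: "q = h * p" by (simp add: q_def p_def h_power)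
  have TD: "T \<le> D * p" using D by (simp add: T_def p_def)
  have yT: "y \<le> T" using \<xi>_le_\<theta> by (simp add: y_def T_def)
  have pp: "p * p \<le> q" and qq: "q * q \<le> h * (p * p)" using h_power_le by (auto simp: p_def q_def)
  define w where "w = y * y + h * (p * p)"
  have hpp: "0 \<le> h * (p * p)" using hpos nn by simp
  have yy: "y * y \<le> w" using hpp by (simp add: w_def)
  have w0: "0 \<le> w" using yy nn by (meson mult_nonneg_nonneg order_trans)
  have "0 \<le> (q - y) * (q - y)" by simp
  then have "2 * (q * y) \<le> w" unfolding w_def using qq by (simp add: algebra_simps)
  then have qy: "q * y \<le> w" using nn by (smt (verit) mult_nonneg_nonneg)
  have qqw: "q * q \<le> w" using qq zero_le_square[of y] unfolding w_def by linarith
  have hT: "h * T \<le> D * q" using mult_left_mono[OF TD, of h] hpos by (simp add: q ac_simps)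
  have yn: "L2_norm \<xi> \<le> y" "L2_norm \<xi>1 \<le> y"
    using L2_norm_le_H1_norm[OF w\<xi>] by (auto simp: y_def)
  have cqy: "c * q * y \<le> c * w" if "0 \<le> c" for c
    using mult_left_mono[OF qy that] by (simp add: ac_simps)
  have cyy: "c * y * y \<le> c * w" if "0 \<le> c" for c
    using mult_left_mono[OF yy that] by (simp add: ac_simps)
  have t1: "\<bar>trip m1 \<epsilon> \<xi>\<bar> \<le> M * (4 * M + 1) * w"
  proof -
    have "L2_norm \<epsilon> * L2_norm \<xi> \<le> (4 * (M * q) + y) * y"
      using \<epsilon>_norms(4) yn nn M0 by (intro mult_mono) (auto simp: q_def y_def)
    also have "\<dots> = 4 * M * q * y + y * y" by (simp add: algebra_simps)
    also have "\<dots> \<le> (4 * M + 1) * w"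
      using cqy[of "4 * M"] yy M0 by (simp add: algebra_simps)
    finally show ?thesis
      unfolding mult.assoc using M0
      by (intro order_trans[OF int01_triple_bound[OF _ _ _ mb(2)]] mult_left_mono) simp_all
  qed
  have \<rho>y: "L2_norm \<rho> * L2_norm f \<le> M * w" if "L2_norm f \<le> y" for f
  proof -
    have "L2_norm \<rho> * L2_norm f \<le> (M * q) * y"
      using \<rho>_L2 that nn M0 by (intro mult_mono) (auto simp: q_def)
    also have "\<dots> \<le> M * w" using cqy[OF M0] .
    finally show ?thesis .
  qed
  have t5: "\<bar>trip d \<rho> \<xi>\<bar> \<le> B * M * w"
    unfolding mult.assoc[of B M]
    by (intro order_trans[OF int01_triple_bound[OF _ _ _ dB]] mult_left_mono \<rho>y yn B0) simp_all
  have t5': "\<bar>trip uh \<rho> \<xi>1\<bar> \<le> B * M * w"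
    unfolding mult.assoc[of B M]
    by (intro order_trans[OF int01_triple_bound[OF _ _ _ uhB]] mult_left_mono \<rho>y yn B0) simp_all
  have parts: "trip uh g \<xi> = - trip d f \<xi> - trip uh f \<xi>1"
    if f: "wderiv f g" for f g
  proof -
    have [simp]: "bmeas f" "bmeas g" using wderiv_bmeas[OF f] by auto
    have "trip d f \<xi> = - int01 (\<lambda>x. uh x * (g x * \<xi> x + f x * \<xi>1 x))"
      by (rule int01_by_parts[OF wuh wderiv_mult[OF f w\<xi>]]) (simp_all add: zeros)
    also have "int01 (\<lambda>x. uh x * (g x * \<xi> x + f x * \<xi>1 x)) =
        trip uh g \<xi> + trip uh f \<xi>1"
      by (simp add: distrib_left int01_add)
    finally show ?thesis by simp
  qed
  note t2 = parts[OF w\<rho>] and t3 = parts[OF w\<theta>]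
  have t4: "\<bar>trip m \<epsilon>1 \<xi>\<bar> \<le> (8 * (M * M) + M) * w"
  proof -
    have "trip m \<epsilon>1 \<xi> = trip \<sigma>1 m \<xi> + trip m \<xi>1 \<xi>"
    proof -
      have "trip m \<epsilon>1 \<xi> = int01 (\<lambda>x. \<sigma>1 x * (m x * \<xi> x) + m x * (\<xi>1 x * \<xi> x))"
        by (intro int01_cong) (simp add: \<epsilon>_split algebra_simps)
      then show ?thesis by (simp add: int01_add)
    qed
    also have "trip \<sigma>1 m \<xi> = - int01 (\<lambda>x. \<sigma> x * (m1 x * \<xi> x + m x * \<xi>1 x))"
      by (rule int01_by_parts[OF w\<sigma> wderiv_mult[OF wm w\<xi>]]) (simp_all add: zeros)
    also have "int01 (\<lambda>x. \<sigma> x * (m1 x * \<xi> x + m x * \<xi>1 x)) =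
        int01 (\<lambda>x. m1 x * (\<sigma> x * \<xi> x) + m x * (\<sigma> x * \<xi>1 x))"
      by (intro int01_cong) (simp add: algebra_simps)
    also have "\<dots> = trip m1 \<sigma> \<xi> + trip m \<sigma> \<xi>1"
      by (simp add: int01_add)
    finally have split: "trip m \<epsilon>1 \<xi> =
        - (trip m1 \<sigma> \<xi> + trip m \<sigma> \<xi>1) + trip m \<xi>1 \<xi>" .
    have \<sigma>y: "L2_norm \<sigma> * L2_norm f \<le> 4 * M * w" if "L2_norm f \<le> y" for f
    proof -
      have "L2_norm \<sigma> * L2_norm f \<le> (4 * M * q) * y"
        using \<sigma>_L2 that nn M0 by (intro mult_mono) (auto simp: q_def)
      also have "\<dots> \<le> 4 * M * w" using cqy[of "4 * M"] M0 by simp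
      finally show ?thesis .
    qed
    have "\<bar>trip m1 \<sigma> \<xi>\<bar> \<le> M * (4 * M * w)"
      by (intro order_trans[OF int01_triple_bound[OF _ _ _ mb(2)]] mult_left_mono \<sigma>y yn M0) simp_all
    moreover have "\<bar>trip m \<sigma> \<xi>1\<bar> \<le> M * (4 * M * w)"
      by (intro order_trans[OF int01_triple_bound[OF _ _ _ mb(1)]] mult_left_mono \<sigma>y yn M0) simp_all
    moreover have "\<bar>trip m \<xi>1 \<xi>\<bar> \<le> M * w"
    proof -
      have "L2_norm \<xi>1 * L2_norm \<xi> \<le> y * y" using yn nn by (intro mult_mono) auto
      then have "L2_norm \<xi>1 * L2_norm \<xi> \<le> w" using yy by linarith
      then show ?thesis
        by (intro order_trans[OF int01_triple_bound[OF _ _ _ mb(1)]] mult_left_mono M0) simp_all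
    qed
    ultimately have "\<bar>trip m \<epsilon>1 \<xi>\<bar> \<le> M * (4 * M * w) + M * (4 * M * w) + M * w"
      unfolding split by linarith
    then show ?thesis by (simp add: algebra_simps)
  qed
  have e1: "(2 * (M * p) + y) * T \<le> D * (2 * M + D) * q"
  proof -
    have "(2 * (M * p) + y) * T \<le> ((2 * M + D) * p) * (D * p)"
      using TD yT nn M0 D by (intro mult_mono) (auto simp: algebra_simps)
    also have "\<dots> = D * (2 * M + D) * (p * p)" by (simp add: ac_simps)
    also have "\<dots> \<le> D * (2 * M + D) * q" using pp D M0 by (intro mult_left_mono) auto
    finally show ?thesis .
  qed
  have DD: "0 \<le> D * (2 * M + D)" using D M0 by simp
  have t6a: "\<bar>trip \<xi> \<epsilon>1 \<theta>\<bar> \<le> D * (2 * M + D) * w"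
  proof -
    have "L2_norm \<epsilon>1 * L2_norm \<theta> \<le> (2 * (M * p) + y) * T"
      using \<epsilon>_norms(2) nn M0 by (intro mult_mono) (auto simp: p_def y_def T_def)
    with e1 have le: "L2_norm \<epsilon>1 * L2_norm \<theta> \<le> D * (2 * M + D) * q" by linarith
    have "\<bar>trip \<xi> \<epsilon>1 \<theta>\<bar> \<le> y * (L2_norm \<epsilon>1 * L2_norm \<theta>)"
      using sup_le_H1_norm[OF w\<xi> zeros(3)] by (intro int01_triple_bound) (simp_all add: y_def)
    also have "\<dots> \<le> y * (D * (2 * M + D) * q)" by (intro mult_left_mono le nn)
    also have "\<dots> \<le> D * (2 * M + D) * w" using cqy[OF DD] by (simp add: ac_simps)
    finally show ?thesis .
  qed
  have t6b: "\<bar>trip \<epsilon> \<theta> \<xi>1\<bar> \<le> D * (2 * M + D) * w"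
  proof -
    have "\<bar>trip \<epsilon> \<theta> \<xi>1\<bar> \<le> (2 * (M * p) + y) * (L2_norm \<theta> * L2_norm \<xi>1)"
      using \<epsilon>_norms(3) by (intro int01_triple_bound) (simp_all add: y_def p_def)
    also have "\<dots> \<le> (2 * (M * p) + y) * (T * y)"
      unfolding T_def using yn nn M0 by (intro mult_left_mono) auto
    also have "\<dots> = ((2 * (M * p) + y) * T) * y" by simp
    also have "\<dots> \<le> (D * (2 * M + D) * q) * y" by (intro mult_right_mono e1 nn)
    also have "\<dots> \<le> D * (2 * M + D) * w" using cqy[OF DD] .
    finally show ?thesis .
  qed
  have X: "y + 2 * (h * T) \<le> y + 2 * D * q" using hT by simp
  have t6c: "\<bar>trip u1 \<theta> \<xi>\<bar> \<le> 3 * M * (1 + 2 * D) * w"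
  proof -
    have "(y + 2 * (h * T)) * y \<le> (y + 2 * D * q) * y" by (intro mult_right_mono X nn)
    also have "\<dots> = y * y + 2 * D * q * y" by (simp add: algebra_simps)
    also have "\<dots> \<le> (1 + 2 * D) * w" using yy cqy[of "2 * D"] D by (simp add: algebra_simps)
    finally have "3 * M * ((y + 2 * (h * T)) * y) \<le> 3 * M * ((1 + 2 * D) * w)"
      using M0 by (intro mult_left_mono) auto
    with theta_terms(1) show ?thesis by (simp add: y_def T_def mult.assoc)
  qed
  have t6d: "\<bar>trip u \<theta> \<xi>1\<bar> \<le> (M * (2 + 8 * (D * D)) + 2 * (M * (D * D))) * w"
  proof -
    have "(y + 2 * (h * T)) * (y + 2 * (h * T)) \<le> (y + 2 * D * q) * (y + 2 * D * q)"
      using X nn hpos D by (intro mult_mono) auto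
    also have "\<dots> \<le> 2 * (y * y) + 8 * (D * D) * (q * q)"
    proof -
      have "0 \<le> (y - 2 * D * q) * (y - 2 * D * q)" by simp
      then show ?thesis by (simp add: algebra_simps)
    qed
    also have "\<dots> \<le> (2 + 8 * (D * D)) * w"
      using yy mult_left_mono[OF qqw, of "8 * (D * D)"] D by (simp add: algebra_simps)
    finally have a: "M * ((y + 2 * (h * T)) * (y + 2 * (h * T))) \<le> M * ((2 + 8 * (D * D)) * w)"
      using M0 by (intro mult_left_mono) auto
    have "T * (2 * (h * T)) = 2 * (h * (T * T))" by simp
    also have "\<dots> \<le> 2 * (h * ((D * p) * (D * p)))"
      using TD nn hpos D by (intro mult_left_mono mult_mono) auto
    also have "\<dots> = 2 * (D * D) * (h * (p * p))" by simp
    also have "\<dots> \<le> 2 * (D * D) * w"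
      using nn by (intro mult_left_mono) (auto simp: w_def)
    finally have "M * (T * (2 * (h * T))) \<le> M * (2 * (D * D) * w)"
      using M0 by (intro mult_left_mono) auto
    with a theta_terms(2) show ?thesis
      unfolding y_def[symmetric] T_def[symmetric] by (simp add: algebra_simps)
  qed
  have s1: "trip d \<theta> \<xi> = trip u1 \<theta> \<xi> - trip \<xi> \<epsilon>1 \<theta>"
  proof -
    have "trip d \<theta> \<xi> = int01 (\<lambda>x. u1 x * (\<theta> x * \<xi> x) - \<xi> x * (\<epsilon>1 x * \<theta> x))"
      by (intro int01_cong) (simp add: \<epsilon>1_def algebra_simps)
    then show ?thesis by (simp add: int01_diff)
  qed
  have s2: "trip uh \<theta> \<xi>1 = trip u \<theta> \<xi>1 - trip \<epsilon> \<theta> \<xi>1"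
  proof -
    have "trip uh \<theta> \<xi>1 = int01 (\<lambda>x. u x * (\<theta> x * \<xi>1 x) - \<epsilon> x * (\<theta> x * \<xi>1 x))"
      by (intro int01_cong) (simp add: \<epsilon>_def algebra_simps)
    then show ?thesis by (simp add: int01_diff)
  qed
  have collect: "- a1 - a2 + a3 - 2 * a4 - a5 + a6 + a7 - a8 \<le> b1 + b2 + b3 + 2 * b4 + b5 + b6 + b7 + b8"
    if "\<bar>a1\<bar> \<le> b1" "\<bar>a2\<bar> \<le> b2" "\<bar>a3\<bar> \<le> b3" "\<bar>a4\<bar> \<le> b4" "\<bar>a5\<bar> \<le> b5" "\<bar>a6\<bar> \<le> b6"
      "\<bar>a7\<bar> \<le> b7" "\<bar>a8\<bar> \<le> b8" for a1 a2 a3 a4 a5 a6 a7 a8 b1 b2 b3 b4 b5 b6 b7 b8 :: real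
    using that unfolding abs_le_iff by simp
  have "rhs \<xi> = - trip m1 \<epsilon> \<xi> - trip d \<rho> \<xi> + trip uh \<rho> \<xi>1
      - 2 * trip m \<epsilon>1 \<xi>
      - trip u1 \<theta> \<xi> + trip \<xi> \<epsilon>1 \<theta>
      + trip u \<theta> \<xi>1 - trip \<epsilon> \<theta> \<xi>1"
    unfolding rhs_eq[OF wderiv_bmeas(1)[OF w\<xi>]] t2 t3 s1 s2 by simp
  also have "\<dots> \<le> M * (4 * M + 1) * w + B * M * w + B * M * w + 2 * ((8 * (M * M) + M) * w)
      + 3 * M * (1 + 2 * D) * w + D * (2 * M + D) * w + (M * (2 + 8 * (D * D)) + 2 * (M * (D * D))) * w + D * (2 * M + D) * w"
    by (rule collect[OF t1 t5 t5' t4 t6c t6a t6d t6b])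
  also have "\<dots> = A2 D * w"
    by (simp add: A2_def algebra_simps)
  finally show ?thesis
    by (simp add: w_def y_def p_def power2_eq_square)
qed

end

section \<open>Differentiation in time\<close>

lemma L2_norm_uniform_limit:
  assumes lim: "uniform_limit {0..1} q g F" and bm: "\<And>s. s \<in> I \<Longrightarrow> bmeas (q s)" "bmeas g"
    and I: "eventually (\<lambda>s. s \<in> I) F"
  shows "((\<lambda>s. L2_norm (\<lambda>x. q s x - g x)) \<longlongrightarrow> 0) F"
proof (rule tendstoI)
  fix e :: real assume e: "0 < e"
  have "eventually (\<lambda>s. \<forall>x\<in>{0..1}. dist (q s x) (g x) < e / 2) F"
    using lim[unfolded uniform_limit_iff, rule_format, of "e / 2"] e by simp
  with I show "eventually (\<lambda>s. dist (L2_norm (\<lambda>x. q s x - g x)) 0 < e) F"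
  proof eventually_elim
    case (elim s)
    have "L2_norm (\<lambda>x. q s x - g x) \<le> e / 2"
      using elim bm by (intro L2_norm_le_bound) (auto simp: dist_real_def intro: less_imp_le)
    then show ?case using e by simp
  qed
qed

lemma (in semi_inner) energy_derivative:
  assumes t: "t \<in> I"
    and diff: "\<And>\<phi> \<psi>. \<phi> \<in> S \<Longrightarrow> \<psi> \<in> S \<Longrightarrow> (\<lambda>x. \<phi> x - \<psi> x) \<in> S"
    and SW: "S \<subseteq> W" and bS: "\<And>\<phi>. \<phi> \<in> S \<Longrightarrow> bmeas \<phi>"
    and norm_le: "\<And>\<phi>. \<phi> \<in> S \<Longrightarrow> L2_norm \<phi> \<le> sqrt (B \<phi> \<phi>)"
    and w: "\<And>s. s \<in> I \<Longrightarrow> w s \<in> S"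
    and rel: "\<And>s \<phi>. s \<in> I \<Longrightarrow> \<phi> \<in> S \<Longrightarrow> B (w s) \<phi> = L2_inner (f s) \<phi>"
    and bf: "\<And>s. s \<in> I \<Longrightarrow> bmeas (f s)" "bmeas f'"
    and lim: "uniform_limit {0..1} (\<lambda>s x. (f s x - f t x) / (s - t)) f' (at t within I)"
  shows "((\<lambda>s. B (w s) (w s)) has_real_derivative 2 * L2_inner f' (w t)) (at t within I)"
proof -
  let ?F = "at t within I"
  define q where "q s x = (f s x - f t x) / (s - t)" for s x
  define v where "v s x = w s x - w t x" for s x
  have I: "eventually (\<lambda>s. s \<in> I) ?F"
    by (simp add: eventually_at_filter)
  have ne: "eventually (\<lambda>s. s \<noteq> t) ?F"
    by (simp add: eventually_at_filter)
  have bq: "bmeas (q s)" if "s \<in> I" for s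
    unfolding q_def[abs_def] using bf(1)[OF that] bf(1)[OF t] by simp
  have v: "v s \<in> S" if "s \<in> I" for s
    unfolding v_def[abs_def] by (rule diff[OF w[OF that] w[OF t]])
  have q0: "((\<lambda>s. L2_norm (\<lambda>x. q s x - f' x)) \<longlongrightarrow> 0) ?F"
    by (rule L2_norm_uniform_limit[OF _ bq bf(2) I]) (use lim in \<open>simp_all add: q_def[abs_def]\<close>)
  have Bv: "B (v s) \<phi> = (s - t) * L2_inner (q s) \<phi>" if s: "s \<in> I" "s \<noteq> t" and \<phi>: "\<phi> \<in> W" "\<phi> \<in> S" for s \<phi>
  proof -
    have "B (v s) \<phi> = B (w s) \<phi> - B (w t) \<phi>"
      unfolding v_def[abs_def] using w[OF s(1)] w[OF t] SW \<phi> by (intro B_diff) auto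
    also have "\<dots> = L2_inner (\<lambda>x. f s x - f t x) \<phi>"
      using rel[OF s(1) \<phi>(2)] rel[OF t \<phi>(2)] bf(1)[OF s(1)] bf(1)[OF t] bS[OF \<phi>(2)] by (simp add: L2.B_diff)
    also have "\<dots> = L2_inner (\<lambda>x. (s - t) * q s x) \<phi>"
      using s(2) by (simp add: q_def)
    also have "\<dots> = (s - t) * L2_inner (q s) \<phi>"
      using bq[OF s(1)] bS[OF \<phi>(2)] by (intro L2.B_cmult) auto
    finally show ?thesis .
  qed
  have nv: "L2_norm (v s) \<le> \<bar>s - t\<bar> * (L2_norm (\<lambda>x. q s x - f' x) + L2_norm f')" if s: "s \<in> I" "s \<noteq> t" for s
  proof -
    have vW: "v s \<in> W" using v[OF s(1)] SW by blast
    define n where "n = sqrt (B (v s) (v s))"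
    have n: "0 \<le> n" "n * n = B (v s) (v s)"
      using B_psd[OF vW] by (simp_all add: n_def)
    have "n * n = (s - t) * L2_inner (q s) (v s)"
      unfolding n(2) by (rule Bv[OF s vW v[OF s(1)]])
    also have "\<dots> \<le> \<bar>s - t\<bar> * \<bar>L2_inner (q s) (v s)\<bar>"
      by (metis abs_ge_self abs_mult)
    also have "\<dots> \<le> \<bar>s - t\<bar> * (L2_norm (q s) * L2_norm (v s))"
      using int01_Cauchy_Schwarz[OF bq[OF s(1)] bS[OF v[OF s(1)]]]
      by (intro mult_left_mono) (auto simp: L2_inner_int01)
    also have "\<dots> \<le> \<bar>s - t\<bar> * (L2_norm (q s) * n)"
      using norm_le[OF v[OF s(1)]] by (intro mult_left_mono) (auto simp: n_def)
    finally have "n * n \<le> (\<bar>s - t\<bar> * L2_norm (q s)) * n" by simp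
    then have "n \<le> \<bar>s - t\<bar> * L2_norm (q s)"
      using n(1) by (cases "n = 0") (auto simp: mult_le_cancel_right)
    then have "L2_norm (v s) \<le> \<bar>s - t\<bar> * L2_norm (q s)"
      using norm_le[OF v[OF s(1)]] by (simp add: n_def)
    also have "L2_norm (q s) = L2_norm (\<lambda>x. (q s x - f' x) + f' x)" by simp
    also have "\<bar>s - t\<bar> * \<dots> \<le> \<bar>s - t\<bar> * (L2_norm (\<lambda>x. q s x - f' x) + L2_norm f')"
      using bq[OF s(1)] bf(2) by (intro mult_left_mono L2_norm_triangle) auto
    finally show ?thesis .
  qed
  have v0: "((\<lambda>s. L2_norm (v s)) \<longlongrightarrow> 0) ?F"
  proof (rule tendsto_sandwich[of "\<lambda>s. 0"])
    have "((\<lambda>s. \<bar>s - t\<bar> * (L2_norm (\<lambda>x. q s x - f' x) + L2_norm f')) \<longlongrightarrow> \<bar>t - t\<bar> * (0 + L2_norm f')) ?F"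
      by (intro tendsto_intros q0)
    then show "((\<lambda>s. \<bar>s - t\<bar> * (L2_norm (\<lambda>x. q s x - f' x) + L2_norm f')) \<longlongrightarrow> 0) ?F" by simp
    show "eventually (\<lambda>s. L2_norm (v s) \<le> \<bar>s - t\<bar> * (L2_norm (\<lambda>x. q s x - f' x) + L2_norm f')) ?F"
      using I ne by eventually_elim (rule nv)
  qed auto
  define bound where "bound s = L2_norm (\<lambda>x. q s x - f' x) * (L2_norm (v s) + 2 * L2_norm (w t)) + L2_norm f' * L2_norm (v s)" for s
  have b0: "(bound \<longlongrightarrow> 0) ?F"
  proof -
    have "(bound \<longlongrightarrow> 0 * (0 + 2 * L2_norm (w t)) + L2_norm f' * 0) ?F"
      unfolding bound_def[abs_def] by (intro tendsto_intros q0 v0)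
    then show ?thesis by simp
  qed
  have main: "\<bar>(B (w s) (w s) - B (w t) (w t)) / (s - t) - 2 * L2_inner f' (w t)\<bar> \<le> bound s"
    if s: "s \<in> I" "s \<noteq> t" for s
  proof -
    have WW: "w s \<in> W" "w t \<in> W" "v s \<in> W" using w[OF s(1)] w[OF t] v[OF s(1)] SW by blast+
    have bw: "bmeas (w s)" "bmeas (w t)" "bmeas (v s)" using bS w[OF s(1)] w[OF t] v[OF s(1)] by blast+
    have ws: "w s = (\<lambda>x. v s x + w t x)" by (simp add: v_def)
    have "B (w s) (w s) - B (w t) (w t) = B (v s) (w s) + B (v s) (w t)"
      unfolding v_def[abs_def] using WW by (simp add: B_diff B_sym[of "w s" "w t"])
    also have "\<dots> = (s - t) * (L2_inner (q s) (w s) + L2_inner (q s) (w t))"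
      using Bv[OF s WW(1) w[OF s(1)]] Bv[OF s WW(2) w[OF t]] by (simp add: distrib_left)
    finally have e1: "(B (w s) (w s) - B (w t) (w t)) / (s - t) = L2_inner (q s) (w s) + L2_inner (q s) (w t)"
      using s(2) by simp
    have e2: "L2_inner (q s) (w s) + L2_inner (q s) (w t) - 2 * L2_inner f' (w t) =
        int01 (\<lambda>x. (q s x - f' x) * (v s x + 2 * w t x)) + int01 (\<lambda>x. f' x * v s x)"
    proof -
      have "int01 (\<lambda>x. (q s x - f' x) * (v s x + 2 * w t x)) + int01 (\<lambda>x. f' x * v s x) =
          int01 (\<lambda>x. (q s x - f' x) * (v s x + 2 * w t x) + f' x * v s x)"
        using bq[OF s(1)] bf(2) bw by (simp add: int01_add)
      also have "\<dots> = int01 (\<lambda>x. q s x * w s x + q s x * w t x - 2 * (f' x * w t x))"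
        by (intro int01_cong) (simp add: v_def algebra_simps)
      also have "\<dots> = L2_inner (q s) (w s) + L2_inner (q s) (w t) - 2 * L2_inner f' (w t)"
        using bq[OF s(1)] bf(2) bw by (simp add: int01_add int01_diff int01_cmult L2_inner_int01)
      finally show ?thesis by simp
    qed
    have eq: "(B (w s) (w s) - B (w t) (w t)) / (s - t) - 2 * L2_inner f' (w t) =
        int01 (\<lambda>x. (q s x - f' x) * (v s x + 2 * w t x)) + int01 (\<lambda>x. f' x * v s x)"
      unfolding e1 by (rule e2)
    have "\<bar>int01 (\<lambda>x. (q s x - f' x) * (v s x + 2 * w t x))\<bar> \<le>
        L2_norm (\<lambda>x. q s x - f' x) * L2_norm (\<lambda>x. v s x + 2 * w t x)"
      by (rule int01_Cauchy_Schwarz) (simp_all add: bq[OF s(1)] bf(2) bw)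
    also have "\<dots> \<le> L2_norm (\<lambda>x. q s x - f' x) * (L2_norm (v s) + 2 * L2_norm (w t))"
      using L2_norm_triangle[of "v s" "\<lambda>x. 2 * w t x"] L2_norm_cmult[of 2 "w t"] bw
      by (intro mult_left_mono) simp_all
    finally have "\<bar>int01 (\<lambda>x. (q s x - f' x) * (v s x + 2 * w t x))\<bar> \<le>
        L2_norm (\<lambda>x. q s x - f' x) * (L2_norm (v s) + 2 * L2_norm (w t))" .
    moreover have "\<bar>int01 (\<lambda>x. f' x * v s x)\<bar> \<le> L2_norm f' * L2_norm (v s)"
      by (rule int01_Cauchy_Schwarz) (simp_all add: bf(2) bw)
    ultimately show ?thesis
      unfolding eq bound_def by linarith
  qed
  have "((\<lambda>s. (B (w s) (w s) - B (w t) (w t)) / (s - t) - 2 * L2_inner f' (w t)) \<longlongrightarrow> 0) ?F"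
  proof (rule Lim_null_comparison[OF _ b0])
    show "\<forall>\<^sub>F s in ?F. norm ((B (w s) (w s) - B (w t) (w t)) / (s - t) - 2 * L2_inner f' (w t)) \<le> bound s"
      unfolding real_norm_def using I ne by eventually_elim (rule main)
  qed
  then show ?thesis
    unfolding has_field_derivative_iff by (rule Lim_null[THEN iffD2])
qed

lemma gronwall_step:
  fixes y :: "real \<Rightarrow> real"
  assumes t: "0 \<le> t" and a: "0 \<le> a" and b: "0 \<le> b"
    and der: "\<And>s. s \<in> {0<..<t} \<Longrightarrow> (y has_real_derivative y' s) (at s)"
    and le: "\<And>s. s \<in> {0<..<t} \<Longrightarrow> y' s \<le> a * y s + b"
    and cont: "continuous_on {0..t} y" and y0: "y 0 = 0"
  shows "y t \<le> b * t * exp (a * t)"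
proof -
  define g where "g s = exp (- a * s) * y s - b * s" for s
  have "g t \<le> g 0"
  proof (rule DERIV_nonpos_imp_decreasing_open[OF t])
    fix s assume s: "0 < s" "s < t"
    have "(g has_real_derivative exp (- a * s) * (y' s - a * y s) - b) (at s)"
      unfolding g_def[abs_def] using der[of s] s
      by (auto intro!: derivative_eq_intros simp: algebra_simps)
    moreover have "exp (- a * s) * (y' s - a * y s) - b \<le> 0"
    proof -
      have "exp (- a * s) * (y' s - a * y s) \<le> exp (- a * s) * b"
        using le[of s] s by (intro mult_left_mono) auto
      also have "\<dots> \<le> 1 * b"
        using a b s by (intro mult_right_mono) auto
      finally show ?thesis by simp
    qed
    ultimately show "\<exists>d. (g has_real_derivative d) (at s) \<and> d \<le> 0" by blast
  next
    show "continuous_on {0..t} g"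
      unfolding g_def[abs_def] by (intro continuous_intros cont)
  qed
  then have "exp (- a * t) * y t \<le> b * t"
    by (simp add: g_def y0)
  then have "exp (a * t) * (exp (- a * t) * y t) \<le> exp (a * t) * (b * t)"
    by (intro mult_left_mono) auto
  then show ?thesis
    by (simp add: mult.assoc[symmetric] exp_add[symmetric]) (simp add: ac_simps)
qed

lemma gronwall_continuation:
  fixes y :: "real \<Rightarrow> real"
  assumes T: "0 < T" and a: "0 \<le> a" and b: "0 \<le> b"
    and der: "\<And>t. t \<in> {0..T} \<Longrightarrow> (y has_real_derivative y' t) (at t within {0..T})"
    and y0: "y 0 = 0"
    and le: "\<And>t. t \<in> {0..T} \<Longrightarrow> y t \<le> \<delta> \<Longrightarrow> y' t \<le> a * y t + b"
    and small: "b * T * exp (a * T) < \<delta>"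
    and t: "t \<in> {0..T}"
  shows "y t \<le> b * T * exp (a * T)"
proof -
  have cont: "continuous_on {0..T} y"
    using der by (rule DERIV_continuous_on)
  have der_at: "(y has_real_derivative y' s) (at s)" if "s \<in> {0<..<T}" for s
    using der[of s] that at_within_Icc_at[of 0 s T] by auto
  have step: "y s \<le> b * T * exp (a * T)" if s: "s \<in> {0..T}" and below: "\<And>q. q \<in> {0<..<s} \<Longrightarrow> y q \<le> \<delta>" for s
  proof -
    have "y s \<le> b * s * exp (a * s)"
      using s below le der_at a b y0 cont
      by (intro gronwall_step[where y' = y']) (auto intro: continuous_on_subset)
    also have "\<dots> \<le> b * T * exp (a * T)"
      using s a b by (intro mult_mono) (auto intro: mult_left_mono)
    finally show ?thesis .
  qed
  have "y s < \<delta>" if s: "s \<in> {0..T}" for s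
  proof (rule ccontr)
    assume "\<not> y s < \<delta>"
    define Z where "Z = {0..T} \<inter> y -` {\<delta>..}"
    have "closed Z"
      unfolding Z_def by (rule continuous_closed_preimage[OF cont]) auto
    then have "compact Z"
      unfolding Z_def by (meson bounded_subset bounded_closed_interval compact_eq_bounded_closed inf_le1)
    moreover have "Z \<noteq> {}"
      using s \<open>\<not> y s < \<delta>\<close> by (auto simp: Z_def)
    ultimately obtain t0 where t0: "t0 \<in> Z" "\<And>q. q \<in> Z \<Longrightarrow> t0 \<le> q"
      using compact_attains_inf[of Z] by blast
    have "y q \<le> \<delta>" if "q \<in> {0<..<t0}" for q
    proof (rule ccontr)
      assume "\<not> y q \<le> \<delta>"
      then have "q \<in> Z" using that t0(1) by (auto simp: Z_def)
      then show False using t0(2)[of q] that by auto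
    qed
    then have "y t0 \<le> b * T * exp (a * T)"
      using t0(1) by (intro step) (auto simp: Z_def)
    then show False
      using small t0(1) by (auto simp: Z_def)
  qed
  then show ?thesis
    using t by (intro step) (auto intro: less_imp_le)
qed

lemma Ck_xt_space:
  assumes "Ck_xt T k v" "j \<le> k"
  shows "continuous_on ({0..T} \<times> {0..1}) (\<lambda>(t, x). (Dx ^^ j) (v t) x)"
  using assms
proof (induction k arbitrary: v j)
  case 0
  then show ?case by simp
next
  case (Suc k)
  show ?case
  proof (cases j)
    case 0
    then show ?thesis using Suc.prems by simp
  next
    case (Suc i)
    then have "continuous_on ({0..T} \<times> {0..1}) (\<lambda>(t, x). (Dx ^^ i) (Dx (v t)) x)"
      using Suc.IH[of "\<lambda>t. Dx (v t)" i] Suc.prems by simp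
    then show ?thesis
      by (simp add: Suc funpow_swap1)
  qed
qed

lemma Ck_xt_Ck:
  assumes "Ck_xt T k v" "t \<in> {0..T}" "j < k" "x \<in> {0..1}"
  shows "((Dx ^^ j) (v t) has_real_derivative (Dx ^^ Suc j) (v t) x) (at x within {0..1})"
  using assms(1,3)
proof (induction k arbitrary: v j)
  case 0
  then show ?case by simp
next
  case (Suc k)
  show ?case
  proof (cases j)
    case 0
    have "v t differentiable (at x within {0..1})"
      using Suc.prems assms by simp
    then obtain d where d: "(v t has_real_derivative d) (at x within {0..1})"
      by (auto simp: real_differentiable_def)
    then show ?thesis
      using Dx_eqI[OF d assms(4)] 0 by simp
  next
    case (Suc i)
    then show ?thesis
      using Suc.IH[of "\<lambda>t. Dx (v t)" i] Suc.prems by (simp add: funpow_swap1)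
  qed
qed

lemma Ck_xt_bounded:
  assumes "Ck_xt T k v" "0 \<le> T"
  shows "\<exists>M\<ge>0. \<forall>j\<le>k. \<forall>t\<in>{0..T}. \<forall>x\<in>{0..1}. \<bar>(Dx ^^ j) (v t) x\<bar> \<le> M"
proof -
  have "\<exists>M\<ge>0. \<forall>t\<in>{0..T}. \<forall>x\<in>{0..1}. \<bar>(Dx ^^ j) (v t) x\<bar> \<le> M" if "j \<le> k" for j
  proof -
    have "bounded ((\<lambda>(t, x). (Dx ^^ j) (v t) x) ` ({0..T} \<times> {0..1}))"
      by (intro compact_imp_bounded compact_continuous_image Ck_xt_space[OF assms(1) that] compact_Times) auto
    then obtain M where M: "\<forall>p\<in>{0..T} \<times> {0..1}. \<bar>(\<lambda>(t, x). (Dx ^^ j) (v t) x) p\<bar> \<le> M"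
      by (auto simp: bounded_iff)
    have "\<bar>(Dx ^^ j) (v t) x\<bar> \<le> \<bar>M\<bar>" if "t \<in> {0..T}" "x \<in> {0..1}" for t x
      using bspec[OF M, of "(t, x)"] that by simp
    then show ?thesis by (intro exI[of _ "\<bar>M\<bar>"]) auto
  qed
  then have "\<forall>j\<in>{..k}. \<exists>M. 0 \<le> M \<and> (\<forall>t\<in>{0..T}. \<forall>x\<in>{0..1}. \<bar>(Dx ^^ j) (v t) x\<bar> \<le> M)"
    by auto
  from bchoice[OF this] obtain M where M: "\<forall>j\<in>{..k}. 0 \<le> M j \<and> (\<forall>t\<in>{0..T}. \<forall>x\<in>{0..1}. \<bar>(Dx ^^ j) (v t) x\<bar> \<le> M j)" ..
  have "M j \<le> (\<Sum>i\<le>k. M i)" if "j \<le> k" for j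
    using M that by (intro member_le_sum) auto
  moreover have "0 \<le> (\<Sum>i\<le>k. M i)"
    using M by (intro sum_nonneg) auto
  moreover have "\<bar>(Dx ^^ j) (v t) x\<bar> \<le> M j" if "j \<le> k" "t \<in> {0..T}" "x \<in> {0..1}" for j t x
    using bspec[OF M, of j] that by simp
  ultimately show ?thesis
    by (intro exI[of _ "\<Sum>i\<le>k. M i"]) (meson order_trans)
qed

lemma Ck_xt_time_quotient:
  assumes v: "Ck_xt T (Suc k) v" and T: "0 < T" and t: "t \<in> {0..T}"
  shows "uniform_limit {0..1} (\<lambda>s x. (v s x - v t x) / (s - t)) (Dt T v t) (at t within {0..T})"
proof -
  have der: "((\<lambda>s. v s x) has_real_derivative Dt T v s x) (at s within {0..T})"
    if s: "s \<in> {0..T}" and x: "x \<in> {0..1}" for s x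
  proof -
    have "(\<lambda>s. v s x) differentiable (at s within {0..T})"
      using v s x by simp
    then obtain d where d: "((\<lambda>s. v s x) has_real_derivative d) (at s within {0..T})"
      by (auto simp: real_differentiable_def)
    have "Dt T v s x = d"
      unfolding Dt_def using d s T
      by (intro vector_derivative_within_closed_interval) (auto simp: has_real_derivative_iff_has_vector_derivative)
    with d show ?thesis by simp
  qed
  have "Ck_xt T k (Dt T v)" using v by simp
  then have "continuous_on ({0..T} \<times> {0..1}) (\<lambda>(t, x). Dt T v t x)"
    by (cases k) auto
  then have uc: "uniformly_continuous_on ({0..T} \<times> {0..1}) (\<lambda>(t, x). Dt T v t x)"
    by (intro compact_uniformly_continuous compact_Times) auto
  show ?thesis
    unfolding uniform_limit_iff
  proof (intro allI impI)
    fix e :: real assume e: "0 < e"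
    obtain \<delta> where \<delta>: "0 < \<delta>" "\<And>p p'. p \<in> {0..T} \<times> {0..1} \<Longrightarrow> p' \<in> {0..T} \<times> {0..1} \<Longrightarrow> dist p' p < \<delta> \<Longrightarrow>
        dist (case p' of (t, x) \<Rightarrow> Dt T v t x) (case p of (t, x) \<Rightarrow> Dt T v t x) < e"
      using uc[unfolded uniformly_continuous_on_def, rule_format, OF e] by blast
    have close: "dist ((v s x - v t x) / (s - t)) (Dt T v t x) < e"
      if s: "s \<in> {0..T}" "s \<noteq> t" "dist s t < \<delta>" and x: "x \<in> {0..1}" for s x
    proof -
      have mv: "\<exists>c\<in>{a<..<b}. v b x - v a x = (b - a) * Dt T v c x" if ab: "a < b" "a \<in> {0..T}" "b \<in> {0..T}" for a b
      proof -
        have "continuous_on {a..b} (\<lambda>s. v s x)"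
          using DERIV_continuous_on[OF der[OF _ x]] ab by (auto intro: continuous_on_subset)
        moreover have "((\<lambda>s. v s x) has_derivative (*) (Dt T v c x)) (at c)" if "a < c" "c < b" for c
          unfolding has_field_derivative_def[symmetric]
          using der[OF _ x, of c] that ab at_within_Icc_at[of 0 c T] by auto
        ultimately obtain c where "a < c" "c < b" "v b x - v a x = Dt T v c x * (b - a)"
          by (rule mvt[OF ab(1), of "\<lambda>s. v s x" "\<lambda>c. (*) (Dt T v c x)"])
        then show ?thesis by (intro bexI[of _ c]) (simp_all add: mult.commute)
      qed
      obtain c where c: "c \<in> {0..T}" "dist c t < \<delta>" "v s x - v t x = (s - t) * Dt T v c x"
      proof (cases "s < t")
        case True
        obtain c where "c \<in> {s<..<t}" "v t x - v s x = (t - s) * Dt T v c x"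
          using mv[OF True s(1) t] by blast
        then show ?thesis
          using s t True by (intro that[of c]) (auto simp: dist_real_def algebra_simps)
      next
        case False
        with s(2) have "t < s" by simp
        then obtain c where "c \<in> {t<..<s}" "v s x - v t x = (s - t) * Dt T v c x"
          using mv[OF _ t s(1)] by blast
        then show ?thesis
          using s t by (intro that[of c]) (auto simp: dist_real_def)
      qed
      have "dist (Dt T v c x) (Dt T v t x) < e"
        using \<delta>(2)[of "(t, x)" "(c, x)"] c(1,2) t x by (simp add: dist_Pair_Pair)
      then show ?thesis
        using c(3) s(2) by simp
    qed
    show "\<forall>\<^sub>F s in at t within {0..T}. \<forall>x\<in>{0..1}. dist ((v s x - v t x) / (s - t)) (Dt T v t x) < e"
      unfolding eventually_at using \<delta>(1) close by blast
  qed
qed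

text \<open>The nodal basis turns pointwise into uniform convergence of the difference quotients.\<close>

lemma fe_time_quotient:
  assumes z: "partition_01 N z" and r: "1 \<le> r" and T: "0 < T"
    and w: "\<And>t. t \<in> {0..T} \<Longrightarrow> w t \<in> fe_space0 r \<mu> N z"
    and dw: "\<And>t x. t \<in> {0..T} \<Longrightarrow> x \<in> {0..1} \<Longrightarrow> (\<lambda>s. w s x) differentiable (at t within {0..T})"
    and t: "t \<in> {0..T}"
  shows "uniform_limit {0..1} (\<lambda>s x. (w s x - w t x) / (s - t)) (Dt T w t) (at t within {0..T})"
    and "bmeas (Dt T w t)"
proof -
  let ?S = "fe_space0 r \<mu> N z" and ?F = "at t within {0..T}"
  obtain X L where X: "finite X" "X \<subseteq> {0..1}" and "\<forall>p\<in>X. L p \<in> ?S"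
    and "\<forall>\<phi>\<in>?S. \<forall>x\<in>{0..1}. \<phi> x = (\<Sum>p\<in>X. \<phi> p * L p x)"
    using fe_space0_nodal_basis[OF z r, of \<mu>] by (elim exE conjE) (rule that)
  then have L: "\<And>p. p \<in> X \<Longrightarrow> L p \<in> ?S"
    and rep: "\<And>\<phi> x. \<phi> \<in> ?S \<Longrightarrow> x \<in> {0..1} \<Longrightarrow> \<phi> x = (\<Sum>p\<in>X. \<phi> p * L p x)"
    by (auto simp only:)
  have bL: "bmeas (L p)" if "p \<in> X" for p
    using wderiv_bmeas(1)[OF fe_space0_basic(3)[OF z L[OF that]]] .
  have der: "((\<lambda>s. w s x) has_real_derivative Dt T w t x) ?F" if x: "x \<in> {0..1}" for x
  proof -
    obtain d where d: "((\<lambda>s. w s x) has_real_derivative d) ?F"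
      using dw[OF t x] by (auto simp: real_differentiable_def)
    have "Dt T w t x = d"
      unfolding Dt_def using d t T
      by (intro vector_derivative_within_closed_interval) (auto simp: has_real_derivative_iff_has_vector_derivative)
    with d show ?thesis by simp
  qed
  have quot: "((\<lambda>s. (w s x - w t x) / (s - t)) \<longlongrightarrow> Dt T w t x) ?F" if "x \<in> {0..1}" for x
    using der[OF that] by (simp add: has_field_derivative_iff)
  have I: "eventually (\<lambda>s. s \<in> {0..T}) ?F"
    by (simp add: eventually_at_filter)
  have nontriv: "?F \<noteq> bot"
    using t T by (simp add: trivial_limit_within islimpt_Icc)
  have q_rep: "(w s x - w t x) / (s - t) = (\<Sum>p\<in>X. (w s p - w t p) / (s - t) * L p x)"
    if "s \<in> {0..T}" "x \<in> {0..1}" for s x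
    using rep[OF w[OF that(1)] that(2)] rep[OF w[OF t] that(2)]
    by (simp add: left_diff_distrib diff_divide_distrib sum_subtractf sum_divide_distrib)
  have Dt_rep: "Dt T w t x = (\<Sum>p\<in>X. Dt T w t p * L p x)" if x: "x \<in> {0..1}" for x
  proof (rule tendsto_unique[OF nontriv quot[OF x]])
    have "((\<lambda>s. \<Sum>p\<in>X. (w s p - w t p) / (s - t) * L p x) \<longlongrightarrow> (\<Sum>p\<in>X. Dt T w t p * L p x)) ?F"
      using X(2) by (intro tendsto_intros quot) auto
    then show "((\<lambda>s. (w s x - w t x) / (s - t)) \<longlongrightarrow> (\<Sum>p\<in>X. Dt T w t p * L p x)) ?F"
    proof (rule Lim_transform_eventually)
      show "\<forall>\<^sub>F s in ?F. (\<Sum>p\<in>X. (w s p - w t p) / (s - t) * L p x) = (w s x - w t x) / (s - t)"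
        using I by eventually_elim (rule q_rep[OF _ x, symmetric])
    qed
  qed
  have "bmeas (\<lambda>x. \<Sum>p\<in>X. Dt T w t p * L p x)"
    using bL by simp
  then show "bmeas (Dt T w t)"
    by (rule bmeas_cong_finite[of "{}", rotated 2]) (simp_all add: Dt_rep)
  have "\<forall>p\<in>X. \<exists>c. \<forall>x\<in>{0..1}. \<bar>L p x\<bar> \<le> c"
    using bL by (auto simp: bmeas_def)
  from bchoice[OF this] obtain c where c: "\<forall>p\<in>X. \<forall>x\<in>{0..1}. \<bar>L p x\<bar> \<le> c p" ..
  define bound where "bound s = (\<Sum>p\<in>X. \<bar>(w s p - w t p) / (s - t) - Dt T w t p\<bar> * c p)" for s
  have "(bound \<longlongrightarrow> (\<Sum>p\<in>X. \<bar>Dt T w t p - Dt T w t p\<bar> * c p)) ?F"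
    unfolding bound_def[abs_def] using X(2) by (intro tendsto_intros quot) auto
  then have b0: "(bound \<longlongrightarrow> 0) ?F" by simp
  show "uniform_limit {0..1} (\<lambda>s x. (w s x - w t x) / (s - t)) (Dt T w t) ?F"
    unfolding uniform_limit_iff
  proof (intro allI impI)
    fix e :: real assume "0 < e"
    then have "eventually (\<lambda>s. bound s < e) ?F"
      using b0 by (rule order_tendstoD(2)[rotated])
    with I show "\<forall>\<^sub>F s in ?F. \<forall>x\<in>{0..1}. dist ((w s x - w t x) / (s - t)) (Dt T w t x) < e"
    proof eventually_elim
      case (elim s)
      show ?case
      proof
        fix x :: real assume x: "x \<in> {0..1}"
        have "dist ((w s x - w t x) / (s - t)) (Dt T w t x) =
            \<bar>\<Sum>p\<in>X. ((w s p - w t p) / (s - t) - Dt T w t p) * L p x\<bar>"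
          unfolding dist_real_def q_rep[OF elim(1) x] Dt_rep[OF x]
          by (simp add: left_diff_distrib sum_subtractf)
        also have "\<dots> \<le> bound s"
          unfolding bound_def using c x
          by (intro order_trans[OF sum_abs] sum_mono) (auto simp: abs_mult intro!: mult_left_mono)
        finally show "dist ((w s x - w t x) / (s - t)) (Dt T w t x) < e"
          using elim(2) by linarith
      qed
    qed
  qed
qed

section \<open>The error estimate\<close>

definition theta_const :: "real \<Rightarrow> real \<Rightarrow> real \<Rightarrow> real \<Rightarrow> real" where
  "theta_const T C M \<kappa> = (let a = 2 * \<bar>error_bounded.A1 C M \<kappa> (error_setting.K C M \<kappa>)\<bar> in a * T * exp (a * T))"

definition xi_const :: "real \<Rightarrow> real \<Rightarrow> real \<Rightarrow> real \<Rightarrow> real" where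
  "xi_const T C M \<kappa> =
    (let a = 2 * \<bar>error_bounded.A2 M (error_setting.K C M \<kappa>) (sqrt (theta_const T C M \<kappa>))\<bar> in a * T * exp (a * T))"

lemma theta_const_nonneg: "0 \<le> T \<Longrightarrow> 0 \<le> theta_const T C M \<kappa>"
  by (simp add: theta_const_def Let_def)

lemma xi_const_nonneg: "0 \<le> T \<Longrightarrow> 0 \<le> xi_const T C M \<kappa>"
  by (simp add: xi_const_def Let_def)

lemma semidiscrete_error:
  fixes u u1 u2 m m1 mh uh pm ru f' :: "real \<Rightarrow> real \<Rightarrow> real"
  assumes T: "0 < T"
    and E: "\<And>t. t \<in> {0..T} \<Longrightarrow>
      error_setting r \<mu> N z C M \<kappa> (u t) (u1 t) (u2 t) (m t) (m1 t) (mh t) (uh t) (pm t) (ru t)"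
    and bf: "\<And>t. t \<in> {0..T} \<Longrightarrow> bmeas (f' t)"
    and lim: "\<And>t. t \<in> {0..T} \<Longrightarrow>
      uniform_limit {0..1} (\<lambda>s x. ((m s x - mh s x) - (m t x - mh t x)) / (s - t)) (f' t) (at t within {0..T})"
    and eq: "\<And>t \<phi>. t \<in> {0..T} \<Longrightarrow> \<phi> \<in> fe_space0 r \<mu> N z \<Longrightarrow>
      L2_inner (f' t) \<phi> = error_setting.rhs (u t) (u1 t) (m t) (m1 t) (mh t) (uh t) \<phi>"
    and init: "L2_norm (\<lambda>x. pm 0 x - mh 0 x) = 0"
    and small: "theta_const T C M \<kappa> * max_mesh N z < 1"
    and t: "t \<in> {0..T}"
  shows "L2_norm (\<lambda>x. u t x - uh t x) \<le>
    (4 * M + sqrt (xi_const T C M \<kappa>)) * (sqrt (max_mesh N z) * max_mesh N z ^ (r - 1))"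
proof -
  let ?S = "fe_space0 r \<mu> N z"
  define h p where "h = max_mesh N z" and "p = max_mesh N z ^ (r - 1)"
  define K where "K = error_setting.K C M \<kappa>"
  define \<theta> where "\<theta> t = error_setting.\<theta> (mh t) (pm t)" for t
  define \<xi> where "\<xi> t = error_setting.\<xi> (uh t) (ru t)" for t
  define f where "f t x = m t x - mh t x" for t x
  have z0: "0 \<in> {0..T}" using T by simp
  interpret E0: error_setting r \<mu> N z C M \<kappa> "u 0" "u1 0" "u2 0" "m 0" "m1 0" "mh 0" "uh 0" "pm 0" "ru 0"
    by (rule E[OF z0])
  have h: "0 < h" and p: "0 \<le> p" "p \<le> h" and hp: "h ^ r = h * p" and h1: "h \<le> 1"
    using E0.hpos E0.h_power_le(2) E0.h_power E0.h1 by (auto simp: h_def p_def)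
  note z = E0.z
  have diff: "(\<lambda>x. \<phi> x - \<psi> x) \<in> ?S" if "\<phi> \<in> ?S" "\<psi> \<in> ?S" for \<phi> \<psi>
    by (rule fe_space0_diff[OF z that])
  have bS: "bmeas \<phi>" if "\<phi> \<in> ?S" for \<phi>
    using wderiv_bmeas(1)[OF fe_space0_basic(3)[OF z that]] .
  have basics: "\<theta> s \<in> ?S" "\<xi> s \<in> ?S" "bmeas (f s)" "H1_norm (\<xi> s) \<le> L2_norm (\<theta> s)"
    "\<And>\<phi>. \<phi> \<in> ?S \<Longrightarrow> L2_inner (\<theta> s) \<phi> = L2_inner (f s) \<phi>"
    "\<And>\<phi>. \<phi> \<in> ?S \<Longrightarrow> A_form (\<xi> s) \<phi> = L2_inner (f s) \<phi>"
    if s: "s \<in> {0..T}" for s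
  proof -
    interpret Es: error_setting r \<mu> N z C M \<kappa> "u s" "u1 s" "u2 s" "m s" "m1 s" "mh s" "uh s" "pm s" "ru s"
      by (rule E[OF s])
    show "\<theta> s \<in> ?S" "\<xi> s \<in> ?S" "H1_norm (\<xi> s) \<le> L2_norm (\<theta> s)"
      using Es.\<theta>S Es.\<xi>S Es.\<xi>_le_\<theta> by (simp_all add: \<theta>_def \<xi>_def)
    have bm: "bmeas (m s)" "bmeas (pm s)" "bmeas (mh s)"
      using wderiv_bmeas(1)[OF Es.wm] bS[OF Es.pm] bS[OF Es.mh] by auto
    then show "bmeas (f s)" by (simp add: f_def[abs_def])
    show \<theta>: "L2_inner (\<theta> s) \<phi> = L2_inner (f s) \<phi>" if \<phi>: "\<phi> \<in> ?S" for \<phi>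
    proof -
      have "L2_inner (\<theta> s) \<phi> = L2_inner (pm s) \<phi> - L2_inner (mh s) \<phi>"
        unfolding \<theta>_def Es.\<theta>_def[abs_def] using bm bS[OF \<phi>] by (intro L2.B_diff) auto
      also have "L2_inner (pm s) \<phi> = L2_inner (m s) \<phi>"
        using Es.pm_orth[OF \<phi>] bm bS[OF \<phi>] L2.B_diff[of "m s" "pm s" \<phi>] by simp
      also have "L2_inner (m s) \<phi> - L2_inner (mh s) \<phi> = L2_inner (f s) \<phi>"
        unfolding f_def[abs_def] using bm bS[OF \<phi>] by (intro L2.B_diff[symmetric]) auto
      finally show ?thesis .
    qed
    show "A_form (\<xi> s) \<phi> = L2_inner (f s) \<phi>" if \<phi>: "\<phi> \<in> ?S" for \<phi>
      using Es.\<xi>_weak[OF \<phi>] \<theta>[OF \<phi>] by (simp add: \<theta>_def \<xi>_def)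
  qed
  have limf: "uniform_limit {0..1} (\<lambda>s x. (f s x - f t x) / (s - t)) (f' t) (at t within {0..T})"
    if "t \<in> {0..T}" for t
    using lim[OF that] by (simp add: f_def[abs_def])
  have d\<theta>: "((\<lambda>s. L2_inner (\<theta> s) (\<theta> s)) has_real_derivative 2 * L2_inner (f' t) (\<theta> t)) (at t within {0..T})"
    if t: "t \<in> {0..T}" for t
  proof (rule L2.energy_derivative[OF t, where S = ?S and f = f])
    show "L2_norm \<phi> \<le> sqrt (L2_inner \<phi> \<phi>)" for \<phi> by (simp add: L2_norm_def)
  qed (use diff bS basics bf[OF t] limf[OF t] in auto)
  have d\<xi>: "((\<lambda>s. A_form (\<xi> s) (\<xi> s)) has_real_derivative 2 * L2_inner (f' t) (\<xi> t)) (at t within {0..T})"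
    if t: "t \<in> {0..T}" for t
  proof (rule A.energy_derivative[OF t, where S = ?S and f = f])
    show "L2_norm \<phi> \<le> sqrt (A_form \<phi> \<phi>)" if "\<phi> \<in> ?S" for \<phi>
      using L2_norm_le_H1_norm(1)[OF fe_space0_basic(3)[OF z that]] by (simp add: H1_norm_def)
    show "?S \<subseteq> {v. \<exists>g. wderiv v g}"
      using fe_space0_basic(3)[OF z] by blast
  qed (use diff bS basics bf[OF t] limf[OF t] in auto)
  have \<theta>sq: "L2_inner \<phi> \<phi> = (L2_norm \<phi>)\<^sup>2" for \<phi>
    by (simp add: L2_norm_sq L2_inner_int01)
  have bounded: "\<exists>d. error_bounded r \<mu> N z C M \<kappa> (u t) (u1 t) (u2 t) (m t) (m1 t) (mh t) (uh t) (pm t) (ru t) d K"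
    if t: "t \<in> {0..T}" and le: "L2_inner (\<theta> t) (\<theta> t) \<le> h" for t
  proof -
    interpret Et: error_setting r \<mu> N z C M \<kappa> "u t" "u1 t" "u2 t" "m t" "m1 t" "mh t" "uh t" "pm t" "ru t"
      by (rule E[OF t])
    have "(L2_norm Et.\<theta>)\<^sup>2 \<le> max_mesh N z"
      using le by (simp add: \<theta>sq[symmetric] \<theta>_def h_def)
    then obtain d where d: "wderiv (uh t) d" "\<And>x. x \<in> {0..1} \<Longrightarrow> \<bar>d x\<bar> \<le> K" "\<And>x. x \<in> {0..1} \<Longrightarrow> \<bar>uh t x\<bar> \<le> K"
      unfolding K_def by (rule Et.uh_derivative_bound) blast
    have "error_bounded r \<mu> N z C M \<kappa> (u t) (u1 t) (u2 t) (m t) (m1 t) (mh t) (uh t) (pm t) (ru t) d K"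
      by unfold_locales (fact d)+
    then show ?thesis by (rule exI[of _ d])
  qed
  define a where "a = 2 * \<bar>error_bounded.A1 C M \<kappa> K\<bar>"
  define E1 where "E1 = theta_const T C M \<kappa>"
  have E1: "E1 = a * T * exp (a * T)"
    unfolding E1_def theta_const_def Let_def a_def K_def ..
  have E1_nonneg: "0 \<le> E1" using T by (simp add: E1_def theta_const_nonneg)
  have E1p: "a * (p * p) * T * exp (a * T) = E1 * (p * p)"
    unfolding E1 by (simp only: ac_simps)
  have \<theta>_small: "E1 * (p * p) < h"
  proof -
    have "E1 * (p * p) \<le> E1 * (h * h)"
      using p h E1_nonneg by (intro mult_left_mono mult_mono) auto
    also have "\<dots> = (E1 * h) * h" by simp
    also have "\<dots> < 1 * h"
      using small h by (intro mult_strict_right_mono) (auto simp: E1_def h_def)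
    finally show ?thesis by simp
  qed
  have \<theta>_bound: "L2_inner (\<theta> t) (\<theta> t) \<le> E1 * (p * p)" if t: "t \<in> {0..T}" for t
    unfolding E1p[symmetric]
  proof (rule gronwall_continuation[OF T _ _ d\<theta> _ _ _ t, where \<delta> = h])
    show "0 \<le> a" "0 \<le> a * (p * p)" by (auto simp: a_def)
    show "L2_inner (\<theta> 0) (\<theta> 0) = 0"
      using init by (simp add: \<theta>sq \<theta>_def E0.\<theta>_def[abs_def])
    show "a * (p * p) * T * exp (a * T) < h"
      using \<theta>_small by (simp add: E1p)
    show "2 * L2_inner (f' s) (\<theta> s) \<le> a * L2_inner (\<theta> s) (\<theta> s) + a * (p * p)"
      if s: "s \<in> {0..T}" and le: "L2_inner (\<theta> s) (\<theta> s) \<le> h" for s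
    proof -
      obtain d where "error_bounded r \<mu> N z C M \<kappa> (u s) (u1 s) (u2 s) (m s) (m1 s) (mh s) (uh s) (pm s) (ru s) d K"
        using bounded[OF s le] by (rule exE)
      then interpret Es: error_bounded r \<mu> N z C M \<kappa> "u s" "u1 s" "u2 s" "m s" "m1 s" "mh s" "uh s" "pm s" "ru s" d K .
      have "L2_inner (f' s) (\<theta> s) = Es.rhs (\<theta> s)"
        by (rule eq[OF s basics(1)[OF s]])
      also have "\<dots> \<le> Es.A1 * ((L2_norm (\<theta> s))\<^sup>2 + p\<^sup>2)"
        using Es.theta_energy by (simp add: \<theta>_def p_def)
      also have "\<dots> \<le> \<bar>Es.A1\<bar> * ((L2_norm (\<theta> s))\<^sup>2 + p\<^sup>2)"
        by (intro mult_right_mono) auto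
      finally show ?thesis
        by (simp add: \<theta>sq a_def power2_eq_square algebra_simps)
    qed
  qed
  define D where "D = sqrt E1"
  have \<theta>D: "L2_norm (\<theta> t) \<le> D * p" if "t \<in> {0..T}" for t
  proof (rule power2_le_imp_le)
    show "(L2_norm (\<theta> t))\<^sup>2 \<le> (D * p)\<^sup>2"
      using \<theta>_bound[OF that] E1_nonneg by (simp add: \<theta>sq D_def power_mult_distrib power2_eq_square[of p])
    show "0 \<le> D * p" using E1_nonneg p by (simp add: D_def)
  qed
  have D0: "0 \<le> D" using E1_nonneg by (simp add: D_def)
  define b where "b = 2 * \<bar>error_bounded.A2 M K D\<bar>"
  define E2 where "E2 = xi_const T C M \<kappa>"
  have E2: "E2 = b * T * exp (b * T)"
    unfolding E2_def xi_const_def Let_def b_def D_def E1_def K_def ..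
  have E2_nonneg: "0 \<le> E2" using T by (simp add: E2_def xi_const_nonneg)
  define \<delta> where "\<delta> = b * (h * (p * p)) * T * exp (b * T) + 1"
  have \<xi>sq: "A_form (\<xi> s) (\<xi> s) = (H1_norm (\<xi> s))\<^sup>2" if "s \<in> {0..T}" for s
    by (rule A_form_H1_norm[OF fe_space0_basic(3)[OF z basics(2)[OF that]]])
  have H0: "0 \<le> H1_norm (\<xi> s)" if "s \<in> {0..T}" for s
    using H1_norm_nonneg[OF fe_space0_basic(3)[OF z basics(2)[OF that]]] .
  have small_\<theta>: "L2_inner (\<theta> s) (\<theta> s) \<le> h" if "s \<in> {0..T}" for s
    using \<theta>_bound[OF that] \<theta>_small by linarith
  have "A_form (\<xi> t) (\<xi> t) \<le> b * (h * (p * p)) * T * exp (b * T)"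
  proof (rule gronwall_continuation[OF T _ _ d\<xi> _ _ _ t, where \<delta> = \<delta>])
    show "0 \<le> b" "0 \<le> b * (h * (p * p))" using h by (auto simp: b_def)
    have "L2_norm (\<theta> 0) = 0"
      using init by (simp add: \<theta>_def E0.\<theta>_def[abs_def])
    then show "A_form (\<xi> 0) (\<xi> 0) = 0"
      using basics(4)[OF z0] H0[OF z0] by (simp add: \<xi>sq[OF z0])
    show "b * (h * (p * p)) * T * exp (b * T) < \<delta>" by (simp add: \<delta>_def)
    show "2 * L2_inner (f' s) (\<xi> s) \<le> b * A_form (\<xi> s) (\<xi> s) + b * (h * (p * p))" if s: "s \<in> {0..T}" for s
    proof -
      obtain d where "error_bounded r \<mu> N z C M \<kappa> (u s) (u1 s) (u2 s) (m s) (m1 s) (mh s) (uh s) (pm s) (ru s) d K"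
        using bounded[OF s small_\<theta>[OF s]] by (rule exE)
      then interpret Es: error_bounded r \<mu> N z C M \<kappa> "u s" "u1 s" "u2 s" "m s" "m1 s" "mh s" "uh s" "pm s" "ru s" d K .
      have "L2_inner (f' s) (\<xi> s) = Es.rhs (\<xi> s)"
        by (rule eq[OF s basics(2)[OF s]])
      also have "\<dots> \<le> Es.A2 D * ((H1_norm (\<xi> s))\<^sup>2 + h * p\<^sup>2)"
        using Es.xi_energy[OF D0] \<theta>D[OF s] by (simp add: \<theta>_def \<xi>_def p_def h_def)
      also have "\<dots> \<le> \<bar>Es.A2 D\<bar> * ((H1_norm (\<xi> s))\<^sup>2 + h * p\<^sup>2)"
        using h by (intro mult_right_mono) auto
      finally show ?thesis
        by (simp add: \<xi>sq[OF s] b_def power2_eq_square algebra_simps)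
    qed
  qed
  also have "\<dots> = (sqrt E2 * (sqrt h * p))\<^sup>2"
    using E2_nonneg h by (simp add: power_mult_distrib E2[symmetric] power2_eq_square[of p]) (simp add: E2)
  finally have "H1_norm (\<xi> t) \<le> sqrt E2 * (sqrt h * p)"
    unfolding \<xi>sq[OF t] by (rule power2_le_imp_le) (use E2_nonneg h p in simp)
  moreover obtain d where "error_bounded r \<mu> N z C M \<kappa> (u t) (u1 t) (u2 t) (m t) (m1 t) (mh t) (uh t) (pm t) (ru t) d K"
    using bounded[OF t small_\<theta>[OF t]] by (rule exE)
  then interpret Et: error_bounded r \<mu> N z C M \<kappa> "u t" "u1 t" "u2 t" "m t" "m1 t" "mh t" "uh t" "pm t" "ru t" d K .
  have "L2_norm (\<lambda>x. u t x - uh t x) \<le> 4 * (M * (h * p)) + H1_norm (\<xi> t)"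
    using Et.\<epsilon>_norms(4) by (simp add: Et.\<epsilon>_def[abs_def] \<xi>_def hp[unfolded h_def] h_def)
  moreover have "4 * (M * (h * p)) \<le> 4 * (M * (sqrt h * p))"
  proof -
    have "h \<le> sqrt h"
      using h h1 by (intro real_le_rsqrt) (auto simp: power2_eq_square mult_left_le)
    then show ?thesis
      using p Et.M0 by (intro mult_left_mono mult_right_mono) auto
  qed
  ultimately show ?thesis
    unfolding E2_def[symmetric] h_def[symmetric] p_def[folded h_def, symmetric] by (simp add: algebra_simps)
qed

lemma Ck_xt_slice:
  assumes "Ck_xt T k v" "j \<le> k" "t \<in> {0..T}"
  shows "continuous_on {0..1} ((Dx ^^ j) (v t))"
proof -
  have "continuous_on {0..1} (\<lambda>x. (\<lambda>(t, x). (Dx ^^ j) (v t) x) (t, x))"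
    using assms(3) by (intro continuous_on_compose2[OF Ck_xt_space[OF assms(1,2)]] continuous_intros) auto
  then show ?thesis by simp
qed

lemma fe_space0_subset_bmeas: "partition_01 N z \<Longrightarrow> fe_space0 r \<mu> N z \<subseteq> {f. bmeas f}"
  using fe_space0_basic(3) wderiv_bmeas(1) by blast

lemma fe_space0_subset_wderiv: "partition_01 N z \<Longrightarrow> fe_space0 r \<mu> N z \<subseteq> {v. \<exists>g. wderiv v g}"
  using fe_space0_basic(3) by blast

lemma Ck_xt_fe_approx:
  assumes z: "partition_01 N z" and r: "2 \<le> r" "\<mu> \<le> r - 2" and v: "Ck_xt T r v" and t: "t \<in> {0..T}"
    and bc: "v t 0 = 0" "v t 1 = 0" and M: "\<And>x. x \<in> {0..1} \<Longrightarrow> \<bar>(Dx ^^ r) (v t) x\<bar> \<le> M"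
  shows "\<exists>s\<in>fe_space0 r \<mu> N z. L2_norm (\<lambda>x. v t x - s x) \<le> M * max_mesh N z ^ r \<and>
    L2_norm (\<lambda>x. Dx (v t) x - Dx s x) \<le> M * max_mesh N z ^ (r - 1)"
proof -
  define f where "f i = (Dx ^^ i) (v t)" for i
  have f0: "f 0 = v t" "f 1 = Dx (v t)" by (simp_all add: f_def)
  have cf: "continuous_on {0..1} (f r)"
    unfolding f_def by (rule Ck_xt_slice[OF v order_refl t])
  have df: "(f i has_real_derivative f (Suc i) x) (at x within {0..1})" if "i < r" "x \<in> {0..1}" for i x
    unfolding f_def by (rule Ck_xt_Ck[OF v t that])
  obtain s where s: "s \<in> fe_space0 r \<mu> N z"
    "L2_norm (\<lambda>x. f 0 x - s x) \<le> max_mesh N z ^ r * L2_norm (f r)"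
    "L2_norm (\<lambda>x. f 1 x - Dx s x) \<le> max_mesh N z ^ (r - 1) * L2_norm (f r)"
    by (rule fe_approx[OF z r _ order_refl df cf]) (use r bc f0 in auto)
  have n: "L2_norm (f r) \<le> M"
    by (rule L2_norm_le_bound[OF bmeas_continuous[OF cf]]) (simp add: f_def M)
  have "max_mesh N z ^ k * L2_norm (f r) \<le> M * max_mesh N z ^ k" for k
    using mult_left_mono[OF n, of "max_mesh N z ^ k"] max_mesh_pos[OF z] by (simp add: mult.commute)
  then show ?thesis
    using s unfolding f0 by (intro bexI[OF _ s(1)]) (auto intro: order_trans)
qed

theorem proposition5p2:
  fixes r :: nat
  assumes "r \<ge> 2"
  shows "\<exists>k. \<forall>T u0 m0 m u.
    T > 0 \<longrightarrow>
    (\<forall>x\<in>{0..1}. m0 x = u0 x - Dx (Dx u0) x) \<longrightarrow>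
    ibvp_unique_solution r T u0 m0 m u \<longrightarrow>
    Ck_xt T k m \<longrightarrow> Ck_xt T k u \<longrightarrow>
    (\<forall>\<mu> F. \<mu> \<le> r - 2 \<longrightarrow> quasiuniform_family F \<longrightarrow>
      (\<exists>C. \<exists>h0>0. \<forall>(N, z)\<in>F. max_mesh N z \<le> h0 \<longrightarrow>
        (\<forall>mh uh. semidiscrete_solution T (fe_space0 r \<mu> N z) u0 mh uh \<longrightarrow>
          (\<forall>t\<in>{0..T}. L2_norm (\<lambda>x. u t x - uh t x) \<le> C * max_mesh N z powr (real r - 1 / 2)))))"
proof (intro exI[of _ r] allI impI)
  fix T :: real and u0 m0 :: "real \<Rightarrow> real" and m u :: "real \<Rightarrow> real \<Rightarrow> real"
    and \<mu> :: nat and F :: "(nat \<times> (nat \<Rightarrow> real)) set"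
  assume T: "T > 0" and m0: "\<forall>x\<in>{0..1}. m0 x = u0 x - Dx (Dx u0) x"
    and sol: "ibvp_unique_solution r T u0 m0 m u" and Cm: "Ck_xt T r m" and Cu: "Ck_xt T r u"
    and \<mu>: "\<mu> \<le> r - 2" and F: "quasiuniform_family F"
  have ibvp: "ibvp_solution r T u0 m0 m u"
    using sol by (simp add: ibvp_unique_solution_def)
  have m_eq: "m t x = u t x - Dx (Dx (u t)) x"
    and pde: "Dt T m t x + u t x * Dx (m t) x + 2 * Dx (u t) x * m t x = 0"
    if "t \<in> {0..T}" "x \<in> {0..1}" for t x
    using ibvp that unfolding ibvp_solution_def by blast+
  have bc: "m t 0 = 0" "m t 1 = 0" "u t 0 = 0" "u t 1 = 0" if "t \<in> {0..T}" for t
    using ibvp that unfolding ibvp_solution_def by blast+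
  have m_init: "m 0 x = u0 x - Dx (Dx u0) x" if x: "x \<in> {0..1}" for x
  proof -
    have "m 0 x = m0 x" using ibvp x unfolding ibvp_solution_def by blast
    then show ?thesis using m0 x by simp
  qed
  obtain Mu Mm where M0: "0 \<le> Mu" "0 \<le> Mm"
    and Mu: "\<forall>j\<le>r. \<forall>t\<in>{0..T}. \<forall>x\<in>{0..1}. \<bar>(Dx ^^ j) (u t) x\<bar> \<le> Mu"
    and Mm: "\<forall>j\<le>r. \<forall>t\<in>{0..T}. \<forall>x\<in>{0..1}. \<bar>(Dx ^^ j) (m t) x\<bar> \<le> Mm"
    using Ck_xt_bounded[OF Cu] Ck_xt_bounded[OF Cm] T by (metis less_imp_le)
  define M where "M = Mu + Mm"
  have uM: "\<bar>(Dx ^^ j) (u t) x\<bar> \<le> M" and mM: "\<bar>(Dx ^^ j) (m t) x\<bar> \<le> M"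
    if j: "j \<le> r" and tx: "t \<in> {0..T}" "x \<in> {0..1}" for j t x
    using Mu[rule_format, OF j tx] Mm[rule_format, OF j tx] M0 by (simp_all add: M_def)
  obtain \<kappa> where \<kappa>: "\<forall>(N, z)\<in>F. max_mesh N z / min_mesh N z \<le> \<kappa>" and part: "\<forall>(N, z)\<in>F. partition_01 N z"
    using F by (auto simp: quasiuniform_family_def)
  obtain C where C0: "C \<ge> 0" and inv:
    "\<And>N z \<mu> \<phi>. partition_01 N z \<Longrightarrow> \<phi> \<in> fe_space0 r \<mu> N z \<Longrightarrow>
      L2_norm (Dx \<phi>) \<le> C / min_mesh N z * L2_norm \<phi>"
    "\<And>N z \<mu> \<phi> g M x. partition_01 N z \<Longrightarrow> \<phi> \<in> fe_space0 r \<mu> N z \<Longrightarrow> bmeas g \<Longrightarrow>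
      (\<And>x. x \<in> {0..1} \<Longrightarrow> \<bar>g x\<bar> \<le> M) \<Longrightarrow> x \<in> {0..1} - z ` {1..N+1} \<Longrightarrow>
      \<bar>Dx \<phi> x\<bar> \<le> C * (L2_norm (\<lambda>x. Dx \<phi> x - g x) / sqrt (min_mesh N z) + M)"
    by (rule fe_inverse_estimates[of r]) blast
  define E1 where "E1 = theta_const T C M \<kappa>"
  have E1: "0 \<le> E1" using T by (simp add: E1_def theta_const_nonneg)
  define h0 where "h0 = min 1 (1 / (E1 + 1))"
  have h0: "h0 > 0" using E1 by (simp add: h0_def)
  have r1: "1 \<le> r" using assms by simp
  obtain k where k: "r = Suc k" using assms by (cases r) auto
  define A where "A = 4 * M + sqrt (xi_const T C M \<kappa>)"
  have "L2_norm (\<lambda>x. u t x - uh t x) \<le> A * max_mesh N z powr (real r - 1 / 2)"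
    if Nz: "(N, z) \<in> F" and small: "max_mesh N z \<le> h0"
      and sd: "semidiscrete_solution T (fe_space0 r \<mu> N z) u0 mh uh" and t: "t \<in> {0..T}" for N z mh uh t
  proof -
    let ?S = "fe_space0 r \<mu> N z"
    have z: "partition_01 N z" using part Nz by blast
    have h: "0 < max_mesh N z" using max_mesh_pos[OF z] .
    have "max_mesh N z / min_mesh N z \<le> \<kappa>" using \<kappa> Nz by blast
    then have \<kappa>': "max_mesh N z \<le> \<kappa> * min_mesh N z"
      using min_mesh_pos[OF z] by (simp add: pos_divide_le_eq)
    have mhS: "mh t \<in> ?S" and uhS: "uh t \<in> ?S" if "t \<in> {0..T}" for t
      using sd that by (simp_all add: semidiscrete_solution_def)
    have dmh: "(\<lambda>s. mh s x) differentiable (at t within {0..T})" if "t \<in> {0..T}" "x \<in> {0..1}" for t x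
      using sd that by (simp add: semidiscrete_solution_def)
    have weak: "L2_inner (mh t) \<phi> = A_form (uh t) \<phi>" if "t \<in> {0..T}" "\<phi> \<in> ?S" for t \<phi>
      using sd that by (simp add: semidiscrete_solution_def)
    have evol: "L2_inner (Dt T mh t) \<psi> =
        - L2_inner (\<lambda>x. uh t x * Dx (mh t) x) \<psi> - 2 * L2_inner (\<lambda>x. Dx (uh t) x * mh t x) \<psi>"
      if "t \<in> {0..T}" "\<psi> \<in> ?S" for t \<psi>
      using sd that by (simp add: semidiscrete_solution_def)
    have mh0: "L2_inner (mh 0) \<phi> = L2_inner (\<lambda>x. u0 x - Dx (Dx u0) x) \<phi>" if "\<phi> \<in> ?S" for \<phi>
      using sd that by (simp add: semidiscrete_solution_def is_L2_projection_def)
    have du: "(u t has_real_derivative Dx (u t) x) (at x within {0..1})"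
      and du1: "(Dx (u t) has_real_derivative Dx (Dx (u t)) x) (at x within {0..1})"
      and dm: "(m t has_real_derivative Dx (m t) x) (at x within {0..1})"
      if "t \<in> {0..T}" "x \<in> {0..1}" for t x
      using Ck_xt_Ck[OF Cu that(1), of 0 x] Ck_xt_Ck[OF Cu that(1), of 1 x] Ck_xt_Ck[OF Cm that(1), of 0 x] that assms
      by simp_all
    have cu2: "continuous_on {0..1} (Dx (Dx (u t)))" and cm1: "continuous_on {0..1} (Dx (m t))"
      if "t \<in> {0..T}" for t
      using Ck_xt_slice[OF Cu, of 2 t] Ck_xt_slice[OF Cm, of 1 t] that assms by (simp_all add: numeral_2_eq_2)
    have cu1: "continuous_on {0..1} (Dx (u t))" if "t \<in> {0..T}" for t
      using Ck_xt_slice[OF Cu, of 1 t] that assms by simp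
    have wu: "wderiv (u t) (Dx (u t))" and wm: "wderiv (m t) (Dx (m t))" if "t \<in> {0..T}" for t
      using wderiv_C1[OF du[OF that] cu1[OF that]] wderiv_C1[OF dm[OF that] cm1[OF that]] by simp_all
    have bu: "bmeas (u t)" "bmeas (Dx (u t))" "bmeas (m t)" "bmeas (Dx (m t))" if "t \<in> {0..T}" for t
      using wderiv_bmeas[OF wu[OF that]] wderiv_bmeas[OF wm[OF that]] by simp_all
    have bS: "bmeas \<phi>" "bmeas (Dx \<phi>)" if "\<phi> \<in> ?S" for \<phi>
      using wderiv_bmeas[OF fe_space0_basic(3)[OF z that]] by simp_all
    have "\<forall>t\<in>{0..T}. \<exists>w. w \<in> ?S \<and> (\<forall>\<phi>\<in>?S. L2_inner (\<lambda>x. m t x - w x) \<phi> = 0)"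
    proof
      fix t assume "t \<in> {0..T}"
      then have mem: "m t \<in> {f. bmeas f}" using bu(3) by simp
      obtain w where "w \<in> ?S" "\<And>\<phi>. \<phi> \<in> ?S \<Longrightarrow> L2_inner (\<lambda>x. m t x - w x) \<phi> = 0"
        by (rule L2.fe_projection[OF z r1 fe_space0_subset_bmeas[OF z] mem]) blast
      then show "\<exists>w. w \<in> ?S \<and> (\<forall>\<phi>\<in>?S. L2_inner (\<lambda>x. m t x - w x) \<phi> = 0)"
        by (intro exI[of _ w]) simp
    qed
    from bchoice[OF this] obtain pm
      where pm: "\<forall>t\<in>{0..T}. pm t \<in> ?S \<and> (\<forall>\<phi>\<in>?S. L2_inner (\<lambda>x. m t x - pm t x) \<phi> = 0)" ..
    have "\<forall>t\<in>{0..T}. \<exists>w. w \<in> ?S \<and> (\<forall>\<phi>\<in>?S. A_form (\<lambda>x. u t x - w x) \<phi> = 0)"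
    proof
      fix t assume t: "t \<in> {0..T}"
      have mem: "u t \<in> {v. \<exists>g. wderiv v g}" using wu[OF t] by blast
      obtain w where "w \<in> ?S" "\<And>\<phi>. \<phi> \<in> ?S \<Longrightarrow> A_form (\<lambda>x. u t x - w x) \<phi> = 0"
        by (rule A.fe_projection[OF z r1 fe_space0_subset_wderiv[OF z] mem]) blast
      then show "\<exists>w. w \<in> ?S \<and> (\<forall>\<phi>\<in>?S. A_form (\<lambda>x. u t x - w x) \<phi> = 0)"
        by (intro exI[of _ w]) simp
    qed
    from bchoice[OF this] obtain ru
      where ru: "\<forall>t\<in>{0..T}. ru t \<in> ?S \<and> (\<forall>\<phi>\<in>?S. A_form (\<lambda>x. u t x - ru t x) \<phi> = 0)" ..
    have E: "error_setting r \<mu> N z C M \<kappa> (u t) (Dx (u t)) (Dx (Dx (u t))) (m t) (Dx (m t)) (mh t) (uh t) (pm t) (ru t)"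
      if t: "t \<in> {0..T}" for t
    proof
      show "2 \<le> r" "\<mu> \<le> r - 2" "partition_01 N z" "max_mesh N z \<le> \<kappa> * min_mesh N z" "0 \<le> C"
        by (fact assms \<mu> z \<kappa>' C0)+
      show "max_mesh N z \<le> 1" using small by (simp add: h0_def)
      show "\<bar>u t x\<bar> \<le> M" "\<bar>Dx (u t) x\<bar> \<le> M" "\<bar>Dx (Dx (u t)) x\<bar> \<le> M" "\<bar>m t x\<bar> \<le> M" "\<bar>Dx (m t) x\<bar> \<le> M"
        if "x \<in> {0..1}" for x
        using uM[OF _ t that, of 0] uM[OF _ t that, of 1] uM[OF _ t that, of 2] mM[OF _ t that, of 0]
          mM[OF _ t that, of 1] assms by (simp_all add: numeral_2_eq_2)
      show "\<exists>s\<in>?S. L2_norm (\<lambda>x. u t x - s x) \<le> M * max_mesh N z ^ r \<and>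
          L2_norm (\<lambda>x. Dx (u t) x - Dx s x) \<le> M * max_mesh N z ^ (r - 1)"
        by (rule Ck_xt_fe_approx[OF z assms \<mu> Cu t bc(3,4)[OF t] uM[OF order_refl t]])
      show "\<exists>s\<in>?S. L2_norm (\<lambda>x. m t x - s x) \<le> M * max_mesh N z ^ r \<and>
          L2_norm (\<lambda>x. Dx (m t) x - Dx s x) \<le> M * max_mesh N z ^ (r - 1)"
        by (rule Ck_xt_fe_approx[OF z assms \<mu> Cm t bc(1,2)[OF t] mM[OF order_refl t]])
      show "L2_norm (Dx \<phi>) \<le> C / min_mesh N z * L2_norm \<phi>" if "\<phi> \<in> ?S" for \<phi>
        by (rule inv(1)[OF z that])
      show "\<bar>Dx \<phi> x\<bar> \<le> C * (L2_norm (\<lambda>x. Dx \<phi> x - g x) / sqrt (min_mesh N z) + B)"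
        if "\<phi> \<in> ?S" "bmeas g" "\<And>x. x \<in> {0..1} \<Longrightarrow> \<bar>g x\<bar> \<le> B" "x \<in> {0..1} - z ` {1..N+1}" for \<phi> g B x
        by (rule inv(2)[OF z that])
      show "L2_inner (mh t) \<phi> = A_form (uh t) \<phi>" if "\<phi> \<in> ?S" for \<phi> by (rule weak[OF t that])
      show "pm t \<in> ?S" "ru t \<in> ?S" using pm ru t by simp_all
      show "L2_inner (\<lambda>x. m t x - pm t x) \<phi> = 0" "A_form (\<lambda>x. u t x - ru t x) \<phi> = 0" if "\<phi> \<in> ?S" for \<phi>
        using pm ru t that by simp_all
    qed (use t du du1 dm cu2 cm1 bc m_eq mhS uhS in simp_all)
    define f' where "f' t x = Dt T m t x - Dt T mh t x" for t x
    have bDt: "bmeas (Dt T m t)" "bmeas (Dt T mh t)" if t: "t \<in> {0..T}" for t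
    proof -
      have "Ck_xt T k (Dt T m)" using Cm by (simp add: k)
      from Ck_xt_slice[OF this _ t, of 0] show "bmeas (Dt T m t)"
        by (intro bmeas_continuous) simp
      show "bmeas (Dt T mh t)"
        by (rule fe_time_quotient(2)[OF z r1 T mhS dmh t])
    qed
    have lim: "uniform_limit {0..1} (\<lambda>s x. ((m s x - mh s x) - (m t x - mh t x)) / (s - t)) (f' t) (at t within {0..T})"
      if t: "t \<in> {0..T}" for t
    proof -
      have "uniform_limit {0..1} (\<lambda>s x. (m s x - m t x) / (s - t)) (Dt T m t) (at t within {0..T})"
        by (rule Ck_xt_time_quotient[OF Cm[unfolded k] T t])
      moreover have "uniform_limit {0..1} (\<lambda>s x. (mh s x - mh t x) / (s - t)) (Dt T mh t) (at t within {0..T})"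
        by (rule fe_time_quotient(1)[OF z r1 T mhS dmh t])
      ultimately have "uniform_limit {0..1} (\<lambda>s x. (m s x - m t x) / (s - t) - (mh s x - mh t x) / (s - t))
          (\<lambda>x. Dt T m t x - Dt T mh t x) (at t within {0..T})"
        by (rule uniform_limit_minus)
      moreover have "(\<lambda>s x. (m s x - m t x) / (s - t) - (mh s x - mh t x) / (s - t)) =
          (\<lambda>s x. ((m s x - mh s x) - (m t x - mh t x)) / (s - t))"
        by (simp add: fun_eq_iff diff_divide_distrib)
      ultimately show ?thesis
        unfolding f'_def[abs_def] by (simp only:)
    qed
    have eq: "L2_inner (f' t) \<phi> = error_setting.rhs (u t) (Dx (u t)) (m t) (Dx (m t)) (mh t) (uh t) \<phi>"
      if t: "t \<in> {0..T}" and \<phi>: "\<phi> \<in> ?S" for t \<phi>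
    proof -
      note bm = bu[OF t] bDt[OF t] bS[OF mhS[OF t]] bS[OF uhS[OF t]] bS(1)[OF \<phi>]
      have "L2_inner (Dt T m t) \<phi> =
          int01 (\<lambda>x. (- 1) * ((u t x * Dx (m t) x) * \<phi> x) + (- 2) * ((Dx (u t) x * m t x) * \<phi> x))"
        unfolding L2_inner_int01
      proof (rule int01_cong)
        fix x :: real assume "x \<in> {0..1}"
        then have Dt_m: "Dt T m t x = - (u t x * Dx (m t) x) - 2 * (Dx (u t) x * m t x)"
          using pde[OF t, of x] by simp
        show "Dt T m t x * \<phi> x = (- 1) * ((u t x * Dx (m t) x) * \<phi> x) + (- 2) * ((Dx (u t) x * m t x) * \<phi> x)"
          unfolding Dt_m by (simp add: algebra_simps)
      qed
      also have "\<dots> = - L2_inner (\<lambda>x. u t x * Dx (m t) x) \<phi> - 2 * L2_inner (\<lambda>x. Dx (u t) x * m t x) \<phi>"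
        unfolding L2_inner_int01 using bm by (subst int01_add) (simp_all only: int01_cmult bmeas_mult bmeas_const)
      finally have 1: "L2_inner (Dt T m t) \<phi> = \<dots>" .
      have 2: "L2_inner (f' t) \<phi> = L2_inner (Dt T m t) \<phi> - L2_inner (Dt T mh t) \<phi>"
        unfolding f'_def[abs_def] using bm by (intro L2.B_diff) simp_all
      have 3: "L2_inner (\<lambda>x. u t x * Dx (m t) x - uh t x * Dx (mh t) x) \<phi> =
          L2_inner (\<lambda>x. u t x * Dx (m t) x) \<phi> - L2_inner (\<lambda>x. uh t x * Dx (mh t) x) \<phi>"
        using bm by (intro L2.B_diff) simp_all
      have 4: "L2_inner (\<lambda>x. Dx (u t) x * m t x - Dx (uh t) x * mh t x) \<phi> =
          L2_inner (\<lambda>x. Dx (u t) x * m t x) \<phi> - L2_inner (\<lambda>x. Dx (uh t) x * mh t x) \<phi>"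
        using bm by (intro L2.B_diff) simp_all
      show ?thesis
        unfolding error_setting.rhs_def[OF E[OF t]] 2 1 evol[OF t \<phi>] 3 4 by simp
    qed
    have init: "L2_norm (\<lambda>x. pm 0 x - mh 0 x) = 0"
    proof -
      have z0: "0 \<in> {0..T}" using T by simp
      define w where "w x = pm 0 x - mh 0 x" for x
      have pmS: "pm 0 \<in> ?S" using pm z0 by blast
      have w: "w \<in> ?S"
        unfolding w_def[abs_def] by (rule fe_space0_diff[OF z pmS mhS[OF z0]])
      note bm = bu(3)[OF z0] bS(1)[OF pmS] bS(1)[OF mhS[OF z0]] bS(1)[OF w]
      have "L2_inner w w = L2_inner (pm 0) w - L2_inner (mh 0) w"
        unfolding w_def[abs_def] using bm by (intro L2.B_diff) (simp_all add: w_def[abs_def])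
      also have "L2_inner (pm 0) w = L2_inner (m 0) w"
        using pm z0 w L2.B_diff[of "m 0" "pm 0" w] bm by simp
      also have "L2_inner (mh 0) w = L2_inner (m 0) w"
        unfolding mh0[OF w] unfolding L2_inner_int01 by (intro int01_cong) (simp add: m_init)
      finally show ?thesis
        by (simp add: L2_norm_def w_def[abs_def])
    qed
    have "theta_const T C M \<kappa> * max_mesh N z \<le> E1 * (1 / (E1 + 1))"
      unfolding E1_def[symmetric] using small E1 by (intro mult_left_mono) (auto simp: h0_def)
    also have "\<dots> < 1"
      using E1 by simp
    finally have "theta_const T C M \<kappa> * max_mesh N z < 1" .
    moreover have bf: "bmeas (f' t)" if "t \<in> {0..T}" for t
      unfolding f'_def[abs_def] using bDt[OF that] by simp
    ultimately have "L2_norm (\<lambda>x. u t x - uh t x) \<le> A * (sqrt (max_mesh N z) * max_mesh N z ^ (r - 1))"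
      unfolding A_def by (intro semidiscrete_error[OF T E bf lim eq init _ t])
    also have "sqrt (max_mesh N z) * max_mesh N z ^ (r - 1) = max_mesh N z powr (real r - 1 / 2)"
    proof -
      have "sqrt (max_mesh N z) * max_mesh N z ^ (r - 1) = max_mesh N z powr (1 / 2) * max_mesh N z powr real (r - 1)"
        using h by (simp add: powr_half_sqrt powr_realpow)
      also have "\<dots> = max_mesh N z powr (real r - 1 / 2)"
        unfolding powr_add[symmetric] using assms by (simp add: of_nat_diff)
      finally show ?thesis .
    qed
    finally show ?thesis .
  qed
  then show "\<exists>C. \<exists>h0>0. \<forall>(N, z)\<in>F. max_mesh N z \<le> h0 \<longrightarrow>
        (\<forall>mh uh. semidiscrete_solution T (fe_space0 r \<mu> N z) u0 mh uh \<longrightarrow>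
          (\<forall>t\<in>{0..T}. L2_norm (\<lambda>x. u t x - uh t x) \<le> C * max_mesh N z powr (real r - 1 / 2)))"
    using h0 by (intro exI[of _ A] exI[of _ h0]) auto
qed

end
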